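(* Let $0<\gamma\le\infty$, $I=[0,\gamma)$, let $w$ be a weight function on $I$, with $W(\infty)=\infty$ if $\gamma=\infty$, and let $\varphi$ be an Orlicz $N$-function. Suppose that $\varphi$ satisfies the $\Delta_2$ condition if $\gamma=\infty$, or that $\varphi$ satisfies the $\Delta_2^\infty$ condition if $\gamma<\infty$. Then the Orlicz-Lorentz space $\Lambda_{\varphi,w}$ is a separable dual space. Consequently, $\Lambda_{\varphi,w}$ has the Radon-Nikodým property.
   Context: Decreasing means non-increasing. $L^0=L^0(I)$ is the set of all (classes of a.e. equal) Lebesgue measurable functions $x:I\to\mathbb{R}$; $m$ is Lebesgue measure. For $x\in L^0$, $d_x(\lambda)=m\{t\in I:|x(t)|>\lambda\}$, $\lambda\ge 0$, and $x^*(t)=\inf\{\lambda\ge 0: d_x(\lambda)\le t\}$, $t\ge 0$, is the decreasing rearrangement (values in $[0,\infty]$, $\inf\emptyset=\infty$). A weight function is a decreasing function $w:I\to(0,\infty)$ that is locally integrable: $W(t)=\int_0^t w<\infty$ for all $t\in I$; if $\gamma=\infty$, $W(\infty)=\int_0^\infty w$. An Orlicz function is a convex $\varphi:[0,\infty)\to[0,\infty)$ with $\varphi(0)=0$ and $\varphi(u)>0$ for $u>0$ (and $\varphi(\infty)=\infty$). It is an Orlicz $N$-function if moreover $\lim_{u\to 0^+}\varphi(u)/u=0$ and $\lim_{u\to\infty}\varphi(u)/u=\infty$. $\varphi$ satisfies $\Delta_2$ if there is $K>0$ with $\varphi(2u)\le K\varphi(u)$ for all $u\ge 0$; it satisfies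 $\Delta_2^\infty$ if there are $K>0$, $u_0\ge 0$ with $\varphi(2u)\le K\varphi(u)$ for all $u\ge u_0$. For $x\in L^0$ let $\rho(x)=\int_0^\gamma\varphi(x^*(t))w(t)\,dt$. The Orlicz-Lorentz space is $\Lambda_{\varphi,w}=\{x\in L^0:\rho(\lambda x)<\infty\text{ for some }\lambda>0\}$, a real Banach space with the Luxemburg norm $\|x\|=\inf\{\epsilon>0:\rho(x/\epsilon)\le 1\}$. A dual space is a Banach space isometrically isomorphic to $X^*$ for some Banach space $X$. *)

theory Defs
  imports "HOL-Analysis.Analysis" "HOL-Algebra.Module"
begin

section \<open>Real Banach spaces with an explicit carrier\<close>

text \<open>
  The Orlicz-Lorentz space depends on the parameters \<open>\<gamma>\<close>, \<open>w\<close>, \<open>\<phi>\<close>, and a predual is quantified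
  existentially, so neither can be an instance of the type class \<open>banach\<close>. A real vector space is
  an HOL-Algebra module over the ring of real numbers; the record fields \<open>mult\<close> and \<open>one\<close>, which
  every module record inherits from the ring record, carry no information.
\<close>

definition real_ring :: "real ring" where
  "real_ring = \<lparr>carrier = UNIV, mult = (*), one = 1, zero = 0, add = (+)\<rparr>"

record 'v normed_structure = "(real, 'v) module" +
  nrm :: "'v \<Rightarrow> real"

definition normed_vector_space :: "'v normed_structure \<Rightarrow> bool" where
  "normed_vector_space V \<longleftrightarrow>
     module real_ring V \<and>
     (\<forall>x\<in>carrier V. 0 \<le> nrm V x \<and> (nrm V x = 0 \<longleftrightarrow> x = \<zero>\<^bsub>V\<^esub>)) \<and>
     (\<forall>a. \<forall>x\<in>carrier V. nrm V (a \<odot>\<^bsub>V\<^esub> x) = \<bar>a\<bar> * nrm V x) \<and>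
     (\<forall>x\<in>carrier V. \<forall>y\<in>carrier V. nrm V (x \<oplus>\<^bsub>V\<^esub> y) \<le> nrm V x + nrm V y)"

text \<open>
  \<open>Metric_space\<close> asks for a nonnegative and symmetric distance on the whole type, hence the
  value \<open>0\<close> off the carrier.
\<close>

definition nrm_dist :: "'v normed_structure \<Rightarrow> 'v \<Rightarrow> 'v \<Rightarrow> real" where
  "nrm_dist V x y =
     (if x \<in> carrier V \<and> y \<in> carrier V then nrm V (x \<ominus>\<^bsub>V\<^esub> y) else 0)"

definition nrm_topology :: "'v normed_structure \<Rightarrow> 'v topology" where
  "nrm_topology V = Metric_space.mtopology (carrier V) (nrm_dist V)"

definition banach_space :: "'v normed_structure \<Rightarrow> bool" where
  "banach_space V \<longleftrightarrow>
     normed_vector_space V \<and> Metric_space.mcomplete (carrier V) (nrm_dist V)"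

definition separable_normed :: "'v normed_structure \<Rightarrow> bool" where
  "separable_normed V \<longleftrightarrow> separable_space (nrm_topology V)"

section \<open>Dual spaces\<close>

definition bounded_functional :: "'v normed_structure \<Rightarrow> ('v \<Rightarrow> real) \<Rightarrow> bool" where
  "bounded_functional V f \<longleftrightarrow>
     (\<forall>x\<in>carrier V. \<forall>y\<in>carrier V. f (x \<oplus>\<^bsub>V\<^esub> y) = f x + f y) \<and>
     (\<forall>a. \<forall>x\<in>carrier V. f (a \<odot>\<^bsub>V\<^esub> x) = a * f x) \<and>
     (\<exists>C. \<forall>x\<in>carrier V. \<bar>f x\<bar> \<le> C * nrm V x)"

text \<open>
  Functionals are extensional, so that equality of functionals is equality on the carrier.
\<close>

definition dual :: "'v normed_structure \<Rightarrow> ('v \<Rightarrow> real) normed_structure" where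
  "dual V = \<lparr>carrier = {f \<in> extensional (carrier V). bounded_functional V f},
     mult = undefined, one = undefined,
     zero = (\<lambda>x\<in>carrier V. 0),
     add = (\<lambda>f g. \<lambda>x\<in>carrier V. f x + g x),
     smult = (\<lambda>a f. \<lambda>x\<in>carrier V. a * f x),
     nrm = (\<lambda>f. SUP x\<in>{x \<in> carrier V. nrm V x \<le> 1}. \<bar>f x\<bar>)\<rparr>"

definition isometrically_isomorphic :: "'v normed_structure \<Rightarrow> 'u normed_structure \<Rightarrow> bool" where
  "isometrically_isomorphic V U \<longleftrightarrow>
     (\<exists>T. bij_betw T (carrier V) (carrier U) \<and>
          (\<forall>x\<in>carrier V. \<forall>y\<in>carrier V. T (x \<oplus>\<^bsub>V\<^esub> y) = T x \<oplus>\<^bsub>U\<^esub> T y) \<and>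
          (\<forall>a. \<forall>x\<in>carrier V. T (a \<odot>\<^bsub>V\<^esub> x) = a \<odot>\<^bsub>U\<^esub> T x) \<and>
          (\<forall>x\<in>carrier V. nrm U (T x) = nrm V x))"

text \<open>
  HOL has no existential quantifier over types; the type argument names the type that supplies
  the points of the predual. The carrier of the predual may be any subset of that type.
\<close>

definition is_dual_space :: "'x itself \<Rightarrow> 'v normed_structure \<Rightarrow> bool" where
  "is_dual_space _ V \<longleftrightarrow>
     banach_space V \<and>
     (\<exists>X :: 'x normed_structure. banach_space X \<and> isometrically_isomorphic V (dual X))"

section \<open>The Radon-Nikodym property\<close>

definition simple_fun :: "'b measure \<Rightarrow> 'v normed_structure \<Rightarrow> ('b \<Rightarrow> 'v) \<Rightarrow> bool" where
  "simple_fun M V s \<longleftrightarrow>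
     s \<in> space M \<rightarrow> carrier V \<and> finite (s ` space M) \<and>
     (\<forall>v. s -` {v} \<inter> space M \<in> sets M)"

definition simple_integral_on ::
    "'b measure \<Rightarrow> 'v normed_structure \<Rightarrow> 'b set \<Rightarrow> ('b \<Rightarrow> 'v) \<Rightarrow> 'v" where
  "simple_integral_on M V E s =
     (\<Oplus>\<^bsub>V\<^esub>v\<in>s ` space M. measure M (s -` {v} \<inter> E) \<odot>\<^bsub>V\<^esub> v)"

definition strongly_measurable :: "'b measure \<Rightarrow> 'v normed_structure \<Rightarrow> ('b \<Rightarrow> 'v) \<Rightarrow> bool" where
  "strongly_measurable M V f \<longleftrightarrow>
     f \<in> space M \<rightarrow> carrier V \<and>
     (\<exists>s. (\<forall>n::nat. simple_fun M V (s n)) \<and>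
          (AE x in M. (\<lambda>n. nrm V (s n x \<ominus>\<^bsub>V\<^esub> f x)) \<longlonglongrightarrow> 0))"

text \<open>
  \<open>f\<close> is Bochner integrable over the finite measure space \<open>M\<close>, and its integral over \<open>E\<close> is \<open>v\<close>.
\<close>

definition has_bochner_integral_on ::
    "'b measure \<Rightarrow> 'v normed_structure \<Rightarrow> ('b \<Rightarrow> 'v) \<Rightarrow> 'b set \<Rightarrow> 'v \<Rightarrow> bool" where
  "has_bochner_integral_on M V f E v \<longleftrightarrow>
     strongly_measurable M V f \<and> v \<in> carrier V \<and>
     (\<exists>s. (\<forall>n::nat. simple_fun M V (s n)) \<and>
          (\<lambda>n. \<integral>\<^sup>+x. ennreal (nrm V (s n x \<ominus>\<^bsub>V\<^esub> f x)) \<partial>M) \<longlonglongrightarrow> 0 \<and>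
          (\<lambda>n. nrm V (simple_integral_on M V E (s n) \<ominus>\<^bsub>V\<^esub> v)) \<longlonglongrightarrow> 0)"

definition vector_measure :: "'b measure \<Rightarrow> 'v normed_structure \<Rightarrow> ('b set \<Rightarrow> 'v) \<Rightarrow> bool" where
  "vector_measure M V G \<longleftrightarrow>
     G \<in> sets M \<rightarrow> carrier V \<and>
     (\<forall>A :: nat \<Rightarrow> 'b set. range A \<subseteq> sets M \<longrightarrow> disjoint_family A \<longrightarrow>
        (\<lambda>n. nrm V ((\<Oplus>\<^bsub>V\<^esub>i\<in>{..<n}. G (A i)) \<ominus>\<^bsub>V\<^esub> G (\<Union>i. A i))) \<longlonglongrightarrow> 0)"

definition bounded_variation :: "'b measure \<Rightarrow> 'v normed_structure \<Rightarrow> ('b set \<Rightarrow> 'v) \<Rightarrow> bool" where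
  "bounded_variation M V G \<longleftrightarrow>
     (\<exists>C. \<forall>P. finite P \<longrightarrow> P \<subseteq> sets M \<longrightarrow> disjoint P \<longrightarrow> \<Union>P = space M \<longrightarrow>
        (\<Sum>A\<in>P. nrm V (G A)) \<le> C)"

definition abs_continuous :: "'b measure \<Rightarrow> 'v normed_structure \<Rightarrow> ('b set \<Rightarrow> 'v) \<Rightarrow> bool" where
  "abs_continuous M V G \<longleftrightarrow> (\<forall>E\<in>sets M. emeasure M E = 0 \<longrightarrow> G E = \<zero>\<^bsub>V\<^esub>)"

text \<open>
  The type argument is the type of points of the finite measure spaces considered; a theorem
  stated for a type variable there covers all finite measure spaces.
\<close>

definition radon_nikodym_property :: "'b itself \<Rightarrow> 'v normed_structure \<Rightarrow> bool" where
  "radon_nikodym_property _ V \<longleftrightarrow>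
     (\<forall>M :: 'b measure. finite_measure M \<longrightarrow>
        (\<forall>G. vector_measure M V G \<and> bounded_variation M V G \<and> abs_continuous M V G \<longrightarrow>
           (\<exists>g. \<forall>E\<in>sets M. has_bochner_integral_on M V g E (G E))))"

section \<open>Orlicz functions and weights\<close>

definition orlicz_function :: "(real \<Rightarrow> real) \<Rightarrow> bool" where
  "orlicz_function \<phi> \<longleftrightarrow> convex_on {0..} \<phi> \<and> \<phi> 0 = 0 \<and> (\<forall>u>0. \<phi> u > 0)"

definition orlicz_N_function :: "(real \<Rightarrow> real) \<Rightarrow> bool" where
  "orlicz_N_function \<phi> \<longleftrightarrow>
     orlicz_function \<phi> \<and>
     ((\<lambda>u. \<phi> u / u) \<longlongrightarrow> 0) (at_right 0) \<and>
     filterlim (\<lambda>u. \<phi> u / u) at_top at_top"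

definition Delta2 :: "(real \<Rightarrow> real) \<Rightarrow> bool" where
  "Delta2 \<phi> \<longleftrightarrow> (\<exists>K>0. \<forall>u\<ge>0. \<phi> (2 * u) \<le> K * \<phi> u)"

definition Delta2_infty :: "(real \<Rightarrow> real) \<Rightarrow> bool" where
  "Delta2_infty \<phi> \<longleftrightarrow> (\<exists>K>0. \<exists>u0\<ge>0. \<forall>u\<ge>u0. \<phi> (2 * u) \<le> K * \<phi> u)"

definition orlicz_ext :: "(real \<Rightarrow> real) \<Rightarrow> ennreal \<Rightarrow> ennreal" where
  "orlicz_ext \<phi> u = (if u = \<infinity> then \<infinity> else ennreal (\<phi> (enn2real u)))"

definition half_open :: "ereal \<Rightarrow> real set" where
  "half_open \<gamma> = {t. 0 \<le> t \<and> ereal t < \<gamma>}"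

definition weight_primitive :: "(real \<Rightarrow> real) \<Rightarrow> ereal \<Rightarrow> ennreal" where
  "weight_primitive w t = (\<integral>\<^sup>+s\<in>half_open t. ennreal (w s) \<partial>lebesgue)"

text \<open>
  Nothing is required of \<open>w 0\<close>: were \<open>w\<close> finite and decreasing on \<open>[0,\<gamma>)\<close> including the
  endpoint \<open>0\<close>, it would be bounded, excluding weights such as \<open>t powr (p/q - 1)\<close> with \<open>p < q\<close>
  and making local integrability vacuous.
\<close>

definition weight_function :: "ereal \<Rightarrow> (real \<Rightarrow> real) \<Rightarrow> bool" where
  "weight_function \<gamma> w \<longleftrightarrow>
     (\<forall>t\<in>half_open \<gamma> - {0}. w t > 0) \<and> antimono_on (half_open \<gamma> - {0}) w \<and>
     (\<forall>t\<in>half_open \<gamma>. weight_primitive w (ereal t) < \<infinity>)"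

section \<open>Orlicz-Lorentz spaces\<close>

text \<open>
  Elements of \<open>L\<^sup>0\<close> are equivalence classes of functions on \<open>real\<close>; as the measure lives on
  \<open>[0,\<gamma>)\<close>, values outside that interval are identified as well.
\<close>

definition ae_rel :: "ereal \<Rightarrow> ((real \<Rightarrow> real) \<times> (real \<Rightarrow> real)) set" where
  "ae_rel \<gamma> = {(f, g). f \<in> borel_measurable (lebesgue_on (half_open \<gamma>)) \<and>
                        g \<in> borel_measurable (lebesgue_on (half_open \<gamma>)) \<and>
                        (AE t in lebesgue_on (half_open \<gamma>). f t = g t)}"

definition L0 :: "ereal \<Rightarrow> (real \<Rightarrow> real) set set" where
  "L0 \<gamma> = borel_measurable (lebesgue_on (half_open \<gamma>)) // ae_rel \<gamma>"

definition ae_class :: "ereal \<Rightarrow> (real \<Rightarrow> real) \<Rightarrow> (real \<Rightarrow> real) set" where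
  "ae_class \<gamma> f = ae_rel \<gamma> `` {f}"

definition rep :: "(real \<Rightarrow> real) set \<Rightarrow> real \<Rightarrow> real" where
  "rep x = (SOME f. f \<in> x)"

definition distribution :: "ereal \<Rightarrow> (real \<Rightarrow> real) \<Rightarrow> real \<Rightarrow> ennreal" where
  "distribution \<gamma> f l = emeasure lebesgue {t \<in> half_open \<gamma>. \<bar>f t\<bar> > l}"

definition rearrangement :: "ereal \<Rightarrow> (real \<Rightarrow> real) \<Rightarrow> real \<Rightarrow> ennreal" where
  "rearrangement \<gamma> f t = (INF l\<in>{l. 0 \<le> l \<and> distribution \<gamma> f l \<le> ennreal t}. ennreal l)"

definition modular ::
    "ereal \<Rightarrow> (real \<Rightarrow> real) \<Rightarrow> (real \<Rightarrow> real) \<Rightarrow> (real \<Rightarrow> real) \<Rightarrow> ennreal" where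
  "modular \<gamma> \<phi> w f =
     (\<integral>\<^sup>+t\<in>half_open \<gamma>. orlicz_ext \<phi> (rearrangement \<gamma> f t) * ennreal (w t) \<partial>lebesgue)"

definition orlicz_lorentz ::
    "ereal \<Rightarrow> (real \<Rightarrow> real) \<Rightarrow> (real \<Rightarrow> real) \<Rightarrow> (real \<Rightarrow> real) set normed_structure" where
  "orlicz_lorentz \<gamma> \<phi> w =
     \<lparr>carrier = {x \<in> L0 \<gamma>. \<exists>l>0. modular \<gamma> \<phi> w (\<lambda>t. l * rep x t) < \<infinity>},
      mult = undefined, one = undefined,
      zero = ae_class \<gamma> (\<lambda>_. 0),
      add = (\<lambda>x y. ae_class \<gamma> (\<lambda>t. rep x t + rep y t)),
      smult = (\<lambda>a x. ae_class \<gamma> (\<lambda>t. a * rep x t)),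
      nrm = (\<lambda>x. Inf {e. 0 < e \<and> modular \<gamma> \<phi> w (\<lambda>t. rep x t / e) \<le> 1})\<rparr>"

end

theory Submission
  imports Defs
begin

text \<open>
  The unit ball of the space is sequentially compact for a countable separating family of bounded functionals: the
  functionals \<open>x \<mapsto> \<integral> x s w\<close>, where \<open>s\<close> runs through the rational step functions. Compactness is obtained from convex
  combinations converging almost everywhere, the Fatou property of the modular, and uniform integrability with
  respect to \<open>w dt\<close>, which holds because \<open>\<phi>\<close> is superlinear and \<open>\<integral> \<phi>(|x|) w \<le> \<rho>(x)\<close>. By a finite-dimensional
  separation argument (Helly), compactness of the ball makes the space the dual of the closed span of these functionals.

  The layer cake formula turns the modular into \<open>\<rho>(x) = \<integral>\<integral> min (m {\<phi>(|x|) > l}) (m {w > s}) dl ds\<close>, from which convexity,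
  the Fatou property and, under the \<open>\<Delta>\<^sub>2\<close> condition, order continuity follow. Order continuity and density of step
  functions give separability.

  For the Radon-Nikodym property, the scalar densities of a vector measure along the countable family are combined
  pointwise by Helly's theorem; their supremum over the norming rational combinations is integrable because of the
  bounded variation, and separability makes the resulting weakly measurable function strongly measurable.
\<close>

section \<open>Normed spaces\<close>

text \<open>No concrete predual is described, and Hahn-Banach is replaced by compactness: once the
  ball is sequentially compact, countably many rational combinations are norming, and vectors with
  prescribed values exist as soon as these combinations are bounded. Two obstacles shape the rest.
  The decreasing rearrangement is not additive, so convexity of the modular cannot be read off its
  definition; in the double integral it reduces to subadditivity of the integral of a rearrangement
  over an initial interval, which is a minimum over thresholds and therefore easy to add. Moreover a
  bounded sequence of functions may have no almost everywhere convergent subsequence, whereas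
  suitable convex combinations of its tails converge and keep the limits of all functionals.
  Superlinearity of \<open>\<phi>\<close> forbids the concentration of mass known from L^1 and lets
  integrals against bounded functions pass to the limit. The growth condition makes the functions of
  finite modular a vector space with an order continuous norm. Points of a predual must belong to a
  type fixed in advance; separability makes room for them there.\<close>

lemma real_ring_simps [simp]:
  "carrier real_ring = UNIV" "x \<otimes>\<^bsub>real_ring\<^esub> y = x * y" "\<one>\<^bsub>real_ring\<^esub> = 1"
  "\<zero>\<^bsub>real_ring\<^esub> = 0" "x \<oplus>\<^bsub>real_ring\<^esub> y = x + y"
  by (simp_all add: real_ring_def)

lemma cring_real_ring: "cring real_ring"
proof -
  have "\<exists>y. x + y = 0" for x :: real
    by (metis add.right_inverse)
  then show ?thesis
    by (intro cringI abelian_groupI comm_monoidI) (auto simp: algebra_simps)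
qed

lemma normed_vector_spaceI:
  assumes "\<And>x y. x \<in> carrier V \<Longrightarrow> y \<in> carrier V \<Longrightarrow> x \<oplus>\<^bsub>V\<^esub> y \<in> carrier V"
    and "\<zero>\<^bsub>V\<^esub> \<in> carrier V"
    and "\<And>a x. x \<in> carrier V \<Longrightarrow> a \<odot>\<^bsub>V\<^esub> x \<in> carrier V"
    and "\<And>x y z. x \<in> carrier V \<Longrightarrow> y \<in> carrier V \<Longrightarrow> z \<in> carrier V \<Longrightarrow>
          (x \<oplus>\<^bsub>V\<^esub> y) \<oplus>\<^bsub>V\<^esub> z = x \<oplus>\<^bsub>V\<^esub> (y \<oplus>\<^bsub>V\<^esub> z)"
    and "\<And>x y. x \<in> carrier V \<Longrightarrow> y \<in> carrier V \<Longrightarrow> x \<oplus>\<^bsub>V\<^esub> y = y \<oplus>\<^bsub>V\<^esub> x"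
    and "\<And>x. x \<in> carrier V \<Longrightarrow> \<zero>\<^bsub>V\<^esub> \<oplus>\<^bsub>V\<^esub> x = x"
    and "\<And>x. x \<in> carrier V \<Longrightarrow> (-1) \<odot>\<^bsub>V\<^esub> x \<oplus>\<^bsub>V\<^esub> x = \<zero>\<^bsub>V\<^esub>"
    and "\<And>a b x. x \<in> carrier V \<Longrightarrow> (a + b) \<odot>\<^bsub>V\<^esub> x = a \<odot>\<^bsub>V\<^esub> x \<oplus>\<^bsub>V\<^esub> b \<odot>\<^bsub>V\<^esub> x"
    and "\<And>a x y. x \<in> carrier V \<Longrightarrow> y \<in> carrier V \<Longrightarrow>
          a \<odot>\<^bsub>V\<^esub> (x \<oplus>\<^bsub>V\<^esub> y) = a \<odot>\<^bsub>V\<^esub> x \<oplus>\<^bsub>V\<^esub> a \<odot>\<^bsub>V\<^esub> y"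
    and "\<And>a b x. x \<in> carrier V \<Longrightarrow> (a * b) \<odot>\<^bsub>V\<^esub> x = a \<odot>\<^bsub>V\<^esub> (b \<odot>\<^bsub>V\<^esub> x)"
    and "\<And>x. x \<in> carrier V \<Longrightarrow> 1 \<odot>\<^bsub>V\<^esub> x = x"
    and "\<And>x. x \<in> carrier V \<Longrightarrow> 0 \<le> nrm V x"
    and "\<And>x. x \<in> carrier V \<Longrightarrow> nrm V x = 0 \<longleftrightarrow> x = \<zero>\<^bsub>V\<^esub>"
    and "\<And>a x. x \<in> carrier V \<Longrightarrow> nrm V (a \<odot>\<^bsub>V\<^esub> x) = \<bar>a\<bar> * nrm V x"
    and "\<And>x y. x \<in> carrier V \<Longrightarrow> y \<in> carrier V \<Longrightarrow> nrm V (x \<oplus>\<^bsub>V\<^esub> y) \<le> nrm V x + nrm V y"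
  shows "normed_vector_space V"
proof -
  have "abelian_group V"
    using assms(1-7) by (intro abelian_groupI) (blast+)
  then have "module real_ring V"
    using assms(1-11) by (intro moduleI cring_real_ring) auto
  then show ?thesis
    unfolding normed_vector_space_def using assms(12-15) by blast
qed

locale normed_space =
  fixes V :: "'v normed_structure"
  assumes nvs: "normed_vector_space V"
begin

sublocale module real_ring V
  using nvs unfolding normed_vector_space_def by blast

lemma nrm_nonneg [simp]: "x \<in> carrier V \<Longrightarrow> 0 \<le> nrm V x"
  and nrm_eq_0 [simp]: "x \<in> carrier V \<Longrightarrow> nrm V x = 0 \<longleftrightarrow> x = \<zero>\<^bsub>V\<^esub>"
  and nrm_smult [simp]: "x \<in> carrier V \<Longrightarrow> nrm V (a \<odot>\<^bsub>V\<^esub> x) = \<bar>a\<bar> * nrm V x"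
  and nrm_add: "x \<in> carrier V \<Longrightarrow> y \<in> carrier V \<Longrightarrow> nrm V (x \<oplus>\<^bsub>V\<^esub> y) \<le> nrm V x + nrm V y"
  using nvs unfolding normed_vector_space_def by blast+

lemma smult_mem [simp, intro]: "x \<in> carrier V \<Longrightarrow> a \<odot>\<^bsub>V\<^esub> x \<in> carrier V"
  by (rule smult_closed) auto

lemma uminus_eq: "x \<in> carrier V \<Longrightarrow> \<ominus>\<^bsub>V\<^esub> x = (-1) \<odot>\<^bsub>V\<^esub> x"
proof -
  assume x: "x \<in> carrier V"
  have "(-1) \<odot>\<^bsub>V\<^esub> x \<oplus>\<^bsub>V\<^esub> x = (-1 + 1) \<odot>\<^bsub>V\<^esub> x"
    using x smult_l_distr[of "-1" 1 x] smult_one[of x] by simp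
  also have "\<dots> = \<zero>\<^bsub>V\<^esub>"
    using smult_l_null[OF x] by simp
  finally show ?thesis
    using x by (intro M.minus_equality) auto
qed

lemma minus_eq_smult: "x \<in> carrier V \<Longrightarrow> y \<in> carrier V \<Longrightarrow> x \<ominus>\<^bsub>V\<^esub> y = x \<oplus>\<^bsub>V\<^esub> (-1) \<odot>\<^bsub>V\<^esub> y"
  by (simp add: a_minus_def uminus_eq)

lemma minus_mem [simp, intro]: "x \<in> carrier V \<Longrightarrow> y \<in> carrier V \<Longrightarrow> x \<ominus>\<^bsub>V\<^esub> y \<in> carrier V"
  by (simp add: minus_eq_smult)

lemma nrm_zero [simp]: "nrm V \<zero>\<^bsub>V\<^esub> = 0"
  by simp

lemma minus_eq_zero: "x \<in> carrier V \<Longrightarrow> y \<in> carrier V \<Longrightarrow> x \<ominus>\<^bsub>V\<^esub> y = \<zero>\<^bsub>V\<^esub> \<longleftrightarrow> x = y"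
  by (metis M.add.inv_closed M.minus_equality M.minus_minus M.r_neg a_minus_def)

lemma minus_swap: "x \<in> carrier V \<Longrightarrow> y \<in> carrier V \<Longrightarrow> x \<ominus>\<^bsub>V\<^esub> y = (-1) \<odot>\<^bsub>V\<^esub> (y \<ominus>\<^bsub>V\<^esub> x)"
  by (metis M.add.inv_closed M.a_comm M.minus_add M.minus_minus a_minus_def minus_mem uminus_eq)

lemma nrm_minus_commute: "x \<in> carrier V \<Longrightarrow> y \<in> carrier V \<Longrightarrow> nrm V (x \<ominus>\<^bsub>V\<^esub> y) = nrm V (y \<ominus>\<^bsub>V\<^esub> x)"
  by (subst minus_swap) auto

lemma minus_add_minus:
  "x \<in> carrier V \<Longrightarrow> y \<in> carrier V \<Longrightarrow> z \<in> carrier V \<Longrightarrow>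
     (x \<ominus>\<^bsub>V\<^esub> y) \<oplus>\<^bsub>V\<^esub> (y \<ominus>\<^bsub>V\<^esub> z) = x \<ominus>\<^bsub>V\<^esub> z"
  by (simp add: a_minus_def M.a_assoc M.r_neg1)

lemma nrm_triangle:
  "x \<in> carrier V \<Longrightarrow> y \<in> carrier V \<Longrightarrow> z \<in> carrier V \<Longrightarrow>
     nrm V (x \<ominus>\<^bsub>V\<^esub> z) \<le> nrm V (x \<ominus>\<^bsub>V\<^esub> y) + nrm V (y \<ominus>\<^bsub>V\<^esub> z)"
  using nrm_add[of "x \<ominus>\<^bsub>V\<^esub> y" "y \<ominus>\<^bsub>V\<^esub> z"] minus_add_minus[of x y z] by auto

lemma metric: "Metric_space (carrier V) (nrm_dist V)"
proof
  fix x y z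
  show "0 \<le> nrm_dist V x y"
    by (simp add: nrm_dist_def)
  show "nrm_dist V x y = nrm_dist V y x"
    by (simp add: nrm_dist_def nrm_minus_commute)
  show "x \<in> carrier V \<Longrightarrow> y \<in> carrier V \<Longrightarrow> (nrm_dist V x y = 0) = (x = y)"
    by (simp add: nrm_dist_def minus_eq_zero)
  show "x \<in> carrier V \<Longrightarrow> y \<in> carrier V \<Longrightarrow> z \<in> carrier V \<Longrightarrow>
     nrm_dist V x z \<le> nrm_dist V x y + nrm_dist V y z"
    by (simp add: nrm_dist_def nrm_triangle)
qed

lemma mcompleteI:
  assumes "\<And>x. range x \<subseteq> carrier V \<Longrightarrow>
      (\<And>e. e > 0 \<Longrightarrow> \<exists>N::nat. \<forall>m n. N \<le> m \<longrightarrow> N \<le> n \<longrightarrow> nrm V (x m \<ominus>\<^bsub>V\<^esub> x n) < e) \<Longrightarrow>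
      \<exists>l\<in>carrier V. (\<lambda>n. nrm V (x n \<ominus>\<^bsub>V\<^esub> l)) \<longlonglongrightarrow> 0"
  shows "Metric_space.mcomplete (carrier V) (nrm_dist V)"
proof -
  interpret Metric_space "carrier V" "nrm_dist V" by (rule metric)
  show ?thesis
    unfolding mcomplete_def
  proof (intro allI impI)
    fix x assume "MCauchy x"
    then have x: "range x \<subseteq> carrier V"
      and c: "\<And>e. e > 0 \<Longrightarrow> \<exists>N. \<forall>m n. N \<le> m \<longrightarrow> N \<le> n \<longrightarrow> nrm_dist V (x m) (x n) < e"
      unfolding MCauchy_def by blast+
    have xc: "x n \<in> carrier V" for n using x by auto
    obtain l where l: "l \<in> carrier V" "(\<lambda>n. nrm V (x n \<ominus>\<^bsub>V\<^esub> l)) \<longlonglongrightarrow> 0"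
      using assms[OF x] c xc unfolding nrm_dist_def by auto
    have "limitin mtopology x l sequentially"
      unfolding limit_metric_sequentially
    proof (intro conjI allI impI)
      fix e :: real assume "e > 0"
      then obtain N where "\<And>n. n \<ge> N \<Longrightarrow> norm (nrm V (x n \<ominus>\<^bsub>V\<^esub> l)) < e"
        using LIMSEQ_D[OF l(2)] by fastforce
      then show "\<exists>N. \<forall>n\<ge>N. x n \<in> carrier V \<and> nrm_dist V (x n) l < e"
        using xc l by (auto simp: nrm_dist_def intro!: exI[of _ N])
    qed (rule l)
    then show "\<exists>l. limitin mtopology x l sequentially" ..
  qed
qed

lemma separable_normed_iff:
  "separable_normed V \<longleftrightarrow>
     (\<exists>D. countable D \<and> D \<subseteq> carrier V \<and> (\<forall>x\<in>carrier V. \<forall>e>0. \<exists>y\<in>D. nrm V (x \<ominus>\<^bsub>V\<^esub> y) < e))"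
proof -
  interpret Metric_space "carrier V" "nrm_dist V" by (rule metric)
  have "mtopology closure_of D = carrier V \<longleftrightarrow> (\<forall>x\<in>carrier V. \<forall>e>0. \<exists>y\<in>D. nrm V (x \<ominus>\<^bsub>V\<^esub> y) < e)"
    if "D \<subseteq> carrier V" for D
    using that unfolding metric_closure_of
    by (auto simp: in_mball nrm_dist_def set_eq_iff subset_iff) blast+
  then show ?thesis
    unfolding separable_normed_def separable_space_def nrm_topology_def topspace_mtopology by metis
qed

end

section \<open>Bounded linear functionals\<close>

locale normed_functional = normed_space V for V :: "'v normed_structure" +
  fixes f :: "'v \<Rightarrow> real"
  assumes bounded_functional: "bounded_functional V f"
begin

lemma f_add [simp]: "x \<in> carrier V \<Longrightarrow> y \<in> carrier V \<Longrightarrow> f (x \<oplus>\<^bsub>V\<^esub> y) = f x + f y"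
  and f_smult [simp]: "x \<in> carrier V \<Longrightarrow> f (a \<odot>\<^bsub>V\<^esub> x) = a * f x"
  using bounded_functional unfolding bounded_functional_def by blast+

lemma f_minus [simp]: "x \<in> carrier V \<Longrightarrow> y \<in> carrier V \<Longrightarrow> f (x \<ominus>\<^bsub>V\<^esub> y) = f x - f y"
  by (simp add: minus_eq_smult)

lemma f_zero [simp]: "f \<zero>\<^bsub>V\<^esub> = 0"
  using f_add[of "\<zero>\<^bsub>V\<^esub>" "\<zero>\<^bsub>V\<^esub>"] by simp

lemma f_finsum: "finite A \<Longrightarrow> g \<in> A \<rightarrow> carrier V \<Longrightarrow> f (\<Oplus>\<^bsub>V\<^esub>i\<in>A. g i) = (\<Sum>i\<in>A. f (g i))"
proof (induction A rule: finite_induct)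
  case (insert a A)
  then have "g \<in> A \<rightarrow> carrier V" "g a \<in> carrier V" by auto
  with insert show ?case by simp
qed simp

lemma f_bounded: obtains C where "C > 0" "\<And>x. x \<in> carrier V \<Longrightarrow> \<bar>f x\<bar> \<le> C * nrm V x"
proof -
  obtain C where C: "\<And>x. x \<in> carrier V \<Longrightarrow> \<bar>f x\<bar> \<le> C * nrm V x"
    using bounded_functional unfolding bounded_functional_def by blast
  have "\<bar>f x\<bar> \<le> (max C 1) * nrm V x" if "x \<in> carrier V" for x
    using C[OF that] nrm_nonneg[OF that] by (smt (verit) mult_right_mono)
  then show thesis by (intro that[of "max C 1"]) auto
qed

lemma le_scale:
  assumes ball: "\<And>x. x \<in> carrier V \<Longrightarrow> nrm V x \<le> 1 \<Longrightarrow> \<bar>f x\<bar> \<le> C" and x: "x \<in> carrier V"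
  shows "\<bar>f x\<bar> \<le> C * nrm V x"
proof (cases "nrm V x = 0")
  case True
  then show ?thesis using x by simp
next
  case False
  then have pos: "nrm V x > 0" using x by (metis nrm_nonneg order_le_less)
  then have "\<bar>f ((1 / nrm V x) \<odot>\<^bsub>V\<^esub> x)\<bar> \<le> C"
    by (intro ball) (use x in auto)
  then have "\<bar>f x\<bar> / nrm V x \<le> C"
    using x pos by (simp add: abs_mult)
  then show ?thesis
    using pos by (simp add: field_simps)
qed

end

section \<open>Spaces whose unit ball is compact for countably many functionals\<close>

lemma bounded_functional_zero: "normed_vector_space V \<Longrightarrow> bounded_functional V (\<lambda>_. 0)"
  unfolding bounded_functional_def normed_vector_space_def by (auto intro!: exI[of _ 0])

lemma bounded_functional_add:
  assumes "bounded_functional V f" "bounded_functional V g"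
  shows "bounded_functional V (\<lambda>v. f v + g v)"
proof -
  obtain A B where "\<And>x. x \<in> carrier V \<Longrightarrow> \<bar>f x\<bar> \<le> A * nrm V x" "\<And>x. x \<in> carrier V \<Longrightarrow> \<bar>g x\<bar> \<le> B * nrm V x"
    using assms unfolding bounded_functional_def by blast
  then have "\<bar>f x + g x\<bar> \<le> (A + B) * nrm V x" if "x \<in> carrier V" for x
    using that by (smt (verit) distrib_right)
  then have "\<exists>C. \<forall>x\<in>carrier V. \<bar>f x + g x\<bar> \<le> C * nrm V x" by blast
  then show ?thesis
    using assms unfolding bounded_functional_def by (simp add: algebra_simps)
qed

lemma bounded_functional_cmult:
  assumes "bounded_functional V f"
  shows "bounded_functional V (\<lambda>v. a * f v)"
proof -
  obtain A where A: "\<And>x. x \<in> carrier V \<Longrightarrow> \<bar>f x\<bar> \<le> A * nrm V x"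
    using assms unfolding bounded_functional_def by blast
  have "\<bar>a * f x\<bar> \<le> (\<bar>a\<bar> * A) * nrm V x" if "x \<in> carrier V" for x
    using mult_left_mono[OF A[OF that], of "\<bar>a\<bar>"] by (simp add: abs_mult mult.assoc)
  then have "\<exists>C. \<forall>x\<in>carrier V. \<bar>a * f x\<bar> \<le> C * nrm V x" by blast
  then show ?thesis
    using assms unfolding bounded_functional_def by (simp add: algebra_simps)
qed

lemma bounded_functional_sum:
  assumes "normed_vector_space V" "\<And>i. i \<in> A \<Longrightarrow> bounded_functional V (f i)"
  shows "bounded_functional V (\<lambda>v. \<Sum>i\<in>A. f i v)"
  using assms(2)
proof (induction A rule: infinite_finite_induct)
  case (insert x F)
  then show ?case by (simp add: bounded_functional_add)
qed (auto intro: bounded_functional_zero[OF assms(1)])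

text \<open>Coefficient lists, unlike coefficient functions, form a countable set when the entries
  are rational. The argument \<open>a\<close> is either the sequence of values of the functionals at
  a vector or a sequence of prescribed values in Helly's theorem.\<close>

definition comb :: "real list \<Rightarrow> (nat \<Rightarrow> real) \<Rightarrow> real" where
  "comb c a = (\<Sum>i<length c. c ! i * a i)"

lemma comb_map_upt: "comb (map q [0..<n]) a = (\<Sum>i<n. q i * a i)"
  by (simp add: comb_def)

lemma comb_cmult: "comb (map ((*) r) c) a = r * comb c a"
  by (simp add: comb_def sum_distrib_left mult.assoc)

lemma comb_linear [simp]:
  "comb c (\<lambda>i. a i + b i) = comb c a + comb c b"
  "comb c (\<lambda>i. a i - b i) = comb c a - comb c b"
  "comb c (\<lambda>i. r * a i) = r * comb c a"
  "comb c (\<lambda>i. a i * r) = comb c a * r"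
  "comb c (\<lambda>i. - a i) = - comb c a"
  "comb c (\<lambda>i. 0) = 0"
  by (simp_all add: comb_def algebra_simps sum.distrib sum_subtractf sum_negf sum_distrib_left)

text \<open>Lists of different lengths are added after padding with zeros. One list serves all
  \<open>a\<close>, so the sum of two combinations of functionals is again such a
  combination.\<close>

lemma comb_add_ex: "\<exists>c. \<forall>a. comb c a = comb c1 a + comb c2 a"
proof -
  define q where "q c i = (if i < length c then c ! i else (0::real))" for c i
  have "(\<Sum>i<n. q c i * a i) = comb c a" if "length c \<le> n" for c n a
    unfolding comb_def q_def using that
    by (intro sum.mono_neutral_cong_right) auto
  then have "comb (map (\<lambda>i. q c1 i + q c2 i) [0..<max (length c1) (length c2)]) a = comb c1 a + comb c2 a" for a
    by (simp add: comb_map_upt algebra_simps sum.distrib)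
  then show ?thesis by blast
qed

lemma comb_tendsto: "(\<And>i. (\<lambda>n. a n i) \<longlonglongrightarrow> b i) \<Longrightarrow> (\<lambda>n. comb c (a n)) \<longlonglongrightarrow> comb c b"
  unfolding comb_def by (intro tendsto_intros)

text \<open>The common setting of the duality and the Radon-Nikodym arguments. Only countably many
  functionals occur, so the topology they induce on the ball is metrizable and compactness can be
  stated with subsequences.\<close>

locale weakly_compact_ball = normed_space V for V :: "'v normed_structure" +
  fixes p :: "nat \<Rightarrow> 'v \<Rightarrow> real"
  assumes p_bounded: "\<And>i. bounded_functional V (p i)"
    and p_separating: "\<And>v. v \<in> carrier V \<Longrightarrow> (\<And>i. p i v = 0) \<Longrightarrow> v = \<zero>\<^bsub>V\<^esub>"
    and ball_compact: "\<And>x. (\<And>n. x n \<in> carrier V) \<Longrightarrow> (\<And>n. nrm V (x n) \<le> 1) \<Longrightarrow>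
          \<exists>r v. strict_mono (r :: nat \<Rightarrow> nat) \<and> v \<in> carrier V \<and> nrm V v \<le> 1 \<and>
            (\<forall>i. (\<lambda>n. p i (x (r n))) \<longlonglongrightarrow> p i v)"
begin

sublocale p: normed_functional V "p i" for i
  by unfold_locales (rule p_bounded)

abbreviation pcomb :: "real list \<Rightarrow> 'v \<Rightarrow> real" where
  "pcomb c v \<equiv> comb c (\<lambda>i. p i v)"

sublocale pc: normed_functional V "pcomb c" for c
  by unfold_locales
    (auto simp: comb_def intro!: bounded_functional_sum[OF nvs] bounded_functional_cmult p_bounded)

lemma p_eqI: "u \<in> carrier V \<Longrightarrow> v \<in> carrier V \<Longrightarrow> (\<And>i. p i u = p i v) \<Longrightarrow> u = v"
  using p_separating[of "u \<ominus>\<^bsub>V\<^esub> v"] minus_eq_zero by auto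

text \<open>The rational combinations that lie in the unit ball of the dual. They turn out to be
  norming (\<open>norming\<close>), and being countable they turn norms into measurable
  suprema.\<close>

definition Q :: "real list set" where
  "Q = {c. set c \<subseteq> range of_rat \<and> (\<forall>v\<in>carrier V. nrm V v \<le> 1 \<longrightarrow> \<bar>pcomb c v\<bar> \<le> 1)}"

lemma countable_Q: "countable Q"
proof -
  have "Q \<subseteq> lists (range of_rat)" unfolding Q_def by auto
  then show ?thesis by (rule countable_subset) auto
qed

lemma Nil_Q: "[] \<in> Q"
  by (simp add: Q_def comb_def)

lemma Q_le: "c \<in> Q \<Longrightarrow> v \<in> carrier V \<Longrightarrow> \<bar>pcomb c v\<bar> \<le> nrm V v"
  using pc.le_scale[of c 1 v] unfolding Q_def by auto

lemma ball_compact_radius: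
  assumes x: "\<And>n. x n \<in> carrier V" and C: "\<And>n. nrm V (x n) \<le> C"
  shows "\<exists>r v. strict_mono (r :: nat \<Rightarrow> nat) \<and> v \<in> carrier V \<and> nrm V v \<le> C \<and>
            (\<forall>i. (\<lambda>n. p i (x (r n))) \<longlonglongrightarrow> p i v)"
proof (cases "C = 0")
  case True
  then have "x n = \<zero>\<^bsub>V\<^esub>" for n
    using C[of n] x[of n] by (metis nrm_eq_0 nrm_nonneg order_antisym)
  then show ?thesis
    using True by (intro exI[of _ id] exI[of _ "\<zero>\<^bsub>V\<^esub>"]) (auto simp: strict_mono_def)
next
  case False
  have "0 \<le> C" using C[of 0] x[of 0] nrm_nonneg by (meson order_trans)
  then have pos: "C > 0" using False by simp
  obtain r v where r: "strict_mono r" "v \<in> carrier V" "nrm V v \<le> 1"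
    "\<And>i. (\<lambda>n. p i ((1 / C) \<odot>\<^bsub>V\<^esub> x (r n))) \<longlonglongrightarrow> p i v"
    using ball_compact[of "\<lambda>n. (1 / C) \<odot>\<^bsub>V\<^esub> x n"] x C pos by auto
  have "(\<lambda>n. C * p i ((1 / C) \<odot>\<^bsub>V\<^esub> x (r n))) \<longlonglongrightarrow> C * p i v" for i
    by (intro tendsto_intros r)
  then show ?thesis
    using r pos x by (intro exI[of _ r] exI[of _ "C \<odot>\<^bsub>V\<^esub> v"]) auto
qed

text \<open>The sum depends on finitely many \<open>p i\<close>, all of which converge along a
  subsequence of a minimising sequence, so the limit vector attains the infimum.\<close>

lemma ball_minimum:
  assumes C: "0 \<le> C"
  obtains v where "v \<in> carrier V" "nrm V v \<le> C"
    "\<And>u. u \<in> carrier V \<Longrightarrow> nrm V u \<le> C \<Longrightarrow> (\<Sum>i<n. (a i - p i v)\<^sup>2) \<le> (\<Sum>i<n. (a i - p i u)\<^sup>2)"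
proof -
  define E where "E v = (\<Sum>i<n. (a i - p i v)\<^sup>2)" for v
  define S where "S = E ` {v \<in> carrier V. nrm V v \<le> C}"
  have "\<zero>\<^bsub>V\<^esub> \<in> {v \<in> carrier V. nrm V v \<le> C}" using C by auto
  then have ne: "S \<noteq> {}" unfolding S_def by blast
  have bdd: "bdd_below S"
    unfolding S_def E_def by (rule bdd_belowI[of _ 0]) (auto intro: sum_nonneg)
  have "\<exists>v\<in>carrier V. nrm V v \<le> C \<and> E v < Inf S + 1 / real (Suc k)" for k
    using cInf_lessD[OF ne, of "Inf S + 1 / real (Suc k)"] unfolding S_def by auto
  then obtain x where x: "\<And>k. x k \<in> carrier V" "\<And>k. nrm V (x k) \<le> C"
      "\<And>k. E (x k) < Inf S + 1 / real (Suc k)"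
    by metis
  obtain r v where r: "strict_mono r" and v: "v \<in> carrier V" "nrm V v \<le> C"
    and lim: "\<And>i. (\<lambda>n. p i (x (r n))) \<longlonglongrightarrow> p i v"
    using ball_compact_radius[of x C] x by blast
  have "(\<lambda>k. E (x (r k))) \<longlonglongrightarrow> E v"
    unfolding E_def by (intro tendsto_intros lim)
  moreover have "(\<lambda>k. Inf S + 1 / real (Suc (r k))) \<longlonglongrightarrow> Inf S + 0"
    using LIMSEQ_subseq_LIMSEQ[OF LIMSEQ_inverse_real_of_nat r]
    by (intro tendsto_intros) (simp add: o_def inverse_eq_divide)
  ultimately have "E v \<le> Inf S + 0"
    using x(3) by (intro LIMSEQ_le) (auto intro: less_imp_le)
  then have "E v \<le> E u" if "u \<in> carrier V" "nrm V u \<le> C" for u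
    using cInf_lower[OF _ bdd, of "E u"] that unfolding S_def by auto
  then show thesis
    using that v unfolding E_def by blast
qed

text \<open>If the minimum over the ball of \<open>\<Sum>i<n. (a i - p i v)\<^sup>2\<close> is positive, the coefficients \<open>a i - p i v\<close> at a minimiser
  separate \<open>a\<close> from the ball; they are then perturbed to rational ones.\<close>

lemma helly_finite:
  assumes C: "0 \<le> C" and a: "\<And>c. c \<in> Q \<Longrightarrow> \<bar>comb c a\<bar> \<le> C"
  shows "\<exists>v\<in>carrier V. nrm V v \<le> C \<and> (\<forall>i<n. p i v = a i)"
proof -
  obtain v0 where v0: "v0 \<in> carrier V" "nrm V v0 \<le> C"
    and vmin: "\<And>u. u \<in> carrier V \<Longrightarrow> nrm V u \<le> C \<Longrightarrow> (\<Sum>i<n. (a i - p i v0)\<^sup>2) \<le> (\<Sum>i<n. (a i - p i u)\<^sup>2)"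
    using ball_minimum[OF C] by blast
  define c where "c i = a i - p i v0" for i
  define d where "d = (\<Sum>i<n. (c i)\<^sup>2)"
  have "d \<ge> 0" unfolding d_def by (auto intro: sum_nonneg)
  have "\<not> d > 0"
  proof
    assume "d > 0"
    \<comment> \<open>First-order condition at the minimiser: moving from \<open>v0\<close> towards
      \<open>v\<close> by \<open>t\<close> changes the sum of squares by
      \<open>- 2 * t * s + t\<^sup>2 * L\<close>, which excludes \<open>s > 0\<close> when
      \<open>t\<close> is small.\<close>
    have var: "(\<Sum>i<n. c i * p i v) \<le> (\<Sum>i<n. c i * p i v0)" if v: "v \<in> carrier V" "nrm V v \<le> C" for v
    proof -
      define s where "s = (\<Sum>i<n. c i * (p i v - p i v0))"
      define L where "L = (\<Sum>i<n. (p i v - p i v0)\<^sup>2)"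
      have L: "L \<ge> 0" unfolding L_def by (auto intro: sum_nonneg)
      have le: "2 * s \<le> t * L" if t: "0 < t" "t \<le> 1" for t
      proof -
        define u where "u = (1 - t) \<odot>\<^bsub>V\<^esub> v0 \<oplus>\<^bsub>V\<^esub> t \<odot>\<^bsub>V\<^esub> v"
        have uV: "u \<in> carrier V" using v v0 unfolding u_def by auto
        have "nrm V u \<le> (1 - t) * nrm V v0 + t * nrm V v"
          using nrm_add[of "(1 - t) \<odot>\<^bsub>V\<^esub> v0" "t \<odot>\<^bsub>V\<^esub> v"] t v v0 unfolding u_def by auto
        also have "\<dots> \<le> (1 - t) * C + t * C"
          using t v v0 by (intro add_mono mult_left_mono) auto
        finally have "nrm V u \<le> C" by (simp add: algebra_simps)
        from vmin[OF uV this] have "d \<le> (\<Sum>i<n. (a i - p i u)\<^sup>2)"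
          unfolding d_def c_def .
        also have "\<dots> = (\<Sum>i<n. (c i)\<^sup>2 - 2 * t * (c i * (p i v - p i v0)) + t\<^sup>2 * (p i v - p i v0)\<^sup>2)"
          using v v0 unfolding u_def c_def
          by (intro sum.cong refl) (simp add: algebra_simps power2_eq_square)
        also have "\<dots> = d - 2 * t * s + t\<^sup>2 * L"
          by (simp add: d_def s_def L_def sum.distrib sum_subtractf sum_distrib_left)
        finally have "t * (2 * s) \<le> t * (t * L)"
          by (simp add: power2_eq_square algebra_simps)
        then show ?thesis using t by simp
      qed
      have "s \<le> 0"
      proof (rule ccontr)
        assume "\<not> s \<le> 0"
        then have s: "s > 0" by simp
        \<comment> \<open>With this \<open>t\<close> the bound \<open>2 * s \<le> t * L\<close>
          yields \<open>2 * s \<le> s\<close>; the summand 1 guards against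
          \<open>L = 0\<close>.\<close>
        define t where "t = min 1 (s / (L + 1))"
        have "t > 0" "t \<le> 1" using s L by (auto simp: t_def)
        then have "2 * s \<le> t * L" by (rule le)
        also have "\<dots> \<le> s / (L + 1) * L"
          using L by (intro mult_right_mono) (auto simp: t_def)
        also have "\<dots> \<le> s"
          using L s by (simp add: field_simps)
        finally show False using s by simp
      qed
      then show ?thesis
        by (simp add: s_def right_diff_distrib sum_subtractf)
    qed
    have "\<exists>K. K > 0 \<and> (\<forall>x\<in>carrier V. \<bar>p i x\<bar> \<le> K * nrm V x)" for i
      using p.f_bounded by metis
    then obtain K where K: "\<And>i. K i > 0" "\<And>i x. x \<in> carrier V \<Longrightarrow> \<bar>p i x\<bar> \<le> K i * nrm V x"
      by metis
    \<comment> \<open>\<open>T\<close> bounds the effect of a unit change in every coefficient, so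
      errors below \<open>\<tau>\<close> cost at most \<open>d / 2\<close>, half of the gap
      \<open>d\<close> between \<open>a\<close> and the ball.\<close>
    define T where "T = (\<Sum>i<n. K i * C + \<bar>a i\<bar>) + 1"
    have T: "T > 0"
      using K(1) C unfolding T_def by (intro add_nonneg_pos sum_nonneg add_nonneg_nonneg) (auto simp: less_imp_le)
    define \<tau> where "\<tau> = d / (2 * T)"
    have \<tau>: "\<tau> > 0" using T \<open>d > 0\<close> by (simp add: \<tau>_def)
    have "\<exists>q. \<bar>of_rat q - c i\<bar> < \<tau>" for i
    proof -
      obtain q where "c i < of_rat q" "of_rat q < c i + \<tau>"
        using of_rat_dense[of "c i" "c i + \<tau>"] \<tau> by auto
      then show ?thesis by (intro exI[of _ q]) auto
    qed
    then obtain q where q: "\<And>i. \<bar>of_rat (q i) - c i\<bar> < \<tau>" by metis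
    define l where "l = map (\<lambda>i. of_rat (q i) :: real) [0..<n]"
    define A where "A = comb l a"
    have main1: "pcomb l v + d / 2 \<le> A" if v: "v \<in> carrier V" "nrm V v \<le> C" for v
    proof -
      have summand: "(of_rat (q i) - c i) * (p i v - a i) \<le> \<tau> * (K i * C + \<bar>a i\<bar>)" for i
      proof -
        have "K i * nrm V v \<le> K i * C" using v K(1)[of i] by (intro mult_left_mono) auto
        then have "\<bar>p i v - a i\<bar> \<le> K i * C + \<bar>a i\<bar>"
          using K(2)[OF v(1), of i] by linarith
        then have "\<bar>of_rat (q i) - c i\<bar> * \<bar>p i v - a i\<bar> \<le> \<tau> * (K i * C + \<bar>a i\<bar>)"
          using q[of i] \<tau> by (intro mult_mono) auto
        then show ?thesis by (metis abs_ge_self abs_mult order_trans)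
      qed
      have "pcomb l v - A = (\<Sum>i<n. c i * p i v) - (\<Sum>i<n. c i * a i) + (\<Sum>i<n. (of_rat (q i) - c i) * (p i v - a i))"
        unfolding A_def l_def comb_map_upt sum_subtractf[symmetric] sum.distrib[symmetric]
        by (intro sum.cong refl) (simp add: algebra_simps)
      also have "\<dots> \<le> (\<Sum>i<n. c i * p i v0) - (\<Sum>i<n. c i * a i) + (\<Sum>i<n. \<tau> * (K i * C + \<bar>a i\<bar>))"
        by (rule add_mono[OF diff_right_mono[OF var[OF v]]]) (rule sum_mono, rule summand)
      also have "(\<Sum>i<n. c i * p i v0) - (\<Sum>i<n. c i * a i) = - d"
        unfolding d_def sum_subtractf[symmetric] sum_negf[symmetric]
        by (intro sum.cong refl) (simp add: c_def algebra_simps power2_eq_square)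
      also have "(\<Sum>i<n. \<tau> * (K i * C + \<bar>a i\<bar>)) \<le> \<tau> * T"
        unfolding T_def sum_distrib_left[symmetric] using \<tau> by (intro mult_left_mono) auto
      also have "\<tau> * T = d / 2" using T by (simp add: \<tau>_def)
      finally show ?thesis by simp
    qed
    \<comment> \<open>The ball is symmetric, so the bound at \<open>v\<close> and at its negative
      gives the absolute value.\<close>
    have main: "\<bar>pcomb l v\<bar> + d / 2 \<le> A" if v: "v \<in> carrier V" "nrm V v \<le> C" for v
      using main1[of v] main1[of "(-1) \<odot>\<^bsub>V\<^esub> v"] v by (auto simp: abs_if)
    have "A \<ge> d / 2" using main[of "\<zero>\<^bsub>V\<^esub>"] C by simp
    \<comment> \<open>\<open>r0\<close> bounds the combination on the unit ball while
      \<open>C * r0\<close> stays at least \<open>d / 2\<close> below \<open>A\<close>. For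
      \<open>C > 0\<close> it arises by rescaling the ball of radius \<open>C\<close>; for
      \<open>C = 0\<close> any bound will do.\<close>
    obtain r0 where r0: "r0 \<ge> 0" "C * r0 \<le> A - d / 2"
        "\<And>v. v \<in> carrier V \<Longrightarrow> nrm V v \<le> 1 \<Longrightarrow> \<bar>pcomb l v\<bar> \<le> r0"
    proof (cases "C = 0")
      case True
      obtain R where R: "R > 0" "\<And>x. x \<in> carrier V \<Longrightarrow> \<bar>pcomb l x\<bar> \<le> R * nrm V x"
        using pc.f_bounded by blast
      show thesis
      proof (rule that[of R])
        fix v assume "v \<in> carrier V" "nrm V v \<le> 1"
        then show "\<bar>pcomb l v\<bar> \<le> R"
          using R(2)[of v] mult_left_le[of "nrm V v" R] R(1) by linarith
      qed (use R True \<open>A \<ge> d / 2\<close> in auto)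
    next
      case False
      then have "C > 0" using C by simp
      show thesis
      proof (rule that[of "(A - d / 2) / C"])
        fix v assume "v \<in> carrier V" "nrm V v \<le> 1"
        then have "\<bar>pcomb l (C \<odot>\<^bsub>V\<^esub> v)\<bar> + d / 2 \<le> A"
          using \<open>C > 0\<close> mult_left_le[of "nrm V v" C] by (intro main) auto
        then show "\<bar>pcomb l v\<bar> \<le> (A - d / 2) / C"
          using \<open>C > 0\<close> \<open>v \<in> carrier V\<close> by (simp add: abs_mult field_simps)
      qed (use \<open>C > 0\<close> \<open>A \<ge> d / 2\<close> in auto)
    qed
    \<comment> \<open>Division by a rational number keeps the coefficients rational, so
      \<open>r0\<close> is rounded up; after multiplication by \<open>C\<close> this costs at most
      \<open>d / 4\<close>, less than the margin \<open>d / 2\<close>.\<close>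
    obtain r where r: "r0 < of_rat r" "of_rat r < r0 + d / (4 * (C + 1))"
      using of_rat_dense[of r0 "r0 + d / (4 * (C + 1))"] \<open>d > 0\<close> C by auto
    have "C * of_rat r \<le> C * (r0 + d / (4 * (C + 1)))"
      using r C by (intro mult_left_mono) auto
    also have "\<dots> = C * r0 + C * (d / (4 * (C + 1)))"
      by (rule distrib_left)
    also have "C * (d / (4 * (C + 1))) \<le> d / 4"
      using C \<open>d > 0\<close> by (simp add: field_simps)
    finally have rA: "C * of_rat r < A" using r0(2) \<open>d > 0\<close> by simp
    have rpos: "(of_rat r :: real) > 0" using r r0(1) by linarith
    have "map ((*) (1 / of_rat r)) l \<in> Q"
      unfolding Q_def
    proof (intro CollectI conjI ballI impI)
      have "1 / of_rat r * of_rat (q i) = (of_rat (q i / r) :: real)" for i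
        by (simp add: of_rat_divide)
      then show "set (map ((*) (1 / of_rat r)) l) \<subseteq> range of_rat"
        by (auto simp: l_def simp del: of_rat_mult)
      fix v assume "v \<in> carrier V" "nrm V v \<le> 1"
      then have "\<bar>pcomb l v\<bar> \<le> of_rat r" using r0(3)[of v] r by auto
      then show "\<bar>pcomb (map ((*) (1 / of_rat r)) l) v\<bar> \<le> 1"
        unfolding comb_cmult using rpos by (simp add: abs_mult)
    qed
    then have "\<bar>comb (map ((*) (1 / of_rat r)) l) a\<bar> \<le> C" by (rule a)
    then have "A \<le> C * of_rat r"
      unfolding comb_cmult using rpos by (simp add: abs_mult A_def field_simps)
    then show False using rA by simp
  qed
  then have "d = 0" using \<open>d \<ge> 0\<close> by linarith
  then have "\<forall>i<n. c i = 0"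
    unfolding d_def by (simp add: sum_nonneg_eq_0_iff)
  then show ?thesis using v0 unfolding c_def by auto
qed

text \<open>The finite systems have solutions in the ball of radius \<open>C\<close>. Along a
  convergent subsequence every single equation is eventually satisfied, so the limit solves all of
  them.\<close>

theorem helly:
  assumes C: "0 \<le> C" and a: "\<And>c. c \<in> Q \<Longrightarrow> \<bar>comb c a\<bar> \<le> C"
  shows "\<exists>v\<in>carrier V. nrm V v \<le> C \<and> (\<forall>i. p i v = a i)"
proof -
  have "\<exists>v\<in>carrier V. nrm V v \<le> C \<and> (\<forall>i<n. p i v = a i)" for n
    by (rule helly_finite[OF assms])
  then obtain x where x: "\<And>n. x n \<in> carrier V" "\<And>n. nrm V (x n) \<le> C" "\<And>n i. i < n \<Longrightarrow> p i (x n) = a i"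
    by metis
  obtain r v where r: "strict_mono r" and v: "v \<in> carrier V" "nrm V v \<le> C"
    and lim: "\<And>i. (\<lambda>n. p i (x (r n))) \<longlonglongrightarrow> p i v"
    using ball_compact_radius[of x C] x by blast
  have "(\<lambda>n. p i (x (r n))) \<longlonglongrightarrow> a i" for i
  proof (rule tendsto_eventually)
    have "p i (x (r n)) = a i" if "n > i" for n
      using seq_suble[OF r, of n] that by (intro x) simp
    then show "\<forall>\<^sub>F n in sequentially. p i (x (r n)) = a i"
      by (intro eventually_mono[OF eventually_gt_at_top[of i]])
  qed
  then show ?thesis using v LIMSEQ_unique[OF lim] by blast
qed

text \<open>Helly's theorem, applied to the values of \<open>v\<close> itself, yields a vector of
  norm at most \<open>C\<close> with the same values, and separation identifies it with
  \<open>v\<close>.\<close>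

lemma norming:
  assumes v: "v \<in> carrier V" and C: "\<And>c. c \<in> Q \<Longrightarrow> \<bar>pcomb c v\<bar> \<le> C"
  shows "nrm V v \<le> C"
proof -
  have "0 \<le> C" using C[OF Nil_Q] by simp
  then obtain u where "u \<in> carrier V" "nrm V u \<le> C" "\<And>i. p i u = p i v"
    using helly[of C "\<lambda>i. p i v"] C by blast
  then show ?thesis using p_eqI[of u v] v by auto
qed

text \<open>A Cauchy sequence is bounded, so a subsequence has a limit with respect to all
  \<open>p i\<close>. The norm is a supremum over \<open>Q\<close>, hence lower semicontinuous for
  this convergence, and the Cauchy estimate passes to the limit.\<close>

theorem banach: "banach_space V"
  unfolding banach_space_def
proof (intro conjI nvs mcompleteI)
  fix x assume "range x \<subseteq> carrier V"
    and cauchy: "\<And>e. e > 0 \<Longrightarrow> \<exists>N::nat. \<forall>m n. N \<le> m \<longrightarrow> N \<le> n \<longrightarrow> nrm V (x m \<ominus>\<^bsub>V\<^esub> x n) < e"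
  then have x: "x n \<in> carrier V" for n by auto
  obtain N where N: "\<And>n. n \<ge> N \<Longrightarrow> nrm V (x n \<ominus>\<^bsub>V\<^esub> x N) < 1"
    using cauchy[of 1] by auto
  have "nrm V (x n) \<le> 1 + nrm V (x N)" if "n \<ge> N" for n
    using nrm_triangle[of "x n" "x N" "\<zero>\<^bsub>V\<^esub>"] N[OF that] x by (simp add: minus_eq_smult)
  then have bound: "nrm V (x (n + N)) \<le> 1 + nrm V (x N)" for n by simp
  have "\<exists>r v. strict_mono r \<and> v \<in> carrier V \<and> nrm V v \<le> 1 + nrm V (x N) \<and>
      (\<forall>i. (\<lambda>n. p i (x (r n + N))) \<longlonglongrightarrow> p i v)"
    using x bound by (intro ball_compact_radius[of "\<lambda>n. x (n + N)"])
  then obtain r v where r: "strict_mono r" and v: "v \<in> carrier V"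
    and lim: "\<And>i. (\<lambda>n. p i (x (r n + N))) \<longlonglongrightarrow> p i v"
    by blast
  have "(\<lambda>n. nrm V (x n \<ominus>\<^bsub>V\<^esub> v)) \<longlonglongrightarrow> 0"
  proof (rule LIMSEQ_I)
    fix e :: real assume "e > 0"
    then obtain N1 where N1: "\<And>m n. N1 \<le> m \<Longrightarrow> N1 \<le> n \<Longrightarrow> nrm V (x m \<ominus>\<^bsub>V\<^esub> x n) < e / 2"
      using cauchy[of "e / 2"] by auto
    have "nrm V (x n \<ominus>\<^bsub>V\<^esub> v) \<le> e / 2" if n: "n \<ge> N1" for n
    proof (rule norming)
      fix c assume c: "c \<in> Q"
      have "(\<lambda>k. pcomb c (x n) - pcomb c (x (r k + N))) \<longlonglongrightarrow> pcomb c (x n) - pcomb c v"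
        by (intro tendsto_intros comb_tendsto lim)
      moreover have "\<forall>\<^sub>F k in sequentially. \<bar>pcomb c (x n) - pcomb c (x (r k + N))\<bar> \<le> e / 2"
        using eventually_ge_at_top[of N1]
      proof eventually_elim
        fix k assume "k \<ge> N1"
        then have "r k + N \<ge> N1" using seq_suble[OF r, of k] by simp
        then show "\<bar>pcomb c (x n) - pcomb c (x (r k + N))\<bar> \<le> e / 2"
          using Q_le[OF c, of "x n \<ominus>\<^bsub>V\<^esub> x (r k + N)"] N1[OF n] x by (fastforce simp: less_imp_le)
      qed
      ultimately have "\<bar>pcomb c (x n) - pcomb c v\<bar> \<le> e / 2"
        by (intro tendsto_upperbound[OF tendsto_rabs]) auto
      then show "\<bar>pcomb c (x n \<ominus>\<^bsub>V\<^esub> v)\<bar> \<le> e / 2"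
        using x v by simp
    qed (use x v in auto)
    then have "nrm V (x n \<ominus>\<^bsub>V\<^esub> v) < e" if "n \<ge> N1" for n
      using that \<open>e > 0\<close> by fastforce
    then show "\<exists>no. \<forall>n\<ge>no. norm (nrm V (x n \<ominus>\<^bsub>V\<^esub> v) - 0) < e"
      using x v by (intro exI[of _ N1]) auto
  qed
  then show "\<exists>l\<in>carrier V. (\<lambda>n. nrm V (x n \<ominus>\<^bsub>V\<^esub> l)) \<longlonglongrightarrow> 0"
    using v by blast
qed

end

section \<open>The predual\<close>

text \<open>The predual is the closed span of the functionals \<open>p i\<close>; \<open>enc\<close> carries it over to the type required for the
  points of the predual.\<close>

locale encoded_predual = weakly_compact_ball V p
  for V :: "'v normed_structure" and p :: "nat \<Rightarrow> 'v \<Rightarrow> real" +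
  fixes enc :: "('v \<Rightarrow> real) \<Rightarrow> 'x"
  assumes enc_inj: "inj_on enc {f \<in> extensional (carrier V). bounded_functional V f}"
begin

text \<open>Norm closure of the span: an estimate \<open>e * nrm V v\<close> on the whole carrier
  says that the dual norm of the difference is at most \<open>e\<close>, and avoids naming that
  norm.\<close>

definition P :: "('v \<Rightarrow> real) set" where
  "P = {f \<in> extensional (carrier V). bounded_functional V f \<and>
          (\<forall>e>0. \<exists>c. \<forall>v\<in>carrier V. \<bar>f v - pcomb c v\<bar> \<le> e * nrm V v)}"

definition dec :: "'x \<Rightarrow> 'v \<Rightarrow> real" where
  "dec = inv_into P enc"

definition X :: "'x normed_structure" where
  "X = \<lparr>carrier = enc ` P, mult = undefined, one = undefined,
     zero = enc (\<lambda>v\<in>carrier V. 0),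
     add = (\<lambda>x y. enc (\<lambda>v\<in>carrier V. dec x v + dec y v)),
     smult = (\<lambda>a x. enc (\<lambda>v\<in>carrier V. a * dec x v)),
     nrm = (\<lambda>x. SUP v\<in>{v \<in> carrier V. nrm V v \<le> 1}. \<bar>dec x v\<bar>)\<rparr>"

lemma dec_enc [simp]: "f \<in> P \<Longrightarrow> dec (enc f) = f"
  unfolding dec_def by (rule inv_into_f_f) (auto intro: inj_on_subset[OF enc_inj] simp: P_def)

lemma P_functional: "f \<in> P \<Longrightarrow> normed_functional V f"
  by unfold_locales (simp add: P_def)

lemma P_approx:
  assumes "f \<in> P" "e > 0"
  obtains c where "\<And>v. v \<in> carrier V \<Longrightarrow> \<bar>f v - pcomb c v\<bar> \<le> e * nrm V v"
  using assms unfolding P_def by blast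

lemma bounded_functional_restrict:
  "bounded_functional V (restrict f (carrier V)) \<longleftrightarrow> bounded_functional V f"
  unfolding bounded_functional_def by auto

lemma P_pcomb: "restrict (pcomb c) (carrier V) \<in> P"
proof -
  have "\<bar>restrict (pcomb c) (carrier V) v - pcomb c v\<bar> \<le> e * nrm V v" if "e > 0" "v \<in> carrier V" for e v
    using that by simp
  then have "\<forall>e>0. \<exists>d. \<forall>v\<in>carrier V. \<bar>restrict (pcomb c) (carrier V) v - pcomb d v\<bar> \<le> e * nrm V v"
    by blast
  then show ?thesis
    unfolding P_def mem_Collect_eq bounded_functional_restrict using pc.bounded_functional by blast
qed

lemma P_p: "restrict (p i) (carrier V) \<in> P"
proof -
  define c :: "real list" where "c = map (\<lambda>j. if j = i then 1 else 0) [0..<Suc i]"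
  have "comb c a = a i" for a
    unfolding c_def comb_map_upt by simp
  then show ?thesis using P_pcomb[of c] by simp
qed

lemma P_add:
  assumes f: "f \<in> P" and g: "g \<in> P"
  shows "(\<lambda>v\<in>carrier V. f v + g v) \<in> P"
proof -
  have "\<exists>c. \<forall>v\<in>carrier V. \<bar>f v + g v - pcomb c v\<bar> \<le> e * nrm V v" if "e > 0" for e
  proof -
    obtain c1 where c1: "\<And>v. v \<in> carrier V \<Longrightarrow> \<bar>f v - pcomb c1 v\<bar> \<le> e / 2 * nrm V v"
      using P_approx[OF f half_gt_zero[OF \<open>e > 0\<close>]] by blast
    obtain c2 where c2: "\<And>v. v \<in> carrier V \<Longrightarrow> \<bar>g v - pcomb c2 v\<bar> \<le> e / 2 * nrm V v"
      using P_approx[OF g half_gt_zero[OF \<open>e > 0\<close>]] by blast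
    obtain c where c: "\<And>a. comb c a = comb c1 a + comb c2 a"
      using comb_add_ex by blast
    have "\<bar>f v + g v - pcomb c v\<bar> \<le> e * nrm V v" if "v \<in> carrier V" for v
    proof -
      have "e * nrm V v = e / 2 * nrm V v + e / 2 * nrm V v" by simp
      then show ?thesis
        using c1[OF that] c2[OF that] unfolding c by linarith
    qed
    then show ?thesis by blast
  qed
  then show ?thesis
    using f g unfolding P_def
    by (auto simp: bounded_functional_restrict intro: bounded_functional_add)
qed

lemma P_smult:
  assumes f: "f \<in> P"
  shows "(\<lambda>v\<in>carrier V. a * f v) \<in> P"
proof -
  have "\<exists>c. \<forall>v\<in>carrier V. \<bar>a * f v - pcomb c v\<bar> \<le> e * nrm V v" if "e > 0" for e
  proof -
    obtain c where c: "\<And>v. v \<in> carrier V \<Longrightarrow> \<bar>f v - pcomb c v\<bar> \<le> e / (\<bar>a\<bar> + 1) * nrm V v"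
      using P_approx[OF f, of "e / (\<bar>a\<bar> + 1)"] \<open>e > 0\<close> by auto
    have "\<bar>a * f v - pcomb (map ((*) a) c) v\<bar> \<le> e * nrm V v" if v: "v \<in> carrier V" for v
    proof -
      have "\<bar>a * f v - pcomb (map ((*) a) c) v\<bar> = \<bar>a\<bar> * \<bar>f v - pcomb c v\<bar>"
        by (simp add: comb_cmult abs_mult[symmetric] right_diff_distrib)
      also have "\<dots> \<le> \<bar>a\<bar> * (e / (\<bar>a\<bar> + 1) * nrm V v)"
        by (intro mult_left_mono c v) simp
      also have "\<dots> = (\<bar>a\<bar> * e / (\<bar>a\<bar> + 1)) * nrm V v" by simp
      also have "\<dots> \<le> e * nrm V v"
        using \<open>e > 0\<close> v by (intro mult_right_mono) (auto simp: field_simps)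
      finally show ?thesis .
    qed
    then show ?thesis by blast
  qed
  then show ?thesis
    using f unfolding P_def
    by (auto simp: bounded_functional_restrict intro: bounded_functional_cmult)
qed

lemma P_zero: "(\<lambda>v\<in>carrier V. 0) \<in> P"
  using P_pcomb[of "[]"] by (simp add: comb_def)

lemma P_eqI: "f \<in> P \<Longrightarrow> g \<in> P \<Longrightarrow> (\<And>v. v \<in> carrier V \<Longrightarrow> f v = g v) \<Longrightarrow> f = g"
  unfolding P_def by (auto intro: extensionalityI)

lemma enc_eqI: "f \<in> P \<Longrightarrow> g \<in> P \<Longrightarrow> (\<And>v. v \<in> carrier V \<Longrightarrow> f v = g v) \<Longrightarrow> enc f = enc g"
  using P_eqI by blast

lemma X_carrier: "carrier X = enc ` P"
  by (simp add: X_def)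

lemma X_add: "f \<in> P \<Longrightarrow> g \<in> P \<Longrightarrow> enc f \<oplus>\<^bsub>X\<^esub> enc g = enc (\<lambda>v\<in>carrier V. f v + g v)"
  and X_smult: "f \<in> P \<Longrightarrow> a \<odot>\<^bsub>X\<^esub> enc f = enc (\<lambda>v\<in>carrier V. a * f v)"
  and X_zero: "\<zero>\<^bsub>X\<^esub> = enc (\<lambda>v\<in>carrier V. 0)"
  and X_nrm: "f \<in> P \<Longrightarrow> nrm X (enc f) = (SUP v\<in>{v \<in> carrier V. nrm V v \<le> 1}. \<bar>f v\<bar>)"
  by (simp_all add: X_def cong: restrict_cong)

lemmas P_closed = P_add P_smult P_zero

lemma X_nrm_leI: "f \<in> P \<Longrightarrow> (\<And>v. v \<in> carrier V \<Longrightarrow> nrm V v \<le> 1 \<Longrightarrow> \<bar>f v\<bar> \<le> C) \<Longrightarrow> nrm X (enc f) \<le> C"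
  unfolding X_nrm by (intro cSUP_least) (auto intro!: exI[of _ "\<zero>\<^bsub>V\<^esub>"])

lemma X_nrm_upper:
  assumes f: "f \<in> P" and x: "x \<in> carrier V" "nrm V x \<le> 1"
  shows "\<bar>f x\<bar> \<le> nrm X (enc f)"
proof -
  interpret f: normed_functional V f by (rule P_functional[OF f])
  obtain C where C: "C > 0" "\<And>x. x \<in> carrier V \<Longrightarrow> \<bar>f x\<bar> \<le> C * nrm V x"
    using f.f_bounded by blast
  have "bdd_above ((\<lambda>v. \<bar>f v\<bar>) ` {v \<in> carrier V. nrm V v \<le> 1})"
  proof (rule bdd_aboveI2)
    fix x assume "x \<in> {v \<in> carrier V. nrm V v \<le> 1}"
    then have "x \<in> carrier V" "nrm V x \<le> 1" by auto
    then show "\<bar>f x\<bar> \<le> C"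
      using C(2)[of x] mult_left_le[of "nrm V x" C] C(1) by linarith
  qed
  then show ?thesis
    unfolding X_nrm[OF f] using x by (intro cSUP_upper) auto
qed

lemma X_nrm_ge: "f \<in> P \<Longrightarrow> v \<in> carrier V \<Longrightarrow> \<bar>f v\<bar> \<le> nrm X (enc f) * nrm V v"
  using normed_functional.le_scale[OF P_functional] X_nrm_upper by blast

lemma X_nrm_nonneg: "f \<in> P \<Longrightarrow> 0 \<le> nrm X (enc f)"
  using X_nrm_upper[of f "\<zero>\<^bsub>V\<^esub>"] by auto

lemma X_normed_vector_space: "normed_vector_space X"
proof (rule normed_vector_spaceI, unfold X_carrier)
  fix x assume "x \<in> enc ` P"
  then obtain f where f: "f \<in> P" "x = enc f" by auto
  show "0 \<le> nrm X x" using f X_nrm_nonneg by auto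
  show "nrm X x = 0 \<longleftrightarrow> x = \<zero>\<^bsub>X\<^esub>"
  proof
    assume "nrm X x = 0"
    then have "f v = 0" if "v \<in> carrier V" for v
      using X_nrm_ge[OF f(1) that] f by simp
    then have "f = (\<lambda>v\<in>carrier V. 0)"
      using f P_zero by (intro P_eqI) auto
    then show "x = \<zero>\<^bsub>X\<^esub>" by (simp add: f X_zero)
  next
    assume "x = \<zero>\<^bsub>X\<^esub>"
    then have "nrm X x \<le> 0"
      unfolding X_zero by (auto intro!: X_nrm_leI P_zero)
    then show "nrm X x = 0" using f X_nrm_nonneg[of f] by auto
  qed
  show "\<zero>\<^bsub>X\<^esub> \<oplus>\<^bsub>X\<^esub> x = x"
    by (simp only: f X_zero X_add X_smult P_closed) (intro enc_eqI P_closed f(1); simp add: algebra_simps)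
  show "(-1) \<odot>\<^bsub>X\<^esub> x \<oplus>\<^bsub>X\<^esub> x = \<zero>\<^bsub>X\<^esub>"
    by (simp only: f X_zero X_add X_smult P_closed) (intro enc_eqI P_closed f(1); simp add: algebra_simps)
  show "1 \<odot>\<^bsub>X\<^esub> x = x"
    by (simp only: f X_zero X_add X_smult P_closed) (intro enc_eqI P_closed f(1); simp add: algebra_simps)
  fix a b :: real
  show "a \<odot>\<^bsub>X\<^esub> x \<in> enc ` P"
    using f by (auto simp: X_smult P_closed)
  show "(a + b) \<odot>\<^bsub>X\<^esub> x = a \<odot>\<^bsub>X\<^esub> x \<oplus>\<^bsub>X\<^esub> b \<odot>\<^bsub>X\<^esub> x"
    by (simp only: f X_zero X_add X_smult P_closed) (intro enc_eqI P_closed f(1); simp add: algebra_simps)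
  show "(a * b) \<odot>\<^bsub>X\<^esub> x = a \<odot>\<^bsub>X\<^esub> (b \<odot>\<^bsub>X\<^esub> x)"
    by (simp only: f X_zero X_add X_smult P_closed) (intro enc_eqI P_closed f(1); simp add: algebra_simps)
  \<comment> \<open>Homogeneity needs one inequality only: the converse is the same inequality for
    the scalar \<open>1 / a\<close> and the functional multiplied by \<open>a\<close>.\<close>
  have le: "nrm X (enc (\<lambda>v\<in>carrier V. r * g v)) \<le> \<bar>r\<bar> * nrm X (enc g)" if "g \<in> P" for g r
    using that X_nrm_upper[OF that]
    by (intro X_nrm_leI P_closed) (auto simp: abs_mult intro!: mult_left_mono)
  show "nrm X (a \<odot>\<^bsub>X\<^esub> x) = \<bar>a\<bar> * nrm X x"
  proof (cases "a = 0")
    case True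
    then show ?thesis
      using le[OF f(1), of 0] X_nrm_nonneg[OF P_smult[OF f(1), of 0]] by (auto simp: f X_smult)
  next
    case False
    have "(\<lambda>v\<in>carrier V. 1 / a * (\<lambda>v\<in>carrier V. a * f v) v) = f"
      using f False by (intro P_eqI P_closed) auto
    then have "nrm X (enc f) \<le> \<bar>1 / a\<bar> * nrm X (enc (\<lambda>v\<in>carrier V. a * f v))"
      using le[OF P_smult[OF f(1), of a], of "1 / a"] by simp
    then show ?thesis
      using le[OF f(1), of a] False by (simp add: f X_smult field_simps)
  qed
  fix y assume "y \<in> enc ` P"
  then obtain g where g: "g \<in> P" "y = enc g" by auto
  show "x \<oplus>\<^bsub>X\<^esub> y \<in> enc ` P"
    using f g by (auto simp: X_add P_closed)
  show "x \<oplus>\<^bsub>X\<^esub> y = y \<oplus>\<^bsub>X\<^esub> x"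
    by (simp only: f g X_zero X_add X_smult P_closed) (intro enc_eqI P_closed f(1) g(1); simp add: algebra_simps)
  show "a \<odot>\<^bsub>X\<^esub> (x \<oplus>\<^bsub>X\<^esub> y) = a \<odot>\<^bsub>X\<^esub> x \<oplus>\<^bsub>X\<^esub> a \<odot>\<^bsub>X\<^esub> y"
    by (simp only: f g X_zero X_add X_smult P_closed) (intro enc_eqI P_closed f(1) g(1); simp add: algebra_simps)
  have "nrm X (enc (\<lambda>v\<in>carrier V. f v + g v)) \<le> nrm X (enc f) + nrm X (enc g)"
    using f(1) g(1) X_nrm_upper[OF f(1)] X_nrm_upper[OF g(1)]
    by (intro X_nrm_leI P_closed) (auto intro: order_trans[OF abs_triangle_ineq] add_mono)
  then show "nrm X (x \<oplus>\<^bsub>X\<^esub> y) \<le> nrm X x + nrm X y"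
    by (simp add: f g X_add)
  fix z assume "z \<in> enc ` P"
  then obtain h where h: "h \<in> P" "z = enc h" by auto
  show "(x \<oplus>\<^bsub>X\<^esub> y) \<oplus>\<^bsub>X\<^esub> z = x \<oplus>\<^bsub>X\<^esub> (y \<oplus>\<^bsub>X\<^esub> z)"
    by (simp only: f g h X_zero X_add X_smult P_closed) (intro enc_eqI P_closed f(1) g(1) h(1); simp add: algebra_simps)
next
  show "\<zero>\<^bsub>X\<^esub> \<in> enc ` P" by (auto simp: X_zero P_closed)
qed

sublocale X: normed_space X
  by unfold_locales (rule X_normed_vector_space)

lemma P_minus: "f \<in> P \<Longrightarrow> g \<in> P \<Longrightarrow> (\<lambda>v\<in>carrier V. f v - g v) \<in> P"
  using P_add[OF _ P_smult[of g "-1"], of f] by (simp cong: restrict_cong)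

lemma X_minus:
  assumes f: "f \<in> P" and g: "g \<in> P"
  shows "enc f \<ominus>\<^bsub>X\<^esub> enc g = enc (\<lambda>v\<in>carrier V. f v - g v)"
proof -
  have "enc f \<ominus>\<^bsub>X\<^esub> enc g = enc f \<oplus>\<^bsub>X\<^esub> (-1) \<odot>\<^bsub>X\<^esub> enc g"
    using f g by (intro X.minus_eq_smult) (auto simp: X_carrier)
  also have "\<dots> = enc (\<lambda>v\<in>carrier V. f v - g v)"
    by (simp only: f g X_add X_smult P_closed) (intro enc_eqI P_closed P_minus f g; simp)
  finally show ?thesis .
qed

text \<open>A Cauchy sequence in the dual norm is uniformly Cauchy on bounded sets. The pointwise
  limit is therefore uniform in this sense and inherits linearity, boundedness and approximability
  by combinations.\<close>

lemma X_banach: "banach_space X"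
  unfolding banach_space_def
proof (intro conjI X_normed_vector_space X.mcompleteI)
  fix x assume rng: "range x \<subseteq> carrier X"
    and cauchy: "\<And>e. e > 0 \<Longrightarrow> \<exists>N::nat. \<forall>m n. N \<le> m \<longrightarrow> N \<le> n \<longrightarrow> nrm X (x m \<ominus>\<^bsub>X\<^esub> x n) < e"
  have "\<exists>f\<in>P. x n = enc f" for n
    using rng rangeI[of x n] unfolding X_carrier by blast
  then obtain f where f: "\<And>n. f n \<in> P" "\<And>n. x n = enc (f n)" by metis
  have close: "\<exists>N. \<forall>m n. N \<le> m \<longrightarrow> N \<le> n \<longrightarrow> (\<forall>v\<in>carrier V. \<bar>f m v - f n v\<bar> \<le> e * nrm V v)" if "e > 0" for e
  proof -
    obtain N where N: "\<And>m n. N \<le> m \<Longrightarrow> N \<le> n \<Longrightarrow> nrm X (x m \<ominus>\<^bsub>X\<^esub> x n) < e"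
      using cauchy[OF \<open>e > 0\<close>] by blast
    have "\<bar>f m v - f n v\<bar> \<le> e * nrm V v" if "N \<le> m" "N \<le> n" "v \<in> carrier V" for m n v
    proof -
      have "\<bar>f m v - f n v\<bar> \<le> nrm X (x m \<ominus>\<^bsub>X\<^esub> x n) * nrm V v"
        using X_nrm_ge[OF P_minus[OF f(1)[of m] f(1)[of n]] that(3)] that(3) by (simp add: f X_minus)
      also have "\<dots> \<le> e * nrm V v"
        using N[of m n] that by (intro mult_right_mono) auto
      finally show ?thesis .
    qed
    then show ?thesis by blast
  qed
  have "convergent (\<lambda>n. f n v)" if v: "v \<in> carrier V" for v
  proof (rule Cauchy_convergent, rule metric_CauchyI)
    fix e :: real assume e: "e > 0"
    \<comment> \<open>The summand 1 avoids division by zero at the zero vector and makes the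
      resulting bound strictly less than \<open>e\<close>.\<close>
    obtain N where N: "\<And>m n. N \<le> m \<Longrightarrow> N \<le> n \<Longrightarrow> \<bar>f m v - f n v\<bar> \<le> e / (nrm V v + 1) * nrm V v"
      using close[of "e / (nrm V v + 1)"] e v by (auto simp: add_nonneg_pos)
    have lt: "e / (nrm V v + 1) * nrm V v < e"
      using e v nrm_nonneg[OF v] by (simp add: divide_less_eq add_nonneg_pos)
    have "\<bar>f m v - f n v\<bar> < e" if "N \<le> m" "N \<le> n" for m n
      using N[OF that] lt by linarith
    then show "\<exists>M. \<forall>m\<ge>M. \<forall>n\<ge>M. dist (f m v) (f n v) < e"
      unfolding dist_real_def by blast
  qed
  then have "\<exists>l. (\<lambda>n. f n v) \<longlonglongrightarrow> l" if "v \<in> carrier V" for v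
    using that unfolding convergent_def by blast
  then obtain g0 where g0: "\<And>v. v \<in> carrier V \<Longrightarrow> (\<lambda>n. f n v) \<longlonglongrightarrow> g0 v" by metis
  define g where "g = restrict g0 (carrier V)"
  have g: "(\<lambda>n. f n v) \<longlonglongrightarrow> g v" if "v \<in> carrier V" for v
    using g0[OF that] that by (simp add: g_def)
  have unif: "\<exists>N. \<forall>m\<ge>N. \<forall>v\<in>carrier V. \<bar>f m v - g v\<bar> \<le> e * nrm V v" if "e > 0" for e
  proof -
    obtain N where N: "\<And>m n v. N \<le> m \<Longrightarrow> N \<le> n \<Longrightarrow> v \<in> carrier V \<Longrightarrow> \<bar>f m v - f n v\<bar> \<le> e * nrm V v"
      using close[OF \<open>e > 0\<close>] by blast
    have "\<bar>f m v - g v\<bar> \<le> e * nrm V v" if "m \<ge> N" "v \<in> carrier V" for m v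
    proof (rule tendsto_upperbound)
      show "(\<lambda>n. \<bar>f m v - f n v\<bar>) \<longlonglongrightarrow> \<bar>f m v - g v\<bar>"
        by (intro tendsto_intros g that)
      show "\<forall>\<^sub>F n in sequentially. \<bar>f m v - f n v\<bar> \<le> e * nrm V v"
        using N that by (intro eventually_mono[OF eventually_ge_at_top[of N]])
    qed simp
    then show ?thesis by blast
  qed
  have lin: "f n (u \<oplus>\<^bsub>V\<^esub> v) = f n u + f n v" "f n (a \<odot>\<^bsub>V\<^esub> u) = a * f n u"
    if "u \<in> carrier V" "v \<in> carrier V" for n u v a
    using P_functional[OF f(1), of n] that by (auto simp: normed_functional.f_add normed_functional.f_smult)
  have g_lin: "g (u \<oplus>\<^bsub>V\<^esub> v) = g u + g v" "g (a \<odot>\<^bsub>V\<^esub> u) = a * g u"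
    if "u \<in> carrier V" "v \<in> carrier V" for u v a
  proof -
    have "(\<lambda>n. f n u + f n v) \<longlonglongrightarrow> g u + g v" by (intro tendsto_intros g that)
    then show "g (u \<oplus>\<^bsub>V\<^esub> v) = g u + g v"
      using g[of "u \<oplus>\<^bsub>V\<^esub> v"] that lin by (auto intro: LIMSEQ_unique)
    have "(\<lambda>n. a * f n u) \<longlonglongrightarrow> a * g u" by (intro tendsto_intros g that)
    then show "g (a \<odot>\<^bsub>V\<^esub> u) = a * g u"
      using g[of "a \<odot>\<^bsub>V\<^esub> u"] that lin by (auto intro: LIMSEQ_unique)
  qed
  obtain N where N: "\<And>v. v \<in> carrier V \<Longrightarrow> \<bar>f N v - g v\<bar> \<le> 1 * nrm V v"
    using unif[of 1] by auto
  have "\<bar>g v\<bar> \<le> (1 + nrm X (enc (f N))) * nrm V v" if "v \<in> carrier V" for v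
    using N[OF that] X_nrm_ge[OF f(1)[of N] that] unfolding distrib_right by linarith
  then have "bounded_functional V g"
    unfolding bounded_functional_def using g_lin by blast
  moreover have "\<exists>c. \<forall>v\<in>carrier V. \<bar>g v - pcomb c v\<bar> \<le> e * nrm V v" if "e > 0" for e
  proof -
    obtain N where N: "\<And>v. v \<in> carrier V \<Longrightarrow> \<bar>f N v - g v\<bar> \<le> e / 2 * nrm V v"
      using unif[OF half_gt_zero[OF \<open>e > 0\<close>]] by auto
    obtain c where c: "\<And>v. v \<in> carrier V \<Longrightarrow> \<bar>f N v - pcomb c v\<bar> \<le> e / 2 * nrm V v"
      using P_approx[OF f(1) half_gt_zero[OF \<open>e > 0\<close>]] by blast
    have "\<bar>g v - pcomb c v\<bar> \<le> e * nrm V v" if "v \<in> carrier V" for v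
    proof -
      have "e * nrm V v = e / 2 * nrm V v + e / 2 * nrm V v" by simp
      then show ?thesis
        using N[OF that] c[OF that] by linarith
    qed
    then show ?thesis by blast
  qed
  ultimately have gP: "g \<in> P" by (simp add: P_def g_def)
  have "(\<lambda>n. nrm X (x n \<ominus>\<^bsub>X\<^esub> enc g)) \<longlonglongrightarrow> 0"
  proof (rule LIMSEQ_I)
    fix e :: real assume e: "e > 0"
    obtain N where N: "\<And>m v. m \<ge> N \<Longrightarrow> v \<in> carrier V \<Longrightarrow> \<bar>f m v - g v\<bar> \<le> e / 2 * nrm V v"
      using unif[of "e / 2"] e by auto
    have "nrm X (x n \<ominus>\<^bsub>X\<^esub> enc g) \<le> e / 2" if n: "n \<ge> N" for n
      unfolding f(2) X_minus[OF f(1) gP]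
    proof (rule X_nrm_leI[OF P_minus[OF f(1) gP]])
      fix v assume "v \<in> carrier V" "nrm V v \<le> 1"
      then have "v \<in> carrier V" "\<bar>f n v - g v\<bar> \<le> e / 2"
        using N[OF n, of v] mult_left_le[of "nrm V v" "e / 2"] e by linarith+
      then show "\<bar>(\<lambda>v\<in>carrier V. f n v - g v) v\<bar> \<le> e / 2"
        by simp
    qed
    moreover have "0 \<le> nrm X (x n \<ominus>\<^bsub>X\<^esub> enc g)" for n
      unfolding f(2) X_minus[OF f(1) gP] by (rule X_nrm_nonneg[OF P_minus[OF f(1) gP]])
    ultimately have "\<bar>nrm X (x n \<ominus>\<^bsub>X\<^esub> enc g)\<bar> < e" if "n \<ge> N" for n
      using that e by fastforce
    then show "\<exists>no. \<forall>n\<ge>no. norm (nrm X (x n \<ominus>\<^bsub>X\<^esub> enc g) - 0) < e"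
      by (intro exI[of _ N]) simp
  qed
  then show "\<exists>l\<in>carrier X. (\<lambda>n. nrm X (x n \<ominus>\<^bsub>X\<^esub> l)) \<longlonglongrightarrow> 0"
    using gP unfolding X_carrier by blast
qed

text \<open>Induction from the right end of the list, because an appended coefficient belongs to the
  functional with index \<open>length c\<close> and leaves the other indices in place.\<close>

lemma comb_in_X:
  assumes "normed_functional X F"
  shows "F (enc (restrict (pcomb c) (carrier V))) = comb c (\<lambda>i. F (enc (restrict (p i) (carrier V))))"
proof (induction c rule: rev_induct)
  interpret F: normed_functional X F by (rule assms)
  {
    case Nil
    have "comb [] a = 0" for a by (simp add: comb_def)
    then show ?case using F.f_zero unfolding X_zero by (simp only:)
  next
    case (snoc b c)
    have snoc_eq: "comb (c @ [b]) a = comb c a + b * a (length c)" for a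
      unfolding comb_def by (simp add: nth_append)
    have memb: "enc (restrict (pcomb c) (carrier V)) \<in> carrier X" "enc (restrict (p i) (carrier V)) \<in> carrier X" for i
      by (simp_all add: X_carrier P_pcomb P_p)
    have "enc (restrict (pcomb (c @ [b])) (carrier V)) =
        enc (restrict (pcomb c) (carrier V)) \<oplus>\<^bsub>X\<^esub> b \<odot>\<^bsub>X\<^esub> enc (restrict (p (length c)) (carrier V))"
      by (simp only: X_add X_smult P_pcomb P_p P_closed)
        (intro enc_eqI P_closed P_pcomb P_p; simp add: snoc_eq)
    then have "F (enc (restrict (pcomb (c @ [b])) (carrier V))) =
        F (enc (restrict (pcomb c) (carrier V))) + b * F (enc (restrict (p (length c)) (carrier V)))"
      by (simp only: F.f_add F.f_smult X.smult_mem memb)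
    then show ?case
      unfolding snoc_eq snoc.IH .
  }
qed

text \<open>\<open>T\<close> is evaluation. It is injective because the \<open>p i\<close> separate,
  onto by Helly's theorem, and isometric because \<open>Q\<close> is norming and consists of
  elements of the unit ball of \<open>X\<close>.\<close>

lemma isometrically_isomorphic_dual: "isometrically_isomorphic V (dual X)"
proof -
  define T where "T v = (\<lambda>x\<in>carrier X. dec x v)" for v
  have Tf: "T v (enc f) = f v" if "f \<in> P" for v f
    using that by (simp add: T_def X_carrier)
  have dual_carrier: "carrier (dual X) = {F \<in> extensional (carrier X). bounded_functional X F}"
    by (simp add: dual_def)
  have T_ext: "T v \<in> extensional (carrier X)" for v by (simp add: T_def)
  have T_dual: "T v \<in> carrier (dual X)" if v: "v \<in> carrier V" for v
  proof -
    have "\<bar>T v x\<bar> \<le> nrm V v * nrm X x" if "x \<in> carrier X" for x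
      using that X_nrm_ge[OF _ v] by (auto simp: X_carrier Tf mult.commute)
    then have "\<exists>C. \<forall>x\<in>carrier X. \<bar>T v x\<bar> \<le> C * nrm X x" by blast
    moreover have "T v (x \<oplus>\<^bsub>X\<^esub> y) = T v x + T v y" if "x \<in> carrier X" "y \<in> carrier X" for x y
      using that v by (auto simp: X_carrier X_add Tf P_closed)
    moreover have "T v (a \<odot>\<^bsub>X\<^esub> x) = a * T v x" if "x \<in> carrier X" for x a
      using that v by (auto simp: X_carrier X_smult Tf P_closed)
    ultimately show ?thesis
      using T_ext by (simp add: dual_carrier bounded_functional_def)
  qed
  have ext: "F = G" if "F \<in> carrier (dual X)" "G \<in> carrier (dual X)" "\<And>f. f \<in> P \<Longrightarrow> F (enc f) = G (enc f)" for F G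
    using that by (intro extensionalityI[of _ "carrier X"]) (auto simp: dual_carrier X_carrier)
  have inj: "inj_on T (carrier V)"
  proof (rule inj_onI)
    fix u v assume uv: "u \<in> carrier V" "v \<in> carrier V" "T u = T v"
    have "p i u = p i v" for i
      using Tf[OF P_p, of u i] Tf[OF P_p, of v i] uv by simp
    then show "u = v" using uv by (intro p_eqI)
  qed
  have surj: "F \<in> T ` carrier V" if F: "F \<in> carrier (dual X)" for F
  proof -
    interpret F: normed_functional X F
      using F by unfold_locales (simp add: dual_carrier)
    obtain C where C: "C > 0" "\<And>x. x \<in> carrier X \<Longrightarrow> \<bar>F x\<bar> \<le> C * nrm X x"
      using F.f_bounded by blast
    \<comment> \<open>The values prescribed by \<open>F\<close>. Members of \<open>Q\<close> have
      norm at most 1 in \<open>X\<close>, so a bound of \<open>F\<close> is the constant required by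
      Helly's theorem.\<close>
    define a where "a i = F (enc (restrict (p i) (carrier V)))" for i
    have comb: "comb c a = F (enc (restrict (pcomb c) (carrier V)))" for c
      unfolding a_def by (rule comb_in_X[symmetric]) unfold_locales
    have "\<bar>comb c a\<bar> \<le> C" if "c \<in> Q" for c
    proof -
      have "nrm X (enc (restrict (pcomb c) (carrier V))) \<le> 1"
        using that by (intro X_nrm_leI P_pcomb) (auto simp: Q_def)
      have "\<bar>comb c a\<bar> \<le> C * nrm X (enc (restrict (pcomb c) (carrier V)))"
        unfolding comb by (rule C(2)) (simp add: X_carrier P_pcomb)
      also have "\<dots> \<le> C * 1"
        by (intro mult_left_mono \<open>nrm X _ \<le> 1\<close>) (use C(1) in simp)
      finally show ?thesis by simp
    qed
    then obtain v where v: "v \<in> carrier V" "\<And>i. p i v = a i"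
      using helly[of C a] C(1) by auto
    have "F = T v"
    proof (rule ext[OF F T_dual[OF v(1)]])
      fix f assume f: "f \<in> P"
      have "\<bar>F (enc f) - f v\<bar> \<le> 0 + e" if e: "e > 0" for e
      proof -
        \<comment> \<open>An approximation error is seen once through \<open>F\<close>, with factor
          \<open>C\<close>, and once through evaluation at \<open>v\<close>, with factor
          \<open>nrm V v\<close>; \<open>K\<close> collects both.\<close>
        define K where "K = C + nrm V v"
        have K: "K > 0" using C(1) nrm_nonneg[OF v(1)] unfolding K_def by linarith
        obtain c where c: "\<And>u. u \<in> carrier V \<Longrightarrow> \<bar>f u - pcomb c u\<bar> \<le> e / K * nrm V u"
          using P_approx[OF f divide_pos_pos[OF e K]] by blast
        let ?c = "restrict (pcomb c) (carrier V)"
        have "\<bar>F (enc f) - F (enc ?c)\<bar> = \<bar>F (enc f \<ominus>\<^bsub>X\<^esub> enc ?c)\<bar>"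
          using f P_pcomb by (simp add: X_carrier)
        also have "\<dots> \<le> C * nrm X (enc f \<ominus>\<^bsub>X\<^esub> enc ?c)"
          using f P_pcomb by (intro C X.minus_mem) (auto simp: X_carrier)
        also have "\<dots> \<le> C * (e / K)"
        proof (rule mult_left_mono)
          show "nrm X (enc f \<ominus>\<^bsub>X\<^esub> enc ?c) \<le> e / K"
            unfolding X_minus[OF f P_pcomb]
          proof (rule X_nrm_leI[OF P_minus[OF f P_pcomb]])
            fix u assume "u \<in> carrier V" "nrm V u \<le> 1"
            then show "\<bar>(\<lambda>v\<in>carrier V. f v - ?c v) u\<bar> \<le> e / K"
              using c[of u] mult_left_le[of "nrm V u" "e / K"] e K by auto
          qed
        qed (use C(1) in simp)
        finally have "\<bar>F (enc f) - F (enc ?c)\<bar> \<le> C * (e / K)" .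
        moreover have "F (enc ?c) = pcomb c v"
          using v(2) comb[of c] by simp
        moreover have "\<bar>f v - pcomb c v\<bar> \<le> nrm V v * (e / K)"
          using c[OF v(1)] by (simp add: mult.commute)
        moreover have "C * (e / K) + nrm V v * (e / K) = e"
          using K unfolding distrib_right[symmetric] K_def[symmetric] by simp
        ultimately show ?thesis by linarith
      qed
      then have "\<bar>F (enc f) - f v\<bar> \<le> 0" by (rule field_le_epsilon)
      then show "F (enc f) = T v (enc f)" by (simp add: Tf f)
    qed
    then show ?thesis using v by blast
  qed
  have "T (u \<oplus>\<^bsub>V\<^esub> v) = T u \<oplus>\<^bsub>dual X\<^esub> T v" if "u \<in> carrier V" "v \<in> carrier V" for u v
  proof -
    have "dec x (u \<oplus>\<^bsub>V\<^esub> v) = dec x u + dec x v" if "x \<in> carrier X" for x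
      using that \<open>u \<in> carrier V\<close> \<open>v \<in> carrier V\<close> P_functional
      by (auto simp: X_carrier normed_functional.f_add)
    then show ?thesis by (simp add: dual_def T_def cong: restrict_cong)
  qed
  moreover have "T (a \<odot>\<^bsub>V\<^esub> u) = a \<odot>\<^bsub>dual X\<^esub> T u" if "u \<in> carrier V" for a u
  proof -
    have "dec x (a \<odot>\<^bsub>V\<^esub> u) = a * dec x u" if "x \<in> carrier X" for x
      using that \<open>u \<in> carrier V\<close> P_functional
      by (auto simp: X_carrier normed_functional.f_smult)
    then show ?thesis by (simp add: dual_def T_def cong: restrict_cong)
  qed
  moreover have "nrm (dual X) (T v) = nrm V v" if v: "v \<in> carrier V" for v
  proof -
    let ?B = "{x \<in> carrier X. nrm X x \<le> 1}"
    have nrm: "nrm (dual X) (T v) = (SUP x\<in>?B. \<bar>T v x\<bar>)"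
      by (simp add: dual_def)
    have le: "\<bar>T v x\<bar> \<le> nrm V v" if x: "x \<in> ?B" for x
    proof -
      obtain f where f: "f \<in> P" "x = enc f" using x X_carrier by auto
      have "\<bar>f v\<bar> \<le> nrm X x * nrm V v" using X_nrm_ge[OF f(1) v] f by simp
      also have "\<dots> \<le> 1 * nrm V v" using x v by (intro mult_right_mono) auto
      finally show ?thesis using f by (simp add: Tf)
    qed
    have "?B \<noteq> {}" by (auto intro!: exI[of _ "\<zero>\<^bsub>X\<^esub>"])
    then have "nrm (dual X) (T v) \<le> nrm V v"
      unfolding nrm by (intro cSUP_least le)
    moreover have "nrm V v \<le> nrm (dual X) (T v)"
    proof (rule norming[OF v])
      fix c assume c: "c \<in> Q"
      let ?c = "restrict (pcomb c) (carrier V)"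
      have "nrm X (enc ?c) \<le> 1"
        using c by (intro X_nrm_leI P_pcomb) (auto simp: Q_def)
      then have "\<bar>T v (enc ?c)\<bar> \<le> nrm (dual X) (T v)"
        unfolding nrm using P_pcomb le by (intro cSUP_upper bdd_aboveI2[where M = "nrm V v"]) (auto simp: X_carrier)
      then show "\<bar>pcomb c v\<bar> \<le> nrm (dual X) (T v)"
        using v by (simp add: Tf P_pcomb)
    qed
    ultimately show ?thesis by simp
  qed
  moreover have "bij_betw T (carrier V) (carrier (dual X))"
    using inj surj T_dual unfolding bij_betw_def by blast
  ultimately show ?thesis
    unfolding isometrically_isomorphic_def by blast
qed

theorem is_dual_space: "is_dual_space TYPE('x) V"
  unfolding is_dual_space_def using banach X_banach isometrically_isomorphic_dual by blast

end

section \<open>The Radon-Nikodym property\<close>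

text \<open>\<open>N\<close> becomes a measure on the same sigma-algebra. Its total mass is a real
  number, so the density is finite almost everywhere and may be replaced by a real function.\<close>

lemma radon_nikodym_nonneg:
  fixes N :: "'b set \<Rightarrow> real"
  assumes "finite_measure M"
    and nonneg: "\<And>E. E \<in> sets M \<Longrightarrow> 0 \<le> N E"
    and sums: "\<And>A. range A \<subseteq> sets M \<Longrightarrow> disjoint_family A \<Longrightarrow> (\<lambda>i. N (A i)) sums N (\<Union>i. A i)"
    and ac: "\<And>E. E \<in> sets M \<Longrightarrow> emeasure M E = 0 \<Longrightarrow> N E = 0"
  shows "\<exists>f. integrable M f \<and> (\<forall>E\<in>sets M. N E = (LINT x:E|M. f x))"
proof -
  interpret finite_measure M by fact
  define \<mu> where "\<mu> = measure_of (space M) (sets M) (\<lambda>E. ennreal (N E))"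
  have sets_\<mu> [simp]: "sets \<mu> = sets M" and space_\<mu> [simp]: "space \<mu> = space M"
    by (simp_all add: \<mu>_def)
  have em: "emeasure \<mu> E = ennreal (N E)" if "E \<in> sets M" for E
    unfolding \<mu>_def
  proof (rule emeasure_measure_of_sigma[OF sets.sigma_algebra_axioms _ _ that])
    show "positive (sets M) (\<lambda>E. ennreal (N E))"
      using ac[of "{}"] by (simp add: positive_def)
    show "countably_additive (sets M) (\<lambda>E. ennreal (N E))"
    proof (rule countably_additiveI)
      fix A :: "nat \<Rightarrow> 'b set" assume A: "range A \<subseteq> sets M" "disjoint_family A" "(\<Union>i. A i) \<in> sets M"
      have "(\<lambda>i. ennreal (N (A i))) sums ennreal (N (\<Union>i. A i))"
        using sums[OF A(1,2)] A nonneg by (subst sums_ennreal) auto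
      then show "(\<Sum>i. ennreal (N (A i))) = ennreal (N (\<Union>i. A i))"
        by (rule sums_unique[symmetric])
    qed
  qed
  have "absolutely_continuous M \<mu>"
    unfolding absolutely_continuous_def using ac em by (auto simp: null_sets_def)
  then obtain f where f: "f \<in> borel_measurable M" "density M f = \<mu>"
    using Radon_Nikodym[of \<mu>] by auto
  have int: "(\<integral>\<^sup>+x. f x * indicator E x \<partial>M) = ennreal (N E)" if "E \<in> sets M" for E
    using emeasure_density[OF f(1) that] em[OF that] f(2) by simp
  have total: "(\<integral>\<^sup>+x. f x \<partial>M) = ennreal (N (space M))"
  proof -
    have "(\<integral>\<^sup>+x. f x \<partial>M) = (\<integral>\<^sup>+x. f x * indicator (space M) x \<partial>M)"
      by (intro nn_integral_cong) simp
    then show ?thesis using int[of "space M"] by simp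
  qed
  then have fin: "AE x in M. f x \<noteq> \<infinity>"
    using f(1) by (intro nn_integral_PInf_AE) auto
  then have eq: "(\<integral>\<^sup>+x. ennreal (enn2real (f x)) * indicator E x \<partial>M) = ennreal (N E)" if "E \<in> sets M" for E
    unfolding int[OF that, symmetric] by (intro nn_integral_cong_AE) (auto elim!: eventually_mono simp: less_top)
  show ?thesis
  proof (intro exI[of _ "\<lambda>x. enn2real (f x)"] conjI ballI)
    show "integrable M (\<lambda>x. enn2real (f x))"
    proof (rule integrableI_nonneg)
      have "(\<integral>\<^sup>+x. ennreal (enn2real (f x)) \<partial>M) = (\<integral>\<^sup>+x. f x \<partial>M)"
        using fin by (intro nn_integral_cong_AE) (auto elim!: eventually_mono simp: less_top)
      then show "(\<integral>\<^sup>+x. ennreal (enn2real (f x)) \<partial>M) < \<infinity>" by (simp add: total)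
    qed (use f(1) in auto)
    fix E assume E: "E \<in> sets M"
    have "(LINT x:E|M. enn2real (f x)) = enn2real (\<integral>\<^sup>+x. ennreal (indicator E x * enn2real (f x)) \<partial>M)"
      unfolding set_lebesgue_integral_def using f(1) E
      by (subst integral_eq_nn_integral) auto
    also have "(\<integral>\<^sup>+x. ennreal (indicator E x * enn2real (f x)) \<partial>M) = ennreal (N E)"
      unfolding eq[OF E, symmetric]
      by (intro nn_integral_cong) (auto simp: indicator_def)
    finally show "N E = (LINT x:E|M. enn2real (f x))"
      using nonneg[OF E] by simp
  qed
qed

text \<open>Jordan decomposition: the positive variation \<open>N\<close> and the difference
  \<open>N - \<nu>\<close> are nonnegative, countably additive and vanish on null sets, so the
  nonnegative case applies to both.\<close>

lemma radon_nikodym_signed: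
  fixes \<nu> :: "'b set \<Rightarrow> real"
  assumes fm: "finite_measure M"
    and sums: "\<And>A. range A \<subseteq> sets M \<Longrightarrow> disjoint_family A \<Longrightarrow> (\<lambda>i. \<nu> (A i)) sums \<nu> (\<Union>i. A i)"
    and bound: "\<And>E. E \<in> sets M \<Longrightarrow> \<bar>\<nu> E\<bar> \<le> C"
    and ac: "\<And>E. E \<in> sets M \<Longrightarrow> emeasure M E = 0 \<Longrightarrow> \<nu> E = 0"
  shows "\<exists>f. integrable M f \<and> (\<forall>E\<in>sets M. \<nu> E = (LINT x:E|M. f x))"
proof -
  define N where "N E = (SUP A\<in>{A \<in> sets M. A \<subseteq> E}. \<nu> A)" for E
  have empty: "\<nu> {} = 0" by (rule ac) auto
  have add: "\<nu> (A \<union> B) = \<nu> A + \<nu> B" if "A \<in> sets M" "B \<in> sets M" "A \<inter> B = {}" for A B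
  proof -
    have "(\<lambda>i. \<nu> (binaryset A B i)) sums \<nu> (\<Union>i. binaryset A B i)"
      using that by (intro sums) (auto simp: binaryset_def disjoint_family_on_def)
    moreover have "(\<lambda>i. \<nu> (binaryset A B i)) sums (\<nu> A + \<nu> B)"
      by (rule binaryset_sums[where f = \<nu>, OF empty])
    ultimately show ?thesis
      unfolding UN_binaryset_eq by (rule sums_unique2)
  qed
  have le_C: "\<nu> A \<le> C" if "A \<in> sets M" for A using bound[OF that] by linarith
  have N_ge: "\<nu> A \<le> N E" if "A \<in> sets M" "A \<subseteq> E" for A E
    unfolding N_def using that le_C by (intro cSUP_upper bdd_aboveI2[where M = C]) auto
  have N_le: "N E \<le> c" if "\<And>A. A \<in> sets M \<Longrightarrow> A \<subseteq> E \<Longrightarrow> \<nu> A \<le> c" for E c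
    unfolding N_def using that by (intro cSUP_least) auto
  have N_nonneg: "0 \<le> N E" for E using N_ge[of "{}" E] empty by simp
  have N_mono: "N E \<le> N F" if "E \<subseteq> F" for E F using N_ge that by (intro N_le) blast
  \<comment> \<open>Competitors for two disjoint sets unite to a competitor for the union; this
    gives one half of countable additivity.\<close>
  have N_super: "N E + N F \<le> N (E \<union> F)" if "E \<inter> F = {}" for E F
  proof -
    have "N E \<le> N (E \<union> F) - \<nu> B" if B: "B \<in> sets M" "B \<subseteq> F" for B
    proof (rule N_le)
      fix A assume A: "A \<in> sets M" "A \<subseteq> E"
      have "\<nu> A + \<nu> B = \<nu> (A \<union> B)" using A B \<open>E \<inter> F = {}\<close> by (intro add[symmetric]) auto
      also have "\<dots> \<le> N (E \<union> F)" using A B by (intro N_ge) auto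
      finally show "\<nu> A \<le> N (E \<union> F) - \<nu> B" by simp
    qed
    then have "N F \<le> N (E \<union> F) - N E" by (intro N_le) (simp add: algebra_simps)
    then show ?thesis by simp
  qed
  have N_sums: "(\<lambda>i. N (A i)) sums N (\<Union>i. A i)" if A: "range A \<subseteq> sets M" "disjoint_family A" for A
  proof -
    have part: "(\<Sum>i<n. N (A i)) \<le> N (\<Union>i<n. A i)" for n
    proof (induction n)
      case (Suc n)
      have "A i \<inter> A n = {}" if "i < n" for i
        using A(2) that by (intro disjoint_family_onD) auto
      then have "(\<Union>i<n. A i) \<inter> A n = {}" by blast
      then have "N (\<Union>i<n. A i) + N (A n) \<le> N (\<Union>i<Suc n. A i)"
        using N_super[of "\<Union>i<n. A i" "A n"] by (simp add: lessThan_Suc Un_commute)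
      then show ?case using Suc by simp
    qed (simp add: N_nonneg)
    have bnd: "(\<Sum>i<n. N (A i)) \<le> N (\<Union>i. A i)" for n
      using part[of n] N_mono[of "\<Union>i<n. A i" "\<Union>i. A i"] by fastforce
    have summ: "summable (\<lambda>i. N (A i))"
    proof (rule bounded_imp_summable)
      show "(\<Sum>i\<le>n. N (A i)) \<le> N (\<Union>i. A i)" for n
        using bnd[of "Suc n"] by (simp only: lessThan_Suc_atMost)
    qed (rule N_nonneg)
    \<comment> \<open>The other half: a competitor for the union is cut along the sets
      \<open>A i\<close>.\<close>
    have "N (\<Union>i. A i) \<le> (\<Sum>i. N (A i))"
    proof (rule N_le)
      fix B assume B: "B \<in> sets M" "B \<subseteq> (\<Union>i. A i)"
      have "(\<lambda>i. \<nu> (B \<inter> A i)) sums \<nu> (\<Union>i. B \<inter> A i)"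
        using A B by (intro sums) (auto simp: disjoint_family_on_def)
      moreover have "(\<Union>i. B \<inter> A i) = B" using B by auto
      ultimately have "\<nu> B = (\<Sum>i. \<nu> (B \<inter> A i))" "summable (\<lambda>i. \<nu> (B \<inter> A i))"
        by (auto simp: sums_iff)
      then show "\<nu> B \<le> (\<Sum>i. N (A i))"
        using summ A B by (auto intro!: suminf_le N_ge)
    qed
    moreover have "(\<Sum>i. N (A i)) \<le> N (\<Union>i. A i)"
      using summ bnd by (rule suminf_le_const)
    ultimately show ?thesis using summ by (simp add: sums_iff)
  qed
  have N_ac: "N E = 0" if E: "E \<in> sets M" "emeasure M E = 0" for E
  proof (rule antisym)
    have "emeasure M A = 0" if "A \<subseteq> E" for A using emeasure_mono[OF that E(1)] E(2) by simp
    then show "N E \<le> 0" using ac by (intro N_le) auto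
  qed (rule N_nonneg)
  obtain f where f: "integrable M f" "\<And>E. E \<in> sets M \<Longrightarrow> N E = (LINT x:E|M. f x)"
    using radon_nikodym_nonneg[of M N, OF fm N_nonneg N_sums N_ac] by blast
  have "\<exists>g. integrable M g \<and> (\<forall>E\<in>sets M. N E - \<nu> E = (LINT x:E|M. g x))"
  proof (rule radon_nikodym_nonneg[OF fm, of "\<lambda>E. N E - \<nu> E"])
    show "0 \<le> N E - \<nu> E" if "E \<in> sets M" for E using N_ge[OF that, of E] by simp
    show "(\<lambda>i. N (A i) - \<nu> (A i)) sums (N (\<Union>i. A i) - \<nu> (\<Union>i. A i))"
      if "range A \<subseteq> sets M" "disjoint_family A" for A
      using that by (intro sums_diff N_sums sums)
    show "N E - \<nu> E = 0" if "E \<in> sets M" "emeasure M E = 0" for E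
      using N_ac[OF that] ac[OF that] by simp
  qed
  then obtain g where g: "integrable M g" "\<And>E. E \<in> sets M \<Longrightarrow> N E - \<nu> E = (LINT x:E|M. g x)"
    by blast
  show ?thesis
  proof (intro exI[of _ "\<lambda>x. f x - g x"] conjI ballI)
    fix E assume E: "E \<in> sets M"
    have "(LINT x:E|M. f x - g x) = (LINT x:E|M. f x) - (LINT x:E|M. g x)"
      using f g E by (intro set_integral_diff(2)) (auto simp: set_integrable_def intro: integrable_mult_indicator simp del: real_scaleR_def)
    then show "\<nu> E = (LINT x:E|M. f x - g x)"
      using f(2)[OF E] g(2)[OF E] by simp
  qed (use f g in auto)
qed

section \<open>Densities of vector measures\<close>

context weakly_compact_ball
begin

lemma vector_measure_norm_le:
  assumes G: "G \<in> sets M \<rightarrow> carrier V"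
    and C: "\<And>P. finite P \<Longrightarrow> P \<subseteq> sets M \<Longrightarrow> disjoint P \<Longrightarrow> \<Union>P = space M \<Longrightarrow> (\<Sum>A\<in>P. nrm V (G A)) \<le> C"
    and E: "E \<in> sets M"
  shows "nrm V (G E) \<le> C"
proof -
  have "G E \<in> carrier V" "G (space M - E) \<in> carrier V"
    using G E by auto
  then have "nrm V (G E) \<le> (\<Sum>A\<in>{E, space M - E}. nrm V (G A))"
    by (intro member_le_sum) auto
  also have "\<dots> \<le> C"
    using E sets.sets_into_space[OF E] by (intro C) (auto simp: disjoint_def)
  finally show ?thesis .
qed

text \<open>A bounded functional turns norm convergence of the partial sums into scalar convergence,
  so each \<open>p i\<close> composed with \<open>G\<close> is a bounded signed measure that
  vanishes on null sets.\<close>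

lemma vector_measure_density:
  assumes fm: "finite_measure M" and vm: "vector_measure M V G" and ac: "abs_continuous M V G"
    and C: "\<And>E. E \<in> sets M \<Longrightarrow> nrm V (G E) \<le> C"
  obtains a where "\<And>i. integrable M (a i)" "\<And>i E. E \<in> sets M \<Longrightarrow> p i (G E) = (LINT x:E|M. a i x)"
proof -
  have G: "G E \<in> carrier V" if "E \<in> sets M" for E
    using vm that unfolding vector_measure_def by auto
  have "\<exists>f. integrable M f \<and> (\<forall>E\<in>sets M. p i (G E) = (LINT x:E|M. f x))" for i
  proof -
    obtain K where K: "K > 0" "\<And>x. x \<in> carrier V \<Longrightarrow> \<bar>p i x\<bar> \<le> K * nrm V x"
      using p.f_bounded by blast
    have sums: "(\<lambda>j. p i (G (A j))) sums p i (G (\<Union>j. A j))"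
      if A: "range A \<subseteq> sets M" "disjoint_family A" for A :: "nat \<Rightarrow> _"
    proof -
      have AG: "G (A j) \<in> carrier V" "G (\<Union>j. A j) \<in> carrier V" for j using A by (auto intro!: G)
      let ?d = "\<lambda>n. (\<Oplus>\<^bsub>V\<^esub>j\<in>{..<n}. G (A j)) \<ominus>\<^bsub>V\<^esub> G (\<Union>j. A j)"
      have dV: "?d n \<in> carrier V" for n using AG by (intro minus_mem M.finsum_closed) auto
      have "(\<lambda>n. nrm V (?d n)) \<longlonglongrightarrow> 0"
        using vm A unfolding vector_measure_def by blast
      then have lim: "(\<lambda>n. K * nrm V (?d n)) \<longlonglongrightarrow> 0"
        by (rule tendsto_mult_right_zero)
      have "(\<lambda>n. p i (?d n)) \<longlonglongrightarrow> 0"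
        by (rule Lim_null_comparison[OF _ lim]) (use K(2) dV in auto)
      moreover have "p i (?d n) = (\<Sum>j<n. p i (G (A j))) - p i (G (\<Union>j. A j))" for n
        using AG by (subst p.f_minus) (auto intro!: M.finsum_closed p.f_finsum)
      ultimately show ?thesis
        unfolding sums_def by (simp add: LIM_zero_iff)
    qed
    have bound: "\<bar>p i (G E)\<bar> \<le> K * C" if "E \<in> sets M" for E
      using K(2)[OF G[OF that]] mult_left_mono[OF C[OF that], of K] K(1) by linarith
    have null: "p i (G E) = 0" if "E \<in> sets M" "emeasure M E = 0" for E
      using ac that unfolding abs_continuous_def by simp
    show ?thesis
      by (rule radon_nikodym_signed[OF fm sums bound null])
  qed
  then show thesis using that by metis
qed

lemma comb_density:
  assumes a: "\<And>i. integrable M (a i)" "\<And>i E. E \<in> sets M \<Longrightarrow> p i (G E) = (LINT x:E|M. a i x)"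
    and E: "E \<in> sets M"
  shows "pcomb c (G E) = (LINT x:E|M. comb c (\<lambda>i. a i x))"
proof -
  have int: "integrable M (\<lambda>x. indicator E x *\<^sub>R a i x)" for i
    using E a(1) by (rule integrable_mult_indicator)
  have "(LINT x:E|M. comb c (\<lambda>i. a i x)) = (LINT x|M. (\<Sum>i<length c. c ! i * (indicator E x *\<^sub>R a i x)))"
    unfolding comb_def set_lebesgue_integral_def
    by (intro Bochner_Integration.integral_cong refl) (simp add: sum_distrib_left algebra_simps)
  also have "\<dots> = (\<Sum>i<length c. c ! i * (LINT x:E|M. a i x))"
    unfolding set_lebesgue_integral_def
    by (subst Bochner_Integration.integral_sum)
      (rule integrable_mult_right[OF int], intro sum.cong refl integral_mult_right_zero)
  finally show ?thesis
    using a(2)[OF E] by (simp add: comb_def)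
qed

lemma Q_uminus: "c \<in> Q \<Longrightarrow> map ((*) (-1)) c \<in> Q"
proof -
  assume c: "c \<in> Q"
  have "- x \<in> range of_rat" if "x \<in> range (of_rat :: rat \<Rightarrow> real)" for x
    using that by (metis (no_types, lifting) imageE of_rat_minus rangeI)
  with c have "set (map ((*) (-1)) c) \<subseteq> range of_rat"
    unfolding Q_def by auto
  then show ?thesis
    using c unfolding Q_def mem_Collect_eq comb_cmult by simp
qed

text \<open>The enumeration starts with the zero combination, which makes all running maxima
  nonnegative.\<close>

definition qq :: "nat \<Rightarrow> real list" where
  "qq n = (case n of 0 \<Rightarrow> [] | Suc k \<Rightarrow> from_nat_into Q k)"

lemma range_qq: "range qq = Q"
proof -
  have "Q \<noteq> {}" using Nil_Q by auto
  then have rng: "range (from_nat_into Q) = Q" using countable_Q by (rule range_from_nat_into)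
  show ?thesis
  proof (intro equalityI subsetI)
    fix c assume "c \<in> range qq"
    then obtain n where "c = qq n" by (rule rangeE)
    then show "c \<in> Q"
      by (cases n) (simp_all add: qq_def Nil_Q from_nat_into[OF \<open>Q \<noteq> {}\<close>])
  next
    fix c assume "c \<in> Q"
    then have "c \<in> range (from_nat_into Q)" by (simp only: rng)
    then obtain k where "c = from_nat_into Q k" by (rule rangeE)
    then show "c \<in> range qq" by (intro range_eqI[of _ _ "Suc k"]) (simp add: qq_def)
  qed
qed

lemma ball_Q: "(\<forall>c\<in>Q. R c) \<longleftrightarrow> (\<forall>j. R (qq j))"
  unfolding range_qq[symmetric] by blast

text \<open>On the set where \<open>qq j\<close> is the first maximiser among \<open>qq 0, \<dots>, qq n\<close>, the maximum is the density of
  \<open>qq j \<circ> G\<close>; these sets partition the space.\<close>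

lemma variation_density:
  assumes fm: "finite_measure M"
    and G: "G \<in> sets M \<rightarrow> carrier V"
    and C: "\<And>P. finite P \<Longrightarrow> P \<subseteq> sets M \<Longrightarrow> disjoint P \<Longrightarrow> \<Union>P = space M \<Longrightarrow> (\<Sum>A\<in>P. nrm V (G A)) \<le> C"
    and zero: "G {} = \<zero>\<^bsub>V\<^esub>"
    and a: "\<And>i. integrable M (a i)" "\<And>i E. E \<in> sets M \<Longrightarrow> p i (G E) = (LINT x:E|M. a i x)"
  shows "(\<integral>\<^sup>+x. (SUP c\<in>Q. ennreal (comb c (\<lambda>i. a i x))) \<partial>M) \<le> ennreal C"
proof -
  define f where "f j x = comb (qq j) (\<lambda>i. a i x)" for j x
  have f_int: "integrable M (f j)" for j
    unfolding f_def comb_def using a(1) by auto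
  then have [measurable]: "f j \<in> borel_measurable M" for j by auto
  define E where "E n j = {x \<in> space M. (\<forall>i\<in>{..n}. f i x \<le> f j x) \<and> (\<forall>i\<in>{..<j}. f i x < f j x)}" for n j
  have E_sets [measurable]: "E n j \<in> sets M" for n j
    unfolding E_def by measurable
  have E_ex: "\<exists>j\<le>n. x \<in> E n j" if "x \<in> space M" for n x
  proof -
    define Pj where "Pj j \<longleftrightarrow> j \<le> n \<and> (\<forall>i\<le>n. f i x \<le> f j x)" for j
    have "Max ((\<lambda>j. f j x) ` {..n}) \<in> (\<lambda>j. f j x) ` {..n}" by (intro Max_in) auto
    then obtain j where j: "Max ((\<lambda>j. f j x) ` {..n}) = f j x" "j \<in> {..n}" by blast
    have "f i x \<le> f j x" if "i \<le> n" for i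
      unfolding j(1)[symmetric] using that by (intro Max_ge) auto
    then have "Pj j" using j(2) unfolding Pj_def by auto
    then have L: "Pj (LEAST j. Pj j)" and least: "\<And>i. i < (LEAST j. Pj j) \<Longrightarrow> \<not> Pj i"
      by (auto intro: LeastI dest: not_less_Least)
    define j0 where "j0 = (LEAST j. Pj j)"
    have "f i x < f j0 x" if "i < j0" for i
    proof -
      have "i \<le> n" "\<not> Pj i" using that L least unfolding j0_def Pj_def by auto
      then obtain k where "k \<le> n" "f i x < f k x" unfolding Pj_def by (auto simp: not_le)
      moreover have "f k x \<le> f j0 x" if "k \<le> n" for k using L that unfolding j0_def Pj_def by auto
      ultimately show ?thesis by force
    qed
    moreover have "j0 \<le> n" "\<And>i. i \<le> n \<Longrightarrow> f i x \<le> f j0 x"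
      using L[folded j0_def] unfolding Pj_def by auto
    ultimately show ?thesis
      unfolding E_def using \<open>x \<in> space M\<close> by auto
  qed
  have E_disj': False if "i \<le> n" "j \<le> n" "i < j" "x \<in> E n i" "x \<in> E n j" for n i j x
  proof -
    have "f j x \<le> f i x" "f i x < f j x"
      using that unfolding E_def mem_Collect_eq by blast+
    then show False by simp
  qed
  have E_disj: "E n i \<inter> E n j = {}" if "i \<le> n" "j \<le> n" "i \<noteq> j" for n i j
    using E_disj'[OF that(1,2)] E_disj'[OF that(2,1)] that(3) by (meson disjoint_iff linorder_neqE_nat)
  define m where "m n x = (\<Sum>j\<le>n. indicator (E n j) x * f j x)" for n x
  have m_eq: "m n x = f j x" if "x \<in> E n j" "j \<le> n" for n j x
  proof -
    have "m n x = (\<Sum>i\<in>{j}. indicator (E n i) x * f i x)"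
      unfolding m_def using that E_disj[of _ n j]
      by (intro sum.mono_neutral_right) (auto simp: indicator_def)
    then show ?thesis using that by simp
  qed
  have m_ge: "f i x \<le> m n x" if "x \<in> space M" "i \<le> n" for i n x
    using E_ex[OF that(1), of n] m_eq that(2) unfolding E_def by fastforce
  have m_nonneg: "0 \<le> m n x" if "x \<in> space M" for n x
    using m_ge[OF that, of 0 n] by (simp add: f_def qq_def comb_def)
  have m_le: "ennreal (m n x) \<le> (SUP c\<in>Q. ennreal (comb c (\<lambda>i. a i x)))" if x: "x \<in> space M" for n x
  proof -
    obtain j where "j \<le> n" "x \<in> E n j" using E_ex[OF x] by blast
    then show ?thesis
      using range_qq by (auto simp: m_eq f_def intro!: SUP_upper)
  qed
  have m_mono: "m n x \<le> m (Suc n) x" if x: "x \<in> space M" for n x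
  proof -
    obtain j where "j \<le> n" "x \<in> E n j" using E_ex[OF x] by blast
    then show ?thesis using m_ge[OF x, of j "Suc n"] by (simp add: m_eq)
  qed
  have [measurable]: "m n \<in> borel_measurable M" for n unfolding m_def by measurable
  have sup: "(SUP c\<in>Q. ennreal (comb c (\<lambda>i. a i x))) = (SUP n. ennreal (m n x))" if x: "x \<in> space M" for x
  proof (rule antisym)
    show "(SUP c\<in>Q. ennreal (comb c (\<lambda>i. a i x))) \<le> (SUP n. ennreal (m n x))"
    proof (rule SUP_least)
      fix c assume "c \<in> Q"
      then obtain j where "c = qq j" using range_qq by blast
      then have "ennreal (comb c (\<lambda>i. a i x)) \<le> ennreal (m j x)"
        using m_ge[OF x, of j j] by (auto simp: f_def intro!: ennreal_leI)
      then show "ennreal (comb c (\<lambda>i. a i x)) \<le> (SUP n. ennreal (m n x))"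
        by (rule order_trans) (rule SUP_upper, simp)
    qed
    show "(SUP n. ennreal (m n x)) \<le> (SUP c\<in>Q. ennreal (comb c (\<lambda>i. a i x)))"
      using m_le[OF x] by (rule SUP_least)
  qed
  have bound: "(\<integral>\<^sup>+x. ennreal (m n x) \<partial>M) \<le> ennreal C" for n
  proof -
    have ind: "integrable M (\<lambda>x. indicator (E n j) x * f j x)" for j
      using integrable_mult_indicator[OF E_sets f_int, of n j j] by simp
    have m_int: "integrable M (m n)"
      unfolding m_def by (intro Bochner_Integration.integrable_sum ind)
    have "integral\<^sup>L M (m n) = (\<Sum>j\<le>n. LINT x|M. indicator (E n j) x * f j x)"
      unfolding m_def using ind by (intro Bochner_Integration.integral_sum) auto
    also have "\<dots> = (\<Sum>j\<le>n. pcomb (qq j) (G (E n j)))"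
      by (intro sum.cong refl) (simp add: comb_density[OF a E_sets] set_lebesgue_integral_def f_def)
    also have "\<dots> \<le> (\<Sum>j\<le>n. nrm V (G (E n j)))"
    proof (rule sum_mono)
      fix j
      have "qq j \<in> Q" using range_qq by blast
      then show "pcomb (qq j) (G (E n j)) \<le> nrm V (G (E n j))"
        using Q_le[of "qq j" "G (E n j)"] G E_sets by fastforce
    qed
    \<comment> \<open>The variation bound sums over a set of sets. Different indices can give the
      same set only if it is empty, and there \<open>G\<close> vanishes, so nothing is lost.\<close>
    also have "\<dots> = (\<Sum>A\<in>E n ` {..n}. nrm V (G A))"
    proof (subst sum.reindex_nontrivial)
      fix i j assume "i \<in> {..n}" "j \<in> {..n}" "i \<noteq> j" "E n i = E n j"
      then have "E n i = {}" using E_disj[of i n j] by auto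
      then show "nrm V (G (E n i)) = 0" using zero by simp
    qed auto
    also have "\<dots> \<le> C"
    proof (rule C)
      show "disjoint (E n ` {..n})"
        using E_disj[of _ n] by (auto simp: disjoint_def)
      show "\<Union> (E n ` {..n}) = space M"
      proof
        show "space M \<subseteq> \<Union> (E n ` {..n})" using E_ex[of _ n] by fastforce
      qed (auto simp: E_def)
    qed auto
    finally have "integral\<^sup>L M (m n) \<le> C" .
    then show ?thesis
      using nn_integral_eq_integral[OF m_int AE_I2[OF m_nonneg]] by (simp add: ennreal_leI)
  qed
  have "(\<integral>\<^sup>+x. (SUP c\<in>Q. ennreal (comb c (\<lambda>i. a i x))) \<partial>M) = (\<integral>\<^sup>+x. (SUP n. ennreal (m n x)) \<partial>M)"
    by (intro nn_integral_cong sup)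
  also have "\<dots> = (SUP n. \<integral>\<^sup>+x. ennreal (m n x) \<partial>M)"
  proof (rule nn_integral_monotone_convergence_SUP_AE)
    show "AE x in M. ennreal (m n x) \<le> ennreal (m (Suc n) x)" for n
      using m_mono by (intro AE_I2 ennreal_leI)
  qed measurable
  also have "\<dots> \<le> ennreal C" by (rule SUP_least) (rule bound)
  finally show ?thesis .
qed

text \<open>\<open>s n x\<close> is the point nearest to \<open>g x\<close> among the first
  \<open>n + 1\<close> members of a dense sequence, with ties broken by the least index. Only
  distances to fixed points enter the choice, so their measurability is enough. The sequence begins
  with zero, which gives the domination by \<open>nrm V (g x)\<close>.\<close>

lemma simple_nearest_point_approximation:
  fixes g :: "'b \<Rightarrow> 'v"
  assumes sep: "separable_normed V" and g: "\<And>x. g x \<in> carrier V"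
    and meas: "\<And>v. v \<in> carrier V \<Longrightarrow> (\<lambda>x. nrm V (g x \<ominus>\<^bsub>V\<^esub> v)) \<in> borel_measurable M"
  obtains s where "\<And>n::nat. simple_fun M V (s n)"
    "\<And>n. (\<lambda>x. nrm V (s n x \<ominus>\<^bsub>V\<^esub> g x)) \<in> borel_measurable M"
    "\<And>n x. nrm V (s n x \<ominus>\<^bsub>V\<^esub> g x) \<le> nrm V (g x)"
    "\<And>x. (\<lambda>n. nrm V (s n x \<ominus>\<^bsub>V\<^esub> g x)) \<longlonglongrightarrow> 0"
proof -
  obtain D where D: "countable D" "D \<subseteq> carrier V" "\<And>x e. x \<in> carrier V \<Longrightarrow> e > 0 \<Longrightarrow> \<exists>y\<in>D. nrm V (x \<ominus>\<^bsub>V\<^esub> y) < e"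
    using sep unfolding separable_normed_iff by blast
  define d where "d n = (case n of 0 \<Rightarrow> \<zero>\<^bsub>V\<^esub> | Suc k \<Rightarrow> from_nat_into D k)" for n
  have "D \<noteq> {}" using D(3)[of "\<zero>\<^bsub>V\<^esub>" 1] by auto
  then have rng: "range (from_nat_into D) = D" using D(1) by (rule range_from_nat_into)
  have dV: "d n \<in> carrier V" for n
    unfolding d_def using rng D(2) by (auto split: nat.splits)
  have dense: "\<exists>n. nrm V (x \<ominus>\<^bsub>V\<^esub> d n) < e" if x: "x \<in> carrier V" "e > 0" for x e
  proof -
    obtain y where y: "y \<in> D" "nrm V (x \<ominus>\<^bsub>V\<^esub> y) < e" using D(3)[OF x] by blast
    then obtain k where "y = from_nat_into D k" using rng by blast
    then show ?thesis using y by (intro exI[of _ "Suc k"]) (simp add: d_def)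
  qed
  define F where "F j x = nrm V (g x \<ominus>\<^bsub>V\<^esub> d j)" for j x
  have [measurable]: "F j \<in> borel_measurable M" for j unfolding F_def using meas dV by simp
  define near where "near n j x \<longleftrightarrow> j \<le> n \<and> (\<forall>i\<in>{..n}. F j x \<le> F i x)" for n j x
  define k where "k n x = (LEAST j. near n j x)" for n x
  have k_meas [measurable]: "k n \<in> measurable M (count_space UNIV)" for n
    unfolding k_def near_def by (intro measurable_Least) measurable
  have near: "near n (k n x) x" for n x
  proof -
    have "Min ((\<lambda>j. F j x) ` {..n}) \<in> (\<lambda>j. F j x) ` {..n}" by (intro Min_in) auto
    then obtain j where j: "Min ((\<lambda>j. F j x) ` {..n}) = F j x" "j \<in> {..n}" by blast
    have "F j x \<le> F i x" if "i \<le> n" for i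
      unfolding j(1)[symmetric] using that by (intro Min_le) auto
    then have "near n j x" using j(2) unfolding near_def by auto
    then show ?thesis unfolding k_def by (rule LeastI)
  qed
  define s where "s n x = d (k n x)" for n x
  have sV: "s n x \<in> carrier V" for n x using dV by (simp add: s_def)
  have s_eq: "nrm V (s n x \<ominus>\<^bsub>V\<^esub> g x) = F (k n x) x" for n x
    unfolding s_def F_def using dV g by (rule nrm_minus_commute)
  have s_le: "nrm V (s n x \<ominus>\<^bsub>V\<^esub> g x) \<le> F j x" if "j \<le> n" for n j x
    using near[of n x] that unfolding s_eq near_def by auto
  show thesis
  proof (rule that)
    fix n
    show "simple_fun M V (s n)"
      unfolding simple_fun_def
    proof (intro conjI allI)
      show "s n \<in> space M \<rightarrow> carrier V" using sV by auto
      have "s n ` space M \<subseteq> d ` {..n}" using near unfolding near_def s_def by auto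
      then show "finite (s n ` space M)" by (rule finite_subset) auto
      fix v
      have "s n -` {v} \<inter> space M = k n -` (d -` {v}) \<inter> space M" by (auto simp: s_def)
      also have "\<dots> \<in> sets M" by (rule measurable_sets[OF k_meas]) simp
      finally show "s n -` {v} \<inter> space M \<in> sets M" .
    qed
    show "(\<lambda>x. nrm V (s n x \<ominus>\<^bsub>V\<^esub> g x)) \<in> borel_measurable M"
      unfolding s_eq by (rule measurable_compose_countable[OF _ k_meas]) measurable
  next
    fix n x
    show "nrm V (s n x \<ominus>\<^bsub>V\<^esub> g x) \<le> nrm V (g x)"
      using s_le[of 0 n x] g[of x] by (simp add: F_def d_def minus_eq_smult)
  next
    fix x
    show "(\<lambda>n. nrm V (s n x \<ominus>\<^bsub>V\<^esub> g x)) \<longlonglongrightarrow> 0"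
    proof (rule LIMSEQ_I)
      fix e :: real assume "e > 0"
      then obtain j where "F j x < e" using dense[OF g] unfolding F_def by blast
      then have "nrm V (s n x \<ominus>\<^bsub>V\<^esub> g x) < e" if "n \<ge> j" for n
        using s_le[OF that, of x] by simp
      then show "\<exists>no. \<forall>n\<ge>no. norm (nrm V (s n x \<ominus>\<^bsub>V\<^esub> g x) - 0) < e"
        using sV g by (intro exI[of _ j]) auto
    qed
  qed
qed

lemma pcomb_simple_integral:
  assumes fm: "finite_measure M" and s: "simple_fun M V s" and E: "E \<in> sets M"
  shows "simple_integral_on M V E s \<in> carrier V"
    and "integrable M (\<lambda>x. pcomb c (s x))"
    and "pcomb c (simple_integral_on M V E s) = (LINT x:E|M. pcomb c (s x))"
proof -
  interpret finite_measure M by fact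
  have sV: "s x \<in> carrier V" if "x \<in> space M" for x using s that unfolding simple_fun_def by auto
  have fin: "finite (s ` space M)" and pre: "s -` {v} \<inter> space M \<in> sets M" for v
    using s unfolding simple_fun_def by auto
  show "simple_integral_on M V E s \<in> carrier V"
    unfolding simple_integral_on_def using sV by (intro M.finsum_closed) auto
  have preE: "s -` {v} \<inter> E \<in> sets M" for v
  proof -
    have "s -` {v} \<inter> E = (s -` {v} \<inter> space M) \<inter> E" using sets.sets_into_space[OF E] by auto
    then show ?thesis using pre E by auto
  qed
  have expand: "pcomb c (s x) = (\<Sum>v\<in>s ` space M. pcomb c v * indicator (s -` {v} \<inter> space M) x)"
    if x: "x \<in> space M" for x
  proof -
    have "(\<Sum>v\<in>s ` space M. pcomb c v * indicator (s -` {v} \<inter> space M) x) =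
        (\<Sum>v\<in>{s x}. pcomb c v * indicator (s -` {v} \<inter> space M) x)"
      using fin x by (intro sum.mono_neutral_right) (auto simp: indicator_def)
    then show ?thesis using x by simp
  qed
  have "integrable M (\<lambda>x. \<Sum>v\<in>s ` space M. pcomb c v * indicator (s -` {v} \<inter> space M) x)"
    using pre by (intro Bochner_Integration.integrable_sum integrable_mult_right integrable_real_indicator)
      (auto simp: emeasure_eq_measure)
  then show "integrable M (\<lambda>x. pcomb c (s x))"
    by (rule Bochner_Integration.integrable_cong[THEN iffD1, rotated 2]) (simp_all add: expand)
  have "(LINT x:E|M. pcomb c (s x)) = (LINT x|M. (\<Sum>v\<in>s ` space M. pcomb c v * indicator (s -` {v} \<inter> E) x))"
    unfolding set_lebesgue_integral_def
  proof (intro Bochner_Integration.integral_cong refl)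
    fix x assume "x \<in> space M"
    then show "indicator E x *\<^sub>R pcomb c (s x) = (\<Sum>v\<in>s ` space M. pcomb c v * indicator (s -` {v} \<inter> E) x)"
      by (auto simp: expand indicator_def intro!: sum.cong)
  qed
  also have "\<dots> = (\<Sum>v\<in>s ` space M. pcomb c v * measure M (s -` {v} \<inter> E))"
    using preE by (subst Bochner_Integration.integral_sum)
      (auto simp: emeasure_eq_measure intro!: integrable_mult_right integrable_real_indicator)
  also have "\<dots> = pcomb c (simple_integral_on M V E s)"
    unfolding simple_integral_on_def using fin sV
    by (subst pc.f_finsum) (auto simp: mult.commute intro!: sum.cong)
  finally show "pcomb c (simple_integral_on M V E s) = (LINT x:E|M. pcomb c (s x))" ..
qed

theorem radon_nikodym_property:
  assumes sep: "separable_normed V"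
  shows "radon_nikodym_property TYPE('b) V"
  unfolding radon_nikodym_property_def
proof (intro allI impI, elim conjE)
  fix M :: "'b measure" and G
  assume fm: "finite_measure M" and vm: "vector_measure M V G" and bv: "bounded_variation M V G"
    and ac: "abs_continuous M V G"
  interpret finite_measure M by fact
  have G: "G \<in> sets M \<rightarrow> carrier V" using vm unfolding vector_measure_def by blast
  obtain C where C: "\<And>P. finite P \<Longrightarrow> P \<subseteq> sets M \<Longrightarrow> disjoint P \<Longrightarrow> \<Union>P = space M \<Longrightarrow> (\<Sum>A\<in>P. nrm V (G A)) \<le> C"
    using bv unfolding bounded_variation_def by blast
  have zero: "G {} = \<zero>\<^bsub>V\<^esub>" using ac unfolding abs_continuous_def by auto
  obtain a where a: "\<And>i. integrable M (a i)" "\<And>i E. E \<in> sets M \<Longrightarrow> p i (G E) = (LINT x:E|M. a i x)"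
    using vector_measure_density[OF fm vm ac vector_measure_norm_le[OF G C]] by blast
  have [measurable]: "a i \<in> borel_measurable M" for i using a(1) by auto
  have comb_meas [measurable]: "(\<lambda>x. comb c (\<lambda>i. a i x)) \<in> borel_measurable M" for c
    unfolding comb_def by measurable
  \<comment> \<open>Candidate for the norm of the density at \<open>x\<close>: the supremum of the
    scalar densities over a norming set.\<close>
  define h where "h x = (SUP c\<in>Q. ennreal (comb c (\<lambda>i. a i x)))" for x
  have h_meas [measurable]: "h \<in> borel_measurable M"
    unfolding h_def using countable_Q by measurable
  have "(\<integral>\<^sup>+x. h x \<partial>M) \<le> ennreal C"
    using variation_density[OF fm G C zero a] unfolding h_def .
  then have h_int: "(\<integral>\<^sup>+x. h x \<partial>M) < \<infinity>"
    by (auto intro: order.strict_trans1)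
  then have h_fin: "AE x in M. h x \<noteq> \<infinity>"
    by (intro nn_integral_PInf_AE) auto
  have helly_h: "\<exists>v\<in>carrier V. nrm V v \<le> enn2real (h x) \<and> (\<forall>i. p i v = a i x)" if "h x \<noteq> \<infinity>" for x
  proof (rule helly)
    have le: "comb c (\<lambda>i. a i x) \<le> enn2real (h x)" if "c \<in> Q" for c
    proof -
      have "ennreal (comb c (\<lambda>i. a i x)) \<le> h x" unfolding h_def using that by (rule SUP_upper)
      then have "enn2real (ennreal (comb c (\<lambda>i. a i x))) \<le> enn2real (h x)"
        using \<open>h x \<noteq> \<infinity>\<close> by (intro enn2real_mono) (auto simp: less_top)
      then show ?thesis by (cases "comb c (\<lambda>i. a i x) \<ge> 0") (auto intro: order_trans[OF _ enn2real_nonneg])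
    qed
    fix c assume c: "c \<in> Q"
    show "\<bar>comb c (\<lambda>i. a i x)\<bar> \<le> enn2real (h x)"
      using le[OF c] le[OF Q_uminus[OF c]] unfolding comb_cmult by simp
  qed simp
  \<comment> \<open>On the null set where \<open>h\<close> is infinite the value is zero; as
    \<open>enn2real \<infinity>\<close> is 0, the bound by \<open>enn2real (h x)\<close> holds for
    every \<open>x\<close>.\<close>
  have "\<exists>v. v \<in> carrier V \<and> nrm V v \<le> enn2real (h x) \<and> (\<forall>i. p i v = (if h x = \<infinity> then 0 else a i x))" for x
  proof (cases "h x = \<infinity>")
    case True
    then show ?thesis by (intro exI[of _ "\<zero>\<^bsub>V\<^esub>"]) auto
  next
    case False
    then show ?thesis using helly_h[OF False] by auto
  qed
  then obtain g where gV: "\<And>x. g x \<in> carrier V" and g_nrm: "\<And>x. nrm V (g x) \<le> enn2real (h x)"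
    and g_p: "\<And>x i. p i (g x) = (if h x = \<infinity> then 0 else a i x)"
    by metis
  have pc_meas [measurable]: "(\<lambda>x. pcomb c (g x)) \<in> borel_measurable M" for c
    unfolding g_p comb_def by measurable
  have pc_AE: "AE x in M. pcomb c (g x) = comb c (\<lambda>i. a i x)" for c
    using h_fin by eventually_elim (simp add: g_p)
  have nrm_meas: "(\<lambda>x. nrm V (g x \<ominus>\<^bsub>V\<^esub> v)) \<in> borel_measurable M" if v: "v \<in> carrier V" for v
    unfolding borel_measurable_iff_le
  proof
    fix r
    \<comment> \<open>Norming over the countable \<open>Q\<close> writes the sublevel set of a norm
      as a countable intersection of measurable sets.\<close>
    have "nrm V (g x \<ominus>\<^bsub>V\<^esub> v) \<le> r \<longleftrightarrow> (\<forall>c\<in>Q. \<bar>pcomb c (g x) - pcomb c v\<bar> \<le> r)" for x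
      using norming[of "g x \<ominus>\<^bsub>V\<^esub> v" r] Q_le[of _ "g x \<ominus>\<^bsub>V\<^esub> v"] gV v by fastforce
    then have "{x \<in> space M. nrm V (g x \<ominus>\<^bsub>V\<^esub> v) \<le> r} =
        {x \<in> space M. \<forall>c\<in>Q. \<bar>pcomb c (g x) - pcomb c v\<bar> \<le> r}" by simp
    also have "\<dots> \<in> sets M"
      unfolding ball_Q by measurable
    finally show "{x \<in> space M. nrm V (g x \<ominus>\<^bsub>V\<^esub> v) \<le> r} \<in> sets M" .
  qed
  obtain s where s: "\<And>n::nat. simple_fun M V (s n)"
    and s_meas [measurable]: "\<And>n. (\<lambda>x. nrm V (s n x \<ominus>\<^bsub>V\<^esub> g x)) \<in> borel_measurable M"
    and s_le: "\<And>n x. nrm V (s n x \<ominus>\<^bsub>V\<^esub> g x) \<le> nrm V (g x)"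
    and s_lim: "\<And>x. (\<lambda>n. nrm V (s n x \<ominus>\<^bsub>V\<^esub> g x)) \<longlonglongrightarrow> 0"
    using simple_nearest_point_approximation[OF sep gV nrm_meas] by blast
  have sV: "s n x \<in> carrier V" if "x \<in> space M" for n x using s[of n] that unfolding simple_fun_def by auto
  have dist_le: "ennreal (nrm V (s n x \<ominus>\<^bsub>V\<^esub> g x)) \<le> h x" for n x
  proof (cases "h x = \<infinity>")
    case False
    then have "h x = ennreal (enn2real (h x))" by (simp add: less_top)
    moreover have "ennreal (nrm V (s n x \<ominus>\<^bsub>V\<^esub> g x)) \<le> ennreal (enn2real (h x))"
      using s_le[of n x] g_nrm[of x] by (intro ennreal_leI) simp
    ultimately show ?thesis by simp
  qed simp
  have L1: "(\<lambda>n. \<integral>\<^sup>+x. ennreal (nrm V (s n x \<ominus>\<^bsub>V\<^esub> g x)) \<partial>M) \<longlonglongrightarrow> (\<integral>\<^sup>+x. 0 \<partial>M)"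
  proof (rule nn_integral_dominated_convergence[where w = h])
    show "AE x in M. (\<lambda>n. ennreal (nrm V (s n x \<ominus>\<^bsub>V\<^esub> g x))) \<longlonglongrightarrow> 0"
      using tendsto_ennrealI[OF s_lim] by simp
  qed (use dist_le h_int in auto)
  show "\<exists>g. \<forall>E\<in>sets M. has_bochner_integral_on M V g E (G E)"
  proof (intro exI ballI)
    fix E assume E: "E \<in> sets M"
    have GE: "G E \<in> carrier V" using G E by auto
    define I where "I n = simple_integral_on M V E (s n)" for n
    have IV: "I n \<in> carrier V" for n
      unfolding I_def by (rule pcomb_simple_integral(1)[OF fm s E])
    \<comment> \<open>The triangle inequality for the not yet established Bochner integral is tested
      against each member of \<open>Q\<close>, where only scalar integrals occur.\<close>
    have I_le: "ennreal (nrm V (I n \<ominus>\<^bsub>V\<^esub> G E)) \<le> (\<integral>\<^sup>+x. ennreal (nrm V (s n x \<ominus>\<^bsub>V\<^esub> g x)) \<partial>M)" for n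
    proof -
      have "(\<integral>\<^sup>+x. ennreal (nrm V (s n x \<ominus>\<^bsub>V\<^esub> g x)) \<partial>M) \<le> (\<integral>\<^sup>+x. h x \<partial>M)"
        by (intro nn_integral_mono dist_le)
      then have fin: "(\<integral>\<^sup>+x. ennreal (nrm V (s n x \<ominus>\<^bsub>V\<^esub> g x)) \<partial>M) < \<infinity>"
        using h_int by (rule order.strict_trans1)
      have nn: "AE x in M. 0 \<le> nrm V (s n x \<ominus>\<^bsub>V\<^esub> g x)"
        using sV gV by (intro AE_I2) auto
      have int: "integrable M (\<lambda>x. nrm V (s n x \<ominus>\<^bsub>V\<^esub> g x))"
        using fin nn by (intro integrableI_nonneg) auto
      have "nrm V (I n \<ominus>\<^bsub>V\<^esub> G E) \<le> (LINT x|M. nrm V (s n x \<ominus>\<^bsub>V\<^esub> g x))"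
      proof (rule norming)
        fix c assume c: "c \<in> Q"
        have ca: "integrable M (\<lambda>x. comb c (\<lambda>i. a i x))"
          unfolding comb_def using a(1) by auto
        note ps = pcomb_simple_integral(2,3)[OF fm s[of n] E, of c]
        have "pcomb c (I n \<ominus>\<^bsub>V\<^esub> G E) = pcomb c (I n) - pcomb c (G E)"
          using IV GE by (rule pc.f_minus)
        also have "\<dots> = (LINT x:E|M. pcomb c (s n x)) - (LINT x:E|M. comb c (\<lambda>i. a i x))"
          unfolding I_def ps(2) using comb_density[where G = G, OF a E, of c] by simp
        also have "\<dots> = (LINT x:E|M. pcomb c (s n x) - comb c (\<lambda>i. a i x))"
          using ps(1) ca E by (intro set_integral_diff(2)[symmetric])
            (auto simp: set_integrable_def simp del: real_scaleR_def intro: integrable_mult_indicator)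
        finally have "\<bar>pcomb c (I n \<ominus>\<^bsub>V\<^esub> G E)\<bar> = \<bar>LINT x:E|M. pcomb c (s n x) - comb c (\<lambda>i. a i x)\<bar>"
          by simp
        also have "\<dots> \<le> (LINT x|M. \<bar>indicator E x *\<^sub>R (pcomb c (s n x) - comb c (\<lambda>i. a i x))\<bar>)"
          unfolding set_lebesgue_integral_def by (rule integral_abs_bound)
        also have "\<dots> \<le> (LINT x|M. nrm V (s n x \<ominus>\<^bsub>V\<^esub> g x))"
        proof (rule integral_mono_AE[OF _ int])
          show "integrable M (\<lambda>x. \<bar>indicator E x *\<^sub>R (pcomb c (s n x) - comb c (\<lambda>i. a i x))\<bar>)"
            using ps(1) ca E by (intro integrable_abs integrable_mult_indicator Bochner_Integration.integrable_diff)
          show "AE x in M. \<bar>indicator E x *\<^sub>R (pcomb c (s n x) - comb c (\<lambda>i. a i x))\<bar> \<le> nrm V (s n x \<ominus>\<^bsub>V\<^esub> g x)"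
            using pc_AE[of c] AE_space
          proof eventually_elim
            fix x assume x: "pcomb c (g x) = comb c (\<lambda>i. a i x)" "x \<in> space M"
            have "\<bar>pcomb c (s n x \<ominus>\<^bsub>V\<^esub> g x)\<bar> \<le> nrm V (s n x \<ominus>\<^bsub>V\<^esub> g x)"
              using sV[OF x(2)] gV by (intro Q_le[OF c]) auto
            moreover have "pcomb c (s n x \<ominus>\<^bsub>V\<^esub> g x) = pcomb c (s n x) - comb c (\<lambda>i. a i x)"
              unfolding x(1)[symmetric] using sV[OF x(2)] gV by (rule pc.f_minus)
            ultimately show "\<bar>indicator E x *\<^sub>R (pcomb c (s n x) - comb c (\<lambda>i. a i x))\<bar> \<le> nrm V (s n x \<ominus>\<^bsub>V\<^esub> g x)"
              using sV[OF x(2)] gV by (auto simp: indicator_def)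
          qed
        qed
        finally show "\<bar>pcomb c (I n \<ominus>\<^bsub>V\<^esub> G E)\<bar> \<le> (LINT x|M. nrm V (s n x \<ominus>\<^bsub>V\<^esub> g x))" .
      qed (use IV GE in auto)
      then show ?thesis
        unfolding nn_integral_eq_integral[OF int nn] by (rule ennreal_leI)
    qed
    have "(\<lambda>n. ennreal (nrm V (I n \<ominus>\<^bsub>V\<^esub> G E))) \<longlonglongrightarrow> ennreal 0"
    proof (rule tendsto_sandwich)
      show "\<forall>\<^sub>F n in sequentially. ennreal 0 \<le> ennreal (nrm V (I n \<ominus>\<^bsub>V\<^esub> G E))"
        by simp
      show "\<forall>\<^sub>F n in sequentially. ennreal (nrm V (I n \<ominus>\<^bsub>V\<^esub> G E)) \<le>
          (\<integral>\<^sup>+x. ennreal (nrm V (s n x \<ominus>\<^bsub>V\<^esub> g x)) \<partial>M)"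
        using I_le by simp
      show "(\<lambda>n. \<integral>\<^sup>+x. ennreal (nrm V (s n x \<ominus>\<^bsub>V\<^esub> g x)) \<partial>M) \<longlonglongrightarrow> ennreal 0"
        using L1 by simp
    qed (rule tendsto_const)
    then have I_lim: "(\<lambda>n. nrm V (I n \<ominus>\<^bsub>V\<^esub> G E)) \<longlonglongrightarrow> 0"
      using IV GE by (subst (asm) tendsto_ennreal_iff) auto
    have "strongly_measurable M V g"
      unfolding strongly_measurable_def
      by (intro conjI exI[of _ s] allI s AE_I2 s_lim) (use gV in auto)
    then show "has_bochner_integral_on M V g E (G E)"
      unfolding has_bochner_integral_on_def
      using GE L1 I_lim[unfolded I_def] by (intro conjI exI[of _ s] allI s) auto
  qed
qed

end

section \<open>Lorentz functionals\<close>

lemma nn_integral_ennreal_level: "(\<integral>\<^sup>+l. indicator {l. 0 \<le> l \<and> ennreal l < u} l \<partial>lborel) = u"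
proof (cases u)
  case (real r)
  then have "{l. 0 \<le> l \<and> ennreal l < u} = {0..<r}"
    by (auto simp: ennreal_less_iff)
  then show ?thesis using real by simp
next
  case top
  then have "{l. 0 \<le> l \<and> ennreal l < u} = {0..}" by (auto simp: ennreal_less_top)
  then have *: "(\<integral>\<^sup>+l. indicator {l. 0 \<le> l \<and> ennreal l < u} l \<partial>lborel) = emeasure lborel {0::real..}"
    by simp
  have "ennreal (real n) \<le> emeasure lborel {0::real..}" for n
  proof -
    have "ennreal (real n) = emeasure lborel {0..real n}" by simp
    also have "\<dots> \<le> emeasure lborel {0::real..}" by (intro emeasure_mono) auto
    finally show ?thesis .
  qed
  then have "emeasure lborel {0::real..} = \<infinity>"
    by (metis ennreal_of_nat_eq_real_of_nat ennreal_Ex_less_of_nat infinity_ennreal_def less_top not_le)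
  then show ?thesis using * top by simp
qed

section \<open>Distribution functions and truncated rearrangements\<close>

locale layer_cake = sigma_finite_measure M for M :: "'a measure"
begin

text \<open>Setting the distribution function to \<open>0\<close> on negative levels lets all level integrals range over \<open>lborel\<close>.\<close>

definition dist_fun :: "('a \<Rightarrow> ennreal) \<Rightarrow> real \<Rightarrow> ennreal" where
  "dist_fun F l = (if 0 \<le> l then emeasure M {t \<in> space M. ennreal l < F t} else 0)"

lemma pair_sigma_finite_lborel: "pair_sigma_finite M (lborel :: real measure)"
  by unfold_locales

lemma level_measurable [measurable]:
  assumes [measurable]: "F \<in> borel_measurable M"
  shows "(\<lambda>(t, l). indicator {l. 0 \<le> l \<and> ennreal l < F t} l :: ennreal) \<in> borel_measurable (M \<Otimes>\<^sub>M lborel)"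
  unfolding indicator_def by measurable

lemma dist_fun_eq_integral:
  assumes [measurable]: "F \<in> borel_measurable M"
  shows "dist_fun F l = (\<integral>\<^sup>+t. indicator {l. 0 \<le> l \<and> ennreal l < F t} l \<partial>M)"
proof -
  have "(\<integral>\<^sup>+t. indicator {l. 0 \<le> l \<and> ennreal l < F t} l \<partial>M) =
      (\<integral>\<^sup>+t. indicator {t \<in> space M. 0 \<le> l \<and> ennreal l < F t} t \<partial>M)"
    by (intro nn_integral_cong) (auto simp: indicator_def)
  also have "\<dots> = emeasure M {t \<in> space M. 0 \<le> l \<and> ennreal l < F t}"
    by (intro nn_integral_indicator) measurable
  finally show ?thesis by (auto simp: dist_fun_def)
qed

lemma dist_fun_measurable [measurable]:
  assumes [measurable]: "F \<in> borel_measurable M"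
  shows "dist_fun F \<in> borel_measurable borel"
proof -
  have "(\<lambda>l. \<integral>\<^sup>+t. indicator {l. 0 \<le> l \<and> ennreal l < F t} l \<partial>M) \<in> borel_measurable borel"
    unfolding indicator_def by measurable
  then show ?thesis by (simp add: dist_fun_eq_integral[symmetric])
qed

lemma dist_fun_neg [simp]: "l < 0 \<Longrightarrow> dist_fun F l = 0"
  by (simp add: dist_fun_def)

lemma dist_fun_mono:
  assumes "F \<in> borel_measurable M" "G \<in> borel_measurable M" "AE t in M. F t \<le> G t"
  shows "dist_fun F l \<le> dist_fun G l"
  unfolding dist_fun_def using assms
  by (auto intro!: emeasure_mono_AE elim!: eventually_mono)

lemma dist_fun_antimono:
  assumes [measurable]: "F \<in> borel_measurable M" and "0 \<le> l" "l \<le> k"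
  shows "dist_fun F k \<le> dist_fun F l"
  using assms(2,3) unfolding dist_fun_def
  by (auto intro!: emeasure_mono intro: order.strict_trans1[OF ennreal_leI])

lemma dist_fun_le_space: "dist_fun F l \<le> emeasure M (space M)"
  unfolding dist_fun_def by (auto intro: emeasure_space)

lemma layer_cake:
  assumes [measurable]: "F \<in> borel_measurable M"
  shows "(\<integral>\<^sup>+t. F t \<partial>M) = (\<integral>\<^sup>+l. dist_fun F l \<partial>lborel)"
proof -
  interpret pair_sigma_finite M "lborel :: real measure" by (rule pair_sigma_finite_lborel)
  have "(\<integral>\<^sup>+t. F t \<partial>M) = (\<integral>\<^sup>+t. \<integral>\<^sup>+l. indicator {l. 0 \<le> l \<and> ennreal l < F t} l \<partial>lborel \<partial>M)"
    by (simp add: nn_integral_ennreal_level)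
  also have "\<dots> = (\<integral>\<^sup>+l. \<integral>\<^sup>+t. indicator {l. 0 \<le> l \<and> ennreal l < F t} l \<partial>M \<partial>lborel)"
    by (intro Fubini'[symmetric]) measurable
  finally show ?thesis by (simp add: dist_fun_eq_integral)
qed

lemma layer_cake_product:
  assumes [measurable]: "F \<in> borel_measurable M" "K \<in> borel_measurable M"
  shows "(\<integral>\<^sup>+t. F t * K t \<partial>M) =
    (\<integral>\<^sup>+l. \<integral>\<^sup>+s. emeasure M {t \<in> space M. 0 \<le> l \<and> ennreal l < F t \<and> 0 \<le> s \<and> ennreal s < K t} \<partial>lborel \<partial>lborel)"
proof -
  interpret pair_sigma_finite M "lborel :: real measure" by (rule pair_sigma_finite_lborel)
  let ?i = "\<lambda>F l t. indicator {l. 0 \<le> l \<and> ennreal l < F t} l :: ennreal"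
  have i_meas: "(\<lambda>t. ?i F l t) \<in> borel_measurable M" for l
    unfolding indicator_def by measurable
  have "(\<integral>\<^sup>+t. F t * K t \<partial>M) = (\<integral>\<^sup>+t. \<integral>\<^sup>+l. ?i F l t * K t \<partial>lborel \<partial>M)"
    by (intro nn_integral_cong, subst nn_integral_multc) (auto simp: nn_integral_ennreal_level)
  also have "\<dots> = (\<integral>\<^sup>+l. \<integral>\<^sup>+t. ?i F l t * K t \<partial>M \<partial>lborel)"
    unfolding indicator_def by (intro Fubini'[symmetric]) measurable
  also have "\<dots> = (\<integral>\<^sup>+l. \<integral>\<^sup>+s. emeasure M {t \<in> space M. 0 \<le> l \<and> ennreal l < F t \<and> 0 \<le> s \<and> ennreal s < K t} \<partial>lborel \<partial>lborel)"
  proof (intro nn_integral_cong)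
    fix l
    have "(\<integral>\<^sup>+t. ?i F l t * K t \<partial>M) = (\<integral>\<^sup>+t. \<integral>\<^sup>+s. ?i F l t * ?i K s t \<partial>lborel \<partial>M)"
      by (intro nn_integral_cong, subst nn_integral_cmult) (auto simp: nn_integral_ennreal_level)
    also have "\<dots> = (\<integral>\<^sup>+s. \<integral>\<^sup>+t. ?i F l t * ?i K s t \<partial>M \<partial>lborel)"
      unfolding indicator_def by (intro Fubini'[symmetric]) measurable
    also have "\<dots> = (\<integral>\<^sup>+s. emeasure M {t \<in> space M. 0 \<le> l \<and> ennreal l < F t \<and> 0 \<le> s \<and> ennreal s < K t} \<partial>lborel)"
    proof (intro nn_integral_cong)
      fix s
      have "(\<integral>\<^sup>+t. ?i F l t * ?i K s t \<partial>M) =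
          (\<integral>\<^sup>+t. indicator {t \<in> space M. 0 \<le> l \<and> ennreal l < F t \<and> 0 \<le> s \<and> ennreal s < K t} t \<partial>M)"
        by (intro nn_integral_cong) (auto simp: indicator_def)
      also have "\<dots> = emeasure M {t \<in> space M. 0 \<le> l \<and> ennreal l < F t \<and> 0 \<le> s \<and> ennreal s < K t}"
        by (intro nn_integral_indicator) measurable
      finally show "(\<integral>\<^sup>+t. ?i F l t * ?i K s t \<partial>M) =
          emeasure M {t \<in> space M. 0 \<le> l \<and> ennreal l < F t \<and> 0 \<le> s \<and> ennreal s < K t}" .
    qed
    finally show "(\<integral>\<^sup>+t. ?i F l t * K t \<partial>M) =
        (\<integral>\<^sup>+s. emeasure M {t \<in> space M. 0 \<le> l \<and> ennreal l < F t \<and> 0 \<le> s \<and> ennreal s < K t} \<partial>lborel)" .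
  qed
  finally show ?thesis .
qed

text \<open>\<open>trunc a F\<close> is \<open>\<integral>\<close> of the decreasing rearrangement of \<open>F\<close> over \<open>[0, a]\<close>.\<close>

definition trunc :: "ennreal \<Rightarrow> ('a \<Rightarrow> ennreal) \<Rightarrow> ennreal" where
  "trunc a F = (\<integral>\<^sup>+l. min (dist_fun F l) a \<partial>lborel)"

text \<open>Subtraction in \<open>ennreal\<close> truncates at zero, so the distribution function of
  the excess is that of \<open>F\<close> shifted by \<open>\<mu>\<close>.\<close>

lemma nn_integral_excess:
  assumes [measurable]: "F \<in> borel_measurable M" and "0 \<le> \<mu>"
  shows "(\<integral>\<^sup>+t. F t - ennreal \<mu> \<partial>M) = (\<integral>\<^sup>+l. dist_fun F l * indicator {\<mu>..} l \<partial>lborel)"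
proof -
  have "(\<integral>\<^sup>+t. F t - ennreal \<mu> \<partial>M) = (\<integral>\<^sup>+l. dist_fun (\<lambda>t. F t - ennreal \<mu>) l \<partial>lborel)"
    by (rule layer_cake) measurable
  also have "\<dots> = (\<integral>\<^sup>+l. dist_fun F (\<mu> + 1 * l) * indicator {\<mu>..} (\<mu> + 1 * l) \<partial>lborel)"
  proof (intro nn_integral_cong)
    fix l :: real
    have "ennreal l < F t - ennreal \<mu> \<longleftrightarrow> ennreal (\<mu> + l) < F t" if "0 \<le> l" for t
      using that \<open>0 \<le> \<mu>\<close> by (cases "F t") (auto simp: ennreal_less_iff ennreal_minus_if simp del: ennreal_plus)
    then show "dist_fun (\<lambda>t. F t - ennreal \<mu>) l = dist_fun F (\<mu> + 1 * l) * indicator {\<mu>..} (\<mu> + 1 * l)"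
      using \<open>0 \<le> \<mu>\<close> by (auto simp: dist_fun_def indicator_def)
  qed
  also have "\<dots> = (\<integral>\<^sup>+l. dist_fun F l * indicator {\<mu>..} l \<partial>lborel)"
    by (subst (2) nn_integral_real_affine[where c = 1 and t = \<mu>]) auto
  finally show ?thesis .
qed

text \<open>Below \<open>\<mu>\<close> the minimum is bounded by \<open>a\<close>, above it by the
  distribution function. With \<open>trunc_attained\<close> this exhibits \<open>trunc a F\<close>
  as a minimum over thresholds \<open>\<mu>\<close>.\<close>

lemma trunc_le:
  assumes [measurable]: "F \<in> borel_measurable M" and "0 \<le> \<mu>"
  shows "trunc a F \<le> a * ennreal \<mu> + (\<integral>\<^sup>+t. F t - ennreal \<mu> \<partial>M)"
proof -
  have "trunc a F \<le> (\<integral>\<^sup>+l. a * indicator {0..<\<mu>} l + dist_fun F l * indicator {\<mu>..} l \<partial>lborel)"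
    unfolding trunc_def using \<open>0 \<le> \<mu>\<close>
    by (intro nn_integral_mono) (auto simp: indicator_def not_le not_less)
  also have "\<dots> = a * ennreal \<mu> + (\<integral>\<^sup>+l. dist_fun F l * indicator {\<mu>..} l \<partial>lborel)"
    using \<open>0 \<le> \<mu>\<close> by (subst nn_integral_add) (auto simp: nn_integral_cmult_indicator)
  finally show ?thesis by (simp add: nn_integral_excess assms)
qed

lemma trunc_attained:
  assumes F [measurable]: "F \<in> borel_measurable M" and a: "a \<noteq> 0" and fin: "trunc a F < \<infinity>"
  shows "\<exists>\<mu>\<ge>0. trunc a F = a * ennreal \<mu> + (\<integral>\<^sup>+t. F t - ennreal \<mu> \<partial>M)"
proof -
  \<comment> \<open>The infimum of \<open>S\<close> is the level at which the distribution function
    falls to \<open>a\<close>, that is, the decreasing rearrangement at \<open>a\<close>. If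
    \<open>S\<close> were empty, the minimum would equal \<open>a\<close> on a half-line and have
    infinite integral.\<close>
  define S where "S = {l. 0 \<le> l \<and> dist_fun F l \<le> a}"
  have "S \<noteq> {}"
  proof
    assume "S = {}"
    then have "a < dist_fun F l" if "0 \<le> l" for l
      using that unfolding S_def by (auto simp: not_le[symmetric])
    then have "min (dist_fun F l) a = a * indicator {0..} l" for l
      by (cases "0 \<le> l") (auto simp: min_def dest: leD)
    then have "trunc a F = a * emeasure lborel {0::real..}"
      unfolding trunc_def by (simp add: nn_integral_cmult_indicator)
    also have "emeasure lborel {0::real..} = \<infinity>"
      using nn_integral_ennreal_level[of \<infinity>] by (simp add: ennreal_less_top atLeast_def)
    finally show False using fin a by (simp add: ennreal_mult_top)
  qed
  have bdd: "bdd_below S" unfolding S_def by (rule bdd_belowI[of _ 0]) auto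
  define \<mu> where "\<mu> = Inf S"
  have "\<mu> \<ge> 0" unfolding \<mu>_def using \<open>S \<noteq> {}\<close> by (intro cInf_greatest) (auto simp: S_def)
  have "min (dist_fun F l) a = a * indicator {0..<\<mu>} l + dist_fun F l * indicator {\<mu>..} l" if lm: "l \<noteq> \<mu>" for l
  proof -
    consider "l < 0" | "0 \<le> l" "l < \<mu>" | "l > \<mu>" using lm by linarith
    then show ?thesis
    proof cases
      case 1
      then show ?thesis using \<open>\<mu> \<ge> 0\<close> by simp
    next
      case 2
      then have "l \<notin> S" unfolding \<mu>_def using cInf_lower[OF _ bdd, of l] by auto
      then show ?thesis using 2 by (auto simp: S_def)
    next
      case 3
      then obtain k where "k \<in> S" "k < l" unfolding \<mu>_def using cInf_lessD[OF \<open>S \<noteq> {}\<close>] by auto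
      then have "dist_fun F l \<le> a"
        using dist_fun_antimono[OF F, of k l] unfolding S_def by (auto intro: order_trans)
      then show ?thesis using 3 \<open>\<mu> \<ge> 0\<close> by (simp add: min_def)
    qed
  qed
  then have "AE l in lborel. min (dist_fun F l) a = a * indicator {0..<\<mu>} l + dist_fun F l * indicator {\<mu>..} l"
    by (intro eventually_mono[OF AE_lborel_singleton[of \<mu>]])
  then have "trunc a F = (\<integral>\<^sup>+l. a * indicator {0..<\<mu>} l + dist_fun F l * indicator {\<mu>..} l \<partial>lborel)"
    unfolding trunc_def by (rule nn_integral_cong_AE)
  also have "\<dots> = a * ennreal \<mu> + (\<integral>\<^sup>+l. dist_fun F l * indicator {\<mu>..} l \<partial>lborel)"
    using \<open>0 \<le> \<mu>\<close> by (subst nn_integral_add) (auto simp: nn_integral_cmult_indicator)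
  finally show ?thesis using \<open>0 \<le> \<mu>\<close> by (auto simp: nn_integral_excess)
qed

text \<open>The optimal thresholds of \<open>F\<close> and \<open>G\<close> are added: their sum is
  an admissible threshold for the sum, and the excess over it is at most the sum of the two
  excesses.\<close>

lemma trunc_add:
  assumes F [measurable]: "F \<in> borel_measurable M" and G [measurable]: "G \<in> borel_measurable M"
  shows "trunc a (\<lambda>t. F t + G t) \<le> trunc a F + trunc a G"
proof (cases "a = 0 \<or> trunc a F = \<infinity> \<or> trunc a G = \<infinity>")
  case True
  then show ?thesis by (auto simp: trunc_def)
next
  case False
  then obtain \<mu> \<nu> where \<mu>: "\<mu> \<ge> 0" "trunc a F = a * ennreal \<mu> + (\<integral>\<^sup>+t. F t - ennreal \<mu> \<partial>M)"
      and \<nu>: "\<nu> \<ge> 0" "trunc a G = a * ennreal \<nu> + (\<integral>\<^sup>+t. G t - ennreal \<nu> \<partial>M)"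
    using trunc_attained[OF F, of a] trunc_attained[OF G, of a] by (auto simp: less_top)
  have le: "x + y - ennreal (\<mu> + \<nu>) \<le> (x - ennreal \<mu>) + (y - ennreal \<nu>)" for x y
    using \<mu>(1) \<nu>(1)
    by (cases x; cases y) (auto simp: ennreal_minus_if ennreal_plus[symmetric] simp del: ennreal_plus intro!: ennreal_leI)
  have "trunc a (\<lambda>t. F t + G t) \<le> a * ennreal (\<mu> + \<nu>) + (\<integral>\<^sup>+t. F t + G t - ennreal (\<mu> + \<nu>) \<partial>M)"
    using \<mu> \<nu> by (intro trunc_le) auto
  also have "\<dots> \<le> a * ennreal (\<mu> + \<nu>) + (\<integral>\<^sup>+t. (F t - ennreal \<mu>) + (G t - ennreal \<nu>) \<partial>M)"
    using \<mu> \<nu> le by (intro add_left_mono nn_integral_mono) simp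
  also have "\<dots> = trunc a F + trunc a G"
    using \<mu> \<nu> by (subst nn_integral_add) (auto simp: algebra_simps)
  finally show ?thesis .
qed

end

section \<open>The integral of a product of two decreasing rearrangements\<close>

locale lorentz_functional = layer_cake M for M :: "'a measure" +
  fixes wt :: "'a \<Rightarrow> ennreal"
  assumes wt_measurable [measurable]: "wt \<in> borel_measurable M"
begin

text \<open>The integral of the product of the decreasing rearrangements of \<open>F\<close> and
  \<open>wt\<close>: their level sets are nested initial intervals, so the intersections have the
  smaller of the two lengths.\<close>

definition H :: "('a \<Rightarrow> ennreal) \<Rightarrow> ennreal" where
  "H F = (\<integral>\<^sup>+l. \<integral>\<^sup>+s. min (dist_fun F l) (dist_fun wt s) \<partial>lborel \<partial>lborel)"

text \<open>Integrating over \<open>l\<close> first exhibits \<open>H\<close> as a superposition of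
  the subadditive functionals \<open>trunc\<close>.\<close>

lemma H_eq_trunc:
  assumes [measurable]: "F \<in> borel_measurable M"
  shows "H F = (\<integral>\<^sup>+s. trunc (dist_fun wt s) F \<partial>lborel)"
  unfolding H_def trunc_def by (rule lborel_pair.Fubini') measurable

lemma H_mono:
  assumes "F \<in> borel_measurable M" "G \<in> borel_measurable M" "AE t in M. F t \<le> G t"
  shows "H F \<le> H G"
  unfolding H_def using dist_fun_mono[OF assms]
  by (intro nn_integral_mono min.mono) auto

lemma H_add:
  assumes [measurable]: "F \<in> borel_measurable M" "G \<in> borel_measurable M"
  shows "H (\<lambda>t. F t + G t) \<le> H F + H G"
proof -
  have [measurable]: "(\<lambda>s. trunc (dist_fun wt s) K) \<in> borel_measurable borel"
    if [measurable]: "K \<in> borel_measurable M" for K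
    unfolding trunc_def by measurable
  have "H (\<lambda>t. F t + G t) \<le> (\<integral>\<^sup>+s. trunc (dist_fun wt s) F + trunc (dist_fun wt s) G \<partial>lborel)"
    by (subst H_eq_trunc) (auto intro!: nn_integral_mono trunc_add)
  also have "\<dots> = H F + H G"
    by (subst nn_integral_add) (auto simp: H_eq_trunc)
  finally show ?thesis .
qed

lemma H_0 [simp]: "H (\<lambda>_. 0) = 0"
proof -
  have "dist_fun (\<lambda>_. 0) l = 0" for l by (simp add: dist_fun_def)
  then show ?thesis by (simp add: H_def)
qed

lemma H_cmult:
  assumes [measurable]: "F \<in> borel_measurable M" and c: "0 \<le> c"
  shows "H (\<lambda>t. ennreal c * F t) = ennreal c * H F"
proof (cases "c = 0")
  case False
  then have c: "c > 0" using c by simp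
  have d: "dist_fun (\<lambda>t. ennreal c * F t) (0 + c * l) = dist_fun F l" for l
  proof -
    have "ennreal (c * l) < ennreal c * F t \<longleftrightarrow> ennreal l < F t" if "0 \<le> l" for t
      using c that by (cases "F t") (auto simp: ennreal_mult[symmetric] ennreal_less_iff ennreal_mult_top)
    then show ?thesis using c by (simp add: dist_fun_def zero_le_mult_iff)
  qed
  have "H (\<lambda>t. ennreal c * F t) = ennreal \<bar>c\<bar> *
      (\<integral>\<^sup>+l. \<integral>\<^sup>+s. min (dist_fun (\<lambda>t. ennreal c * F t) (0 + c * l)) (dist_fun wt s) \<partial>lborel \<partial>lborel)"
    unfolding H_def using c by (intro nn_integral_real_affine) auto
  then show ?thesis unfolding d using c by (simp add: H_def)
qed simp

text \<open>The Hardy-Littlewood inequality: an intersection of level sets has at most the measure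
  of each of them.\<close>

lemma nn_integral_le_H:
  assumes [measurable]: "F \<in> borel_measurable M"
  shows "(\<integral>\<^sup>+t. F t * wt t \<partial>M) \<le> H F"
  unfolding layer_cake_product[OF assms wt_measurable] H_def
proof (intro nn_integral_mono min.boundedI)
  fix l s
  let ?A = "{t \<in> space M. 0 \<le> l \<and> ennreal l < F t \<and> 0 \<le> s \<and> ennreal s < wt t}"
  have "emeasure M ?A \<le> emeasure M {t \<in> space M. ennreal l < F t}"
    "emeasure M ?A \<le> emeasure M {t \<in> space M. ennreal s < wt t}"
    by (intro emeasure_mono; auto)+
  then show "emeasure M ?A \<le> dist_fun F l" "emeasure M ?A \<le> dist_fun wt s"
    unfolding dist_fun_def by auto
qed

text \<open>Levels are defined by a strict inequality, so a point above level \<open>l\<close> for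
  the lower limit is eventually above it along the sequence; Fatou's lemma does the rest.\<close>

lemma dist_fun_liminf:
  assumes [measurable]: "\<And>n. F n \<in> borel_measurable M" "G \<in> borel_measurable M"
    and le: "AE t in M. G t \<le> liminf (\<lambda>n. F n t)"
  shows "dist_fun G l \<le> liminf (\<lambda>n. dist_fun (F n) l)"
proof -
  let ?i = "\<lambda>F t. indicator {l. 0 \<le> l \<and> ennreal l < F t} l :: ennreal"
  have i_meas [measurable]: "?i F \<in> borel_measurable M" if [measurable]: "F \<in> borel_measurable M" for F
    unfolding indicator_def by measurable
  have "dist_fun G l \<le> (\<integral>\<^sup>+t. liminf (\<lambda>n. ?i (F n) t) \<partial>M)"
    unfolding dist_fun_eq_integral[OF assms(2)]
  proof (rule nn_integral_mono_AE)
    show "AE t in M. ?i G t \<le> liminf (\<lambda>n. ?i (F n) t)"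
      using le
    proof eventually_elim
      fix t assume t: "G t \<le> liminf (\<lambda>n. F n t)"
      show "?i G t \<le> liminf (\<lambda>n. ?i (F n) t)"
      proof (cases "0 \<le> l \<and> ennreal l < G t")
        case True
        then have "ennreal l < liminf (\<lambda>n. F n t)" using t by (auto intro: order.strict_trans2)
        then have "\<forall>\<^sub>F n in sequentially. ennreal l < F n t" by (rule less_LiminfD)
        then have "\<forall>\<^sub>F n in sequentially. 1 \<le> ?i (F n) t"
          by eventually_elim (use True in simp)
        then have "1 \<le> liminf (\<lambda>n. ?i (F n) t)" by (rule Liminf_bounded)
        then show ?thesis using True by simp
      qed simp
    qed
  qed
  also have "\<dots> \<le> liminf (\<lambda>n. \<integral>\<^sup>+t. ?i (F n) t \<partial>M)"
    by (rule nn_integral_liminf) measurable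
  finally show ?thesis by (simp add: dist_fun_eq_integral)
qed

lemma H_liminf:
  assumes F [measurable]: "\<And>n. F n \<in> borel_measurable M" and G [measurable]: "G \<in> borel_measurable M"
    and le: "AE t in M. G t \<le> liminf (\<lambda>n. F n t)"
  shows "H G \<le> liminf (\<lambda>n. H (F n))"
proof -
  have min_lim: "min x b \<le> liminf (\<lambda>n. min (y n) b)" if "x \<le> liminf y" for x b :: ennreal and y
    unfolding le_Liminf_iff
  proof (intro allI impI)
    fix z assume "z < min x b"
    then have "z < liminf y" "z < b" using that by (auto intro: order.strict_trans2)
    then show "\<forall>\<^sub>F n in sequentially. z < min (y n) b"
      using less_LiminfD[of z sequentially y] by (auto elim: eventually_mono)
  qed
  have "H G \<le> (\<integral>\<^sup>+l. \<integral>\<^sup>+s. liminf (\<lambda>n. min (dist_fun (F n) l) (dist_fun wt s)) \<partial>lborel \<partial>lborel)"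
    unfolding H_def by (intro nn_integral_mono min_lim dist_fun_liminf[OF F G le])
  also have "\<dots> \<le> (\<integral>\<^sup>+l. liminf (\<lambda>n. \<integral>\<^sup>+s. min (dist_fun (F n) l) (dist_fun wt s) \<partial>lborel) \<partial>lborel)"
    by (intro nn_integral_mono nn_integral_liminf) measurable
  also have "\<dots> \<le> liminf (\<lambda>n. H (F n))"
    unfolding H_def by (intro nn_integral_liminf) measurable
  finally show ?thesis .
qed

text \<open>Dominated convergence is used three times: in \<open>t\<close> on a level set, in
  \<open>s\<close>, and in \<open>l\<close>. The first use requires level sets of \<open>G\<close>
  of finite measure, which is what \<open>dist_fin\<close> provides; for weights it comes from
  \<open>dist_fun_finite\<close>.\<close>

lemma H_tendsto_0:
  assumes F [measurable]: "\<And>n. F n \<in> borel_measurable M" and G [measurable]: "G \<in> borel_measurable M"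
    and le: "\<And>n. AE t in M. F n t \<le> G t" and lim: "AE t in M. (\<lambda>n. F n t) \<longlonglongrightarrow> 0"
    and fin: "H G < \<infinity>"
    and dist_fin: "\<And>l. (\<integral>\<^sup>+s. min (dist_fun G l) (dist_fun wt s) \<partial>lborel) < \<infinity> \<Longrightarrow> 0 < l \<Longrightarrow> dist_fun G l < \<infinity>"
  shows "(\<lambda>n. H (F n)) \<longlonglongrightarrow> 0"
proof -
  define W where "W F l = (\<integral>\<^sup>+s. min (dist_fun F l) (dist_fun wt s) \<partial>lborel)" for F l
  have [measurable]: "W F \<in> borel_measurable borel" if [measurable]: "F \<in> borel_measurable M" for F
    unfolding W_def by measurable
  have dle: "dist_fun (F n) l \<le> dist_fun G l" for n l by (rule dist_fun_mono[OF F G le])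
  have "AE l in lborel. W G l \<noteq> \<infinity>"
    using fin unfolding H_def W_def by (intro nn_integral_PInf_AE) auto
  then have W_lim: "AE l in lborel. (\<lambda>n. W (F n) l) \<longlonglongrightarrow> 0"
    using AE_lborel_singleton[of 0]
  proof eventually_elim
    fix l :: real assume l: "W G l \<noteq> \<infinity>" "l \<noteq> 0"
    show "(\<lambda>n. W (F n) l) \<longlonglongrightarrow> 0"
    proof (cases "l > 0")
      case False
      then show ?thesis using l by (simp add: W_def)
    next
      case True
      have Gfin: "dist_fun G l < \<infinity>"
        using dist_fin[of l] l True unfolding W_def by (simp add: less_top)
      let ?i = "\<lambda>F t. indicator {l. 0 \<le> l \<and> ennreal l < F t} l :: ennreal"
      have i_meas [measurable]: "?i F \<in> borel_measurable M" if [measurable]: "F \<in> borel_measurable M" for F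
        unfolding indicator_def by measurable
      have "(\<lambda>n. \<integral>\<^sup>+t. ?i (F n) t \<partial>M) \<longlonglongrightarrow> (\<integral>\<^sup>+t. 0 \<partial>M)"
      proof (rule nn_integral_dominated_convergence[where w = "?i G"])
        show "AE t in M. ?i (F n) t \<le> ?i G t" for n
          using le[of n] by eventually_elim (auto simp: indicator_def)
        show "(\<integral>\<^sup>+t. ?i G t \<partial>M) < \<infinity>"
          using Gfin by (simp add: dist_fun_eq_integral)
        show "AE t in M. (\<lambda>n. ?i (F n) t) \<longlonglongrightarrow> 0"
          using lim
        proof eventually_elim
          fix t assume "(\<lambda>n. F n t) \<longlonglongrightarrow> 0"
          then have "\<forall>\<^sub>F n in sequentially. F n t < ennreal l"
            using True by (intro order_tendstoD) auto
          then have "\<forall>\<^sub>F n in sequentially. ?i (F n) t = 0"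
            by eventually_elim (simp add: indicator_def not_less less_imp_le)
          then show "(\<lambda>n. ?i (F n) t) \<longlonglongrightarrow> 0"
            by (rule tendsto_eventually)
        qed
      qed measurable
      then have d0: "(\<lambda>n. dist_fun (F n) l) \<longlonglongrightarrow> 0" by (simp add: dist_fun_eq_integral)
      have "(\<lambda>n. W (F n) l) \<longlonglongrightarrow> (\<integral>\<^sup>+s. 0 \<partial>(lborel :: real measure))"
        unfolding W_def
      proof (rule nn_integral_dominated_convergence[where w = "\<lambda>s. min (dist_fun G l) (dist_fun wt s)"])
        show "AE s in lborel. min (dist_fun (F n) l) (dist_fun wt s) \<le> min (dist_fun G l) (dist_fun wt s)" for n
          by (intro AE_I2 min.mono dle order_refl)
        show "AE s in lborel. (\<lambda>n. min (dist_fun (F n) l) (dist_fun wt s)) \<longlonglongrightarrow> 0"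
        proof (rule AE_I2)
          fix s
          show "(\<lambda>n. min (dist_fun (F n) l) (dist_fun wt s)) \<longlonglongrightarrow> 0"
            by (rule tendsto_sandwich[OF _ _ tendsto_const d0]) auto
        qed
        show "(\<integral>\<^sup>+s. min (dist_fun G l) (dist_fun wt s) \<partial>lborel) < \<infinity>"
          using l unfolding W_def by (simp add: less_top)
      qed measurable
      then show ?thesis by simp
    qed
  qed
  have "(\<lambda>n. \<integral>\<^sup>+l. W (F n) l \<partial>lborel) \<longlonglongrightarrow> (\<integral>\<^sup>+l. 0 \<partial>(lborel :: real measure))"
  proof (rule nn_integral_dominated_convergence[where w = "W G"])
    show "AE l in lborel. W (F n) l \<le> W G l" for n
      unfolding W_def by (intro AE_I2 nn_integral_mono min.mono dle order_refl)
    show "(\<integral>\<^sup>+l. W G l \<partial>lborel) < \<infinity>" using fin unfolding H_def W_def .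
  qed (use W_lim in auto)
  then show ?thesis unfolding H_def W_def by simp
qed

end

section \<open>Decreasing weights on an interval\<close>

lemma half_open_infinity [simp]: "half_open \<infinity> = {0..}"
  and half_open_ereal [simp]: "half_open (ereal r) = {0..<r}"
  by (auto simp: half_open_def)

lemma half_open_borel [measurable]: "half_open \<gamma> \<in> sets borel"
proof -
  have "half_open \<gamma> = {t. 0 \<le> t \<and> ereal t < \<gamma>}" by (simp add: half_open_def)
  also have "\<dots> \<in> sets borel" by measurable
  finally show ?thesis .
qed

lemma half_open_lebesgue [simp, measurable]: "half_open \<gamma> \<in> sets lebesgue"
  using half_open_borel by auto

lemma half_open_downward: "t \<in> half_open \<gamma> \<Longrightarrow> 0 \<le> u \<Longrightarrow> u \<le> t \<Longrightarrow> u \<in> half_open \<gamma>"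
  by (auto simp: half_open_def intro: order.strict_trans1[of _ "ereal t"])

lemma sigma_finite_lebesgue_on:
  fixes S :: "real set"
  assumes "S \<in> sets lebesgue"
  shows "sigma_finite_measure (lebesgue_on S)"
proof
  let ?A = "range (\<lambda>n::nat. S \<inter> {- real n..real n})"
  have "\<exists>n::nat. x \<in> {- real n..real n}" for x
  proof -
    obtain n :: nat where "\<bar>x\<bar> \<le> real n" using real_arch_simple by blast
    then show ?thesis by (intro exI[of _ n]) auto
  qed
  then have "\<Union> ?A = S" by blast
  moreover have "emeasure (lebesgue_on S) (S \<inter> {- real n..real n}) \<noteq> \<infinity>" for n :: nat
  proof -
    have "emeasure (lebesgue_on S) (S \<inter> {- real n..real n}) = emeasure lebesgue (S \<inter> {- real n..real n})"
      using assms by (intro emeasure_restrict_space) auto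
    also have "\<dots> \<le> emeasure lebesgue {- real n..real n}"
      using assms by (intro emeasure_mono) auto
    also have "\<dots> < \<infinity>" by simp
    finally show ?thesis by simp
  qed
  ultimately show "\<exists>A. countable A \<and> A \<subseteq> sets (lebesgue_on S) \<and> \<Union> A = space (lebesgue_on S) \<and>
      (\<forall>a\<in>A. emeasure (lebesgue_on S) a \<noteq> \<infinity>)"
    using assms by (intro exI[of _ ?A]) (auto simp: sets_restrict_space image_iff)
qed

locale lorentz_weight =
  fixes \<gamma> :: ereal and w :: "real \<Rightarrow> real"
  assumes gamma_pos: "0 < \<gamma>" and weight: "weight_function \<gamma> w"
    and weight_infinite: "\<gamma> = \<infinity> \<Longrightarrow> weight_primitive w \<infinity> = \<infinity>"
begin

abbreviation "M \<equiv> lebesgue_on (half_open \<gamma>)"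

sublocale layer_cake M
  by (intro layer_cake.intro sigma_finite_lebesgue_on) simp

lemma space_M [simp]: "space M = half_open \<gamma>"
  by (simp add: space_restrict_space)

lemma sets_M_Collect: "Measurable.pred M P \<Longrightarrow> {t \<in> half_open \<gamma>. P t} \<in> sets M"
  by (simp add: pred_def)

lemma gamma_cases: obtains "\<gamma> = \<infinity>" | r where "\<gamma> = ereal r" "0 < r"
  using gamma_pos by (cases \<gamma>) auto

lemma borel_imp_measurable_M [measurable (raw)]: "f \<in> borel_measurable borel \<Longrightarrow> f \<in> borel_measurable M"
  by (intro measurable_restrict_space1 measurable_completion) simp

lemma sets_M_borel: "A \<in> sets borel \<Longrightarrow> A \<subseteq> half_open \<gamma> \<Longrightarrow> A \<in> sets M"
  by (auto simp: sets_restrict_space_iff)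

lemma emeasure_M: "A \<in> sets borel \<Longrightarrow> A \<subseteq> half_open \<gamma> \<Longrightarrow> emeasure M A = emeasure lborel A"
  by (subst emeasure_restrict_space) auto

lemma AE_M_pos: "AE t in M. t \<in> half_open \<gamma> - {0}"
proof -
  have "AE t in lebesgue. t \<noteq> (0::real)"
    by (rule AE_completion) (rule AE_lborel_singleton)
  then show ?thesis
    by (subst AE_restrict_space_iff) auto
qed

lemma w_pos: "t \<in> half_open \<gamma> \<Longrightarrow> t \<noteq> 0 \<Longrightarrow> 0 < w t"
  and w_antimono: "t \<in> half_open \<gamma> \<Longrightarrow> u \<in> half_open \<gamma> \<Longrightarrow> t \<noteq> 0 \<Longrightarrow> t \<le> u \<Longrightarrow> w u \<le> w t"
  and w_primitive: "t \<in> half_open \<gamma> \<Longrightarrow> weight_primitive w (ereal t) < \<infinity>"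
  using weight unfolding weight_function_def monotone_on_def by (auto simp: half_open_def)

lemma w_measurable [measurable]: "w \<in> borel_measurable M"
proof -
  have I0: "half_open \<gamma> - {0} \<in> sets borel" by measurable
  have "mono_on (half_open \<gamma> - {0}) (\<lambda>t. - w t)"
    using w_antimono by (intro mono_onI) auto
  then have "(\<lambda>t. - w t) \<in> borel_measurable (restrict_space borel (half_open \<gamma> - {0}))"
    by (rule borel_measurable_mono_on_fnc)
  then have "(\<lambda>t. - w t * indicator (half_open \<gamma> - {0}) t) \<in> borel_measurable borel"
    using I0 by (subst (asm) borel_measurable_restrict_space_iff) (auto simp: mult.commute)
  then have *: "(\<lambda>t. - (- w t * indicator (half_open \<gamma> - {0}) t)) \<in> borel_measurable M"
    by (intro borel_measurable_uminus borel_imp_measurable_M)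
  \<comment> \<open>Monotonicity is available away from the origin only; the arbitrary value
    \<open>w 0\<close> is restored by a case distinction.\<close>
  have "(\<lambda>t. if t = 0 then w 0 else - (- w t * indicator (half_open \<gamma> - {0}) t)) \<in> borel_measurable M"
  proof (intro measurable_If measurable_const *)
    have "{t \<in> space M. t = 0} = half_open \<gamma> \<inter> {0}" by auto
    then show "{t \<in> space M. t = 0} \<in> sets M" by (simp add: sets_M_borel)
  qed auto
  then show ?thesis
    by (rule measurable_cong[THEN iffD1, rotated]) auto
qed

sublocale lorentz_functional M "\<lambda>t. ennreal (w t)"
  by unfold_locales measurable

lemma emeasure_initial_segment:
  assumes "D \<le> emeasure M (half_open \<gamma>)"
  shows "emeasure M {t \<in> half_open \<gamma>. ennreal t < D} = D"
proof (cases D)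
  case (real r)
  have "{0..<r} \<subseteq> half_open \<gamma>"
  proof (cases rule: gamma_cases)
    case (2 g)
    then have "ennreal r \<le> ennreal g"
      using assms real by (subst (asm) emeasure_M) auto
    then show ?thesis using 2 by auto
  qed auto
  moreover from this have "{t \<in> half_open \<gamma>. ennreal t < D} = {0..<r}"
    using real by (auto simp: half_open_def ennreal_less_iff)
  ultimately show ?thesis using real by (simp add: emeasure_M)
next
  case top
  then have "{t \<in> half_open \<gamma>. ennreal t < D} = half_open \<gamma>" by (auto simp: ennreal_less_top)
  then show ?thesis using assms top by (simp add: top_unique)
qed

text \<open>Both sets are initial segments of the interval up to the point \<open>0\<close>, so one of them contains the other.\<close>

lemma emeasure_nested_segments:
  assumes D: "D \<le> emeasure M (half_open \<gamma>)"
  shows "emeasure M {t \<in> half_open \<gamma>. ennreal t < D \<and> ennreal s < ennreal (w t)} =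
    min D (emeasure M {t \<in> half_open \<gamma>. ennreal s < ennreal (w t)})"
proof -
  define A where "A = {t \<in> half_open \<gamma>. ennreal t < D}"
  define B where "B = {t \<in> half_open \<gamma>. ennreal s < ennreal (w t)}"
  have [measurable]: "A \<in> sets M" "B \<in> sets M"
    unfolding A_def B_def by (intro sets_M_Collect; measurable)+
  have AD: "emeasure M A = D" unfolding A_def by (rule emeasure_initial_segment[OF D])
  have eq: "emeasure M (A \<inter> B) = emeasure M C" if "C \<in> {A, B}" "C - {0} \<subseteq> A \<inter> B" for C
  proof (rule emeasure_eq_AE)
    show "AE t in M. t \<in> A \<inter> B \<longleftrightarrow> t \<in> C"
      using AE_M_pos by eventually_elim (use that in blast)
  qed (use that in auto)
  have "A - {0} \<subseteq> B \<or> B - {0} \<subseteq> A"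
  proof (rule ccontr)
    assume "\<not> ?thesis"
    then obtain t u where "t \<in> A" "t \<noteq> 0" "t \<notin> B" "u \<in> B" "u \<noteq> 0" "u \<notin> A" by blast
    then have tu: "t \<in> half_open \<gamma>" "u \<in> half_open \<gamma>" "\<not> ennreal s < ennreal (w t)" "ennreal s < ennreal (w u)"
        "ennreal t < D" "\<not> ennreal u < D"
      by (auto simp: A_def B_def)
    then have "t \<le> u" using ennreal_leI[of u t] by (meson le_less_trans linorder_le_cases not_less)
    then have "ennreal (w u) \<le> ennreal (w t)"
      using tu \<open>t \<noteq> 0\<close> w_antimono by (intro ennreal_leI) auto
    then show False using tu by auto
  qed
  then have "emeasure M (A \<inter> B) = min (emeasure M A) (emeasure M B)"
  proof
    assume *: "A - {0} \<subseteq> B"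
    then have "emeasure M (A \<inter> B) = emeasure M A" by (intro eq) auto
    moreover have "emeasure M (A \<inter> B) \<le> emeasure M B" by (intro emeasure_mono) auto
    ultimately show ?thesis by (simp add: min_def)
  next
    assume *: "B - {0} \<subseteq> A"
    then have "emeasure M (A \<inter> B) = emeasure M B" by (intro eq) auto
    moreover have "emeasure M (A \<inter> B) \<le> emeasure M A" by (intro emeasure_mono) auto
    ultimately show ?thesis by (simp add: min_def)
  qed
  moreover have "A \<inter> B = {t \<in> half_open \<gamma>. ennreal t < D \<and> ennreal s < ennreal (w t)}"
    by (auto simp: A_def B_def)
  ultimately show ?thesis unfolding AD by (simp add: B_def)
qed

lemma weight_primitive_eq:
  assumes "t \<in> half_open \<gamma>"
  shows "weight_primitive w (ereal t) = (\<integral>\<^sup>+u. ennreal (w u) * indicator {0..<t} u \<partial>M)"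
proof -
  have "u \<in> half_open \<gamma>" if "u \<in> {0..<t}" for u
    using half_open_downward[OF assms, of u] that by auto
  then have "ennreal (w u) * indicator {0..<t} u * indicator (half_open \<gamma>) u = ennreal (w u) * indicator {0..<t} u" for u
    by (auto simp: indicator_def)
  then show ?thesis
    unfolding weight_primitive_def by (subst nn_integral_restrict_space) auto
qed

text \<open>Levels below \<open>w t1\<close> contribute at most \<open>D\<close> each. A point where
  \<open>w\<close> exceeds a higher level lies to the left of \<open>t1\<close>, so these levels
  together contribute at most the primitive of the weight at \<open>t1\<close>.\<close>

lemma level_integral_finite:
  assumes D: "D < \<infinity>"
  shows "(\<integral>\<^sup>+s. min D (dist_fun (\<lambda>t. ennreal (w t)) s) \<partial>lborel) < \<infinity>"
proof -
  obtain t1 where t1: "0 < t1" "t1 \<in> half_open \<gamma>"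
  proof (cases rule: gamma_cases)
    case 1
    then show thesis using that[of 1] by simp
  next
    case (2 r)
    then show thesis using that[of "r / 2"] by simp
  qed
  define F where "F t = ennreal (w t) * indicator {0..<t1} t" for t
  have F_meas [measurable]: "F \<in> borel_measurable M" unfolding F_def by measurable
  have "min D (dist_fun (\<lambda>t. ennreal (w t)) s) \<le> D * indicator {0..<w t1} s + dist_fun F s" for s
  proof -
    consider "s < 0" | "0 \<le> s" "s < w t1" | "0 \<le> s" "w t1 \<le> s" by linarith
    then show ?thesis
    proof cases
      case 3
      have "dist_fun (\<lambda>t. ennreal (w t)) s \<le> dist_fun F s"
        unfolding dist_fun_def if_P[OF 3(1)] space_M
      proof (rule emeasure_mono)
        show "{t \<in> half_open \<gamma>. ennreal s < ennreal (w t)} \<subseteq> {t \<in> half_open \<gamma>. ennreal s < F t}"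
        proof
          fix t assume t: "t \<in> {t \<in> half_open \<gamma>. ennreal s < ennreal (w t)}"
          then have "w t1 < w t" using 3 by (auto simp: ennreal_less_iff)
          then have "t < t1" using w_antimono[of t1 t] t t1 by force
          then show "t \<in> {t \<in> half_open \<gamma>. ennreal s < F t}"
            using t by (auto simp: F_def half_open_def)
        qed
        show "{t \<in> half_open \<gamma>. ennreal s < F t} \<in> sets M"
          by (intro sets_M_Collect) measurable
      qed
      then show ?thesis by (simp add: min.coboundedI2 add_increasing)
    qed (auto intro: min.coboundedI1)
  qed
  then have "(\<integral>\<^sup>+s. min D (dist_fun (\<lambda>t. ennreal (w t)) s) \<partial>lborel) \<le>
      (\<integral>\<^sup>+s. D * indicator {0..<w t1} s + dist_fun F s \<partial>lborel)"
    by (rule nn_integral_mono)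
  also have "\<dots> = D * ennreal (w t1) + (\<integral>\<^sup>+t. F t \<partial>M)"
    using w_pos[OF t1(2)] t1(1)
    by (subst nn_integral_add) (auto simp: nn_integral_cmult_indicator layer_cake)
  also have "(\<integral>\<^sup>+t. F t \<partial>M) = weight_primitive w (ereal t1)"
    unfolding F_def by (rule weight_primitive_eq[symmetric, OF t1(2)])
  finally show ?thesis
    using D w_primitive[OF t1(2)] by (auto simp: ennreal_mult_less_top intro: order.strict_trans1)
qed

text \<open>If a level set had infinite measure, the integral would be the whole mass of the weight.
  On the half-line that mass is infinite; a bounded interval contains no set of infinite
  measure.\<close>

lemma dist_fun_finite:
  assumes G: "(\<integral>\<^sup>+s. min (dist_fun G l) (dist_fun (\<lambda>t. ennreal (w t)) s) \<partial>lborel) < \<infinity>"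
  shows "dist_fun G l < \<infinity>"
proof (cases rule: gamma_cases)
  case 1
  show ?thesis
  proof (rule ccontr)
    assume "\<not> dist_fun G l < \<infinity>"
    then have "dist_fun G l = \<infinity>" by (simp add: less_top[symmetric])
    then have "(\<integral>\<^sup>+s. min (dist_fun G l) (dist_fun (\<lambda>t. ennreal (w t)) s) \<partial>lborel) = (\<integral>\<^sup>+t. ennreal (w t) \<partial>M)"
      by (simp add: layer_cake)
    also have "\<dots> = weight_primitive w \<infinity>"
      unfolding weight_primitive_def using 1 by (subst nn_integral_restrict_space) auto
    finally show False using G weight_infinite[OF 1] by simp
  qed
next
  case (2 r)
  have "dist_fun G l \<le> emeasure M (half_open \<gamma>)" using dist_fun_le_space by simp
  also have "\<dots> < \<infinity>" using 2 by (subst emeasure_M) auto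
  finally show ?thesis .
qed

lemma H_bounded_finite:
  assumes "0 \<le> c"
  shows "H (\<lambda>t. ennreal c * indicator {0..<real n} t) < \<infinity>"
proof -
  define W where "W = (\<integral>\<^sup>+s. min (ennreal (real n)) (dist_fun (\<lambda>t. ennreal (w t)) s) \<partial>lborel)"
  have "dist_fun (indicator {0..<real n}) l \<le> ennreal (real n)" if "0 \<le> l" for l
  proof -
    have "dist_fun (indicator {0..<real n}) l \<le> emeasure M (half_open \<gamma> \<inter> {0..<real n})"
      using that unfolding dist_fun_def
      by (auto intro!: emeasure_mono sets_M_borel simp: indicator_def split: if_splits)
    also have "\<dots> \<le> emeasure lborel {0..<real n}"
      using emeasure_mono[of "half_open \<gamma> \<inter> {0..<real n}" "{0..<real n}" lborel] by (simp add: emeasure_M)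
    finally show ?thesis by simp
  qed
  moreover have "dist_fun (indicator {0..<real n}) l = 0" if "1 \<le> l" for l
  proof -
    have *: "{t \<in> half_open \<gamma>. ennreal l < indicator {0..<real n} t} = {}"
      using that by (auto simp: indicator_def ennreal_less_one_iff not_less split: if_splits)
    show ?thesis unfolding dist_fun_def space_M * by simp
  qed
  ultimately have bound: "(\<integral>\<^sup>+s. min (dist_fun (indicator {0..<real n}) l) (dist_fun (\<lambda>t. ennreal (w t)) s) \<partial>lborel)
      \<le> W * indicator {0..<1} l" for l
    unfolding W_def by (cases "l < 0"; cases "l < 1") (auto intro!: nn_integral_mono min.mono)
  have "H (indicator {0..<real n}) \<le> (\<integral>\<^sup>+l. W * indicator {0..<1::real} l \<partial>lborel)"
    unfolding H_def by (intro nn_integral_mono bound)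
  also have "\<dots> = W" by (simp add: nn_integral_cmult_indicator)
  also have "\<dots> < \<infinity>" unfolding W_def by (intro level_integral_finite) simp
  finally show ?thesis
    using assms by (subst H_cmult) (auto simp: ennreal_mult_less_top)
qed

end

section \<open>Orlicz functions and the modular\<close>

locale orlicz =
  fixes \<phi> :: "real \<Rightarrow> real"
  assumes orlicz: "orlicz_function \<phi>"
begin

lemma phi_0 [simp]: "\<phi> 0 = 0"
  and phi_pos: "0 < u \<Longrightarrow> 0 < \<phi> u"
  and phi_convex: "convex_on {0..} \<phi>"
  using orlicz unfolding orlicz_function_def by auto

lemma phi_nonneg [simp]: "0 \<le> u \<Longrightarrow> 0 \<le> \<phi> u"
  using phi_pos[of u] by (cases "u = 0") auto

lemma phi_scale: "0 \<le> c \<Longrightarrow> c \<le> 1 \<Longrightarrow> 0 \<le> u \<Longrightarrow> \<phi> (c * u) \<le> c * \<phi> u"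
  using convex_onD[OF phi_convex, of c 0 u] by simp

lemma phi_strict_mono: "0 \<le> u \<Longrightarrow> u < v \<Longrightarrow> \<phi> u < \<phi> v"
proof -
  assume uv: "0 \<le> u" "u < v"
  then have "\<phi> u \<le> u / v * \<phi> v" using phi_scale[of "u / v" v] by simp
  also have "\<dots> < \<phi> v" using uv phi_pos[of v] by (simp add: field_simps)
  finally show ?thesis .
qed

lemma phi_mono: "0 \<le> u \<Longrightarrow> u \<le> v \<Longrightarrow> \<phi> u \<le> \<phi> v"
  using phi_strict_mono[of u v] by (cases "u = v") auto

lemma phi_less_iff: "0 \<le> u \<Longrightarrow> 0 \<le> v \<Longrightarrow> \<phi> u < \<phi> v \<longleftrightarrow> u < v"
  using phi_strict_mono[of u v] phi_mono[of v u] by (meson not_le)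

text \<open>Convexity gives continuity in the open half-line. At the origin \<open>\<phi>\<close> is
  squeezed between 0 and the chord \<open>u * \<phi> 1\<close>.\<close>

lemma phi_continuous: "continuous_on {0..} \<phi>"
  unfolding continuous_on_eq_continuous_within
proof
  fix x :: real assume "x \<in> {0..}"
  then consider "x = 0" | "x > 0" by fastforce
  then show "continuous (at x within {0..}) \<phi>"
  proof cases
    case 1
    have "(\<phi> \<longlongrightarrow> 0) (at 0 within {0..})"
    proof (rule tendsto_sandwich)
      have near: "\<forall>\<^sub>F u in at 0 within {0..}. 0 \<le> u \<and> u \<le> (1::real)"
        unfolding eventually_at by (intro exI[of _ 1]) (auto simp: dist_real_def)
      show "\<forall>\<^sub>F u in at 0 within {0..}. 0 \<le> \<phi> u"
        using near by eventually_elim simp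
      show "\<forall>\<^sub>F u in at 0 within {0..}. \<phi> u \<le> u * \<phi> 1"
        using near by eventually_elim (use phi_scale[of _ 1] in simp)
      have "((\<lambda>u. u * \<phi> 1) \<longlongrightarrow> 0 * \<phi> 1) (at 0 within {0..})"
        by (intro tendsto_intros)
      then show "((\<lambda>u. u * \<phi> 1) \<longlongrightarrow> 0) (at 0 within {0..})" by simp
    qed simp
    then show ?thesis by (simp add: continuous_within 1)
  next
    case 2
    have "continuous_on {0<..} \<phi>"
      by (intro convex_on_continuous convex_on_subset[OF phi_convex]) auto
    then have "isCont \<phi> x"
      using 2 by (auto simp: continuous_on_eq_continuous_at)
    then show ?thesis by (rule continuous_at_imp_continuous_at_within)
  qed
qed

lemma phi_surj: assumes "0 \<le> l" shows "\<exists>\<mu>\<ge>0. \<phi> \<mu> = l"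
proof -
  \<comment> \<open>Convexity gives \<open>\<phi> b \<ge> b * \<phi> 1\<close> for
    \<open>b \<ge> 1\<close>, so this \<open>b\<close> reaches the level \<open>l\<close> and the
    intermediate value theorem applies.\<close>
  define b where "b = max 1 (l / \<phi> 1)"
  have b: "1 \<le> b" "l / \<phi> 1 \<le> b" by (auto simp: b_def)
  have "\<phi> 1 \<le> 1 / b * \<phi> b" using phi_scale[of "1 / b" b] b by simp
  then have "b * \<phi> 1 \<le> \<phi> b" using b by (simp add: field_simps)
  moreover have "l \<le> b * \<phi> 1" using b(2) phi_pos[of 1] by (simp add: field_simps)
  moreover have "continuous_on {0..b} \<phi>" using phi_continuous by (rule continuous_on_subset) auto
  ultimately obtain \<mu> where "0 \<le> \<mu>" "\<mu> \<le> b" "\<phi> \<mu> = l"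
    using IVT'[of \<phi> 0 l b] assms b by auto
  then show ?thesis by blast
qed

lemma phi_abs_measurable [measurable]:
  assumes [measurable]: "f \<in> borel_measurable N"
  shows "(\<lambda>t. \<phi> \<bar>f t\<bar>) \<in> borel_measurable N"
proof -
  have "(\<lambda>u. \<phi> \<bar>u\<bar>) \<in> borel_measurable borel"
    by (intro borel_measurable_continuous_onI continuous_on_compose2[OF phi_continuous] continuous_intros) auto
  then show ?thesis by (rule measurable_compose[rotated]) measurable
qed

lemma phi_tendsto: "f \<longlonglongrightarrow> x \<Longrightarrow> (\<lambda>n. \<phi> \<bar>f n\<bar>) \<longlonglongrightarrow> \<phi> \<bar>x\<bar>"
  by (intro continuous_on_tendsto_compose[OF phi_continuous]) (auto intro!: tendsto_intros)

end

section \<open>The modular as a functional of level sets\<close>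

locale orlicz_lorentz_modular = lorentz_weight \<gamma> w + orlicz \<phi>
  for \<gamma> :: ereal and w \<phi> :: "real \<Rightarrow> real"
begin

abbreviation \<rho> :: "(real \<Rightarrow> real) \<Rightarrow> ennreal" where
  "\<rho> \<equiv> modular \<gamma> \<phi> w"

lemma distribution_eq:
  assumes [measurable]: "f \<in> borel_measurable M"
  shows "distribution \<gamma> f l = emeasure M {t \<in> half_open \<gamma>. l < \<bar>f t\<bar>}"
proof -
  have "{t \<in> half_open \<gamma>. l < \<bar>f t\<bar>} \<in> sets M"
    by (intro sets_M_Collect) measurable
  then show ?thesis
    unfolding distribution_def by (subst emeasure_restrict_space) auto
qed

text \<open>Right continuity of the distribution function makes the infimum in \<open>rearrangement\<close> attained.\<close>

lemma less_rearrangement_iff: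
  assumes f [measurable]: "f \<in> borel_measurable M" and "0 \<le> \<mu>"
  shows "ennreal \<mu> < rearrangement \<gamma> f t \<longleftrightarrow> ennreal t < distribution \<gamma> f \<mu>"
proof
  assume "ennreal \<mu> < rearrangement \<gamma> f t"
  then show "ennreal t < distribution \<gamma> f \<mu>"
    unfolding rearrangement_def using \<open>0 \<le> \<mu>\<close>
    by (auto simp: not_le[symmetric] intro: INF_lower)
next
  assume less: "ennreal t < distribution \<gamma> f \<mu>"
  define A where "A n = {t \<in> half_open \<gamma>. \<mu> + 1 / real (Suc n) < \<bar>f t\<bar>}" for n
  have A_sets: "A n \<in> sets M" for n unfolding A_def by (intro sets_M_Collect) measurable
  have "incseq A"
  proof (rule incseq_SucI)
    fix n
    have "1 / real (Suc (Suc n)) \<le> 1 / real (Suc n)" by (intro divide_left_mono) auto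
    then show "A n \<subseteq> A (Suc n)" unfolding A_def by fastforce
  qed
  moreover have "(\<Union>n. A n) = {t \<in> half_open \<gamma>. \<mu> < \<bar>f t\<bar>}"
  proof (intro equalityI subsetI)
    fix u assume u: "u \<in> {t \<in> half_open \<gamma>. \<mu> < \<bar>f t\<bar>}"
    then obtain n where "1 / real (Suc n) < \<bar>f u\<bar> - \<mu>"
      using nat_approx_posE[of "\<bar>f u\<bar> - \<mu>"] by auto
    then show "u \<in> (\<Union>n. A n)" using u unfolding A_def by (auto intro!: exI[of _ n])
  next
    fix u assume "u \<in> (\<Union>n. A n)"
    then obtain n where "u \<in> half_open \<gamma>" "\<mu> + 1 / real (Suc n) < \<bar>f u\<bar>" unfolding A_def by auto
    moreover have "\<mu> < \<mu> + 1 / real (Suc n)" by simp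
    ultimately show "u \<in> {t \<in> half_open \<gamma>. \<mu> < \<bar>f t\<bar>}"
      using less_trans by blast
  qed
  ultimately have "(SUP n. emeasure M (A n)) = distribution \<gamma> f \<mu>"
    using A_sets by (subst SUP_emeasure_incseq) (auto simp: distribution_eq[OF f])
  then obtain n where n: "ennreal t < emeasure M (A n)"
    using less by (metis less_SUP_iff)
  have "\<mu> + 1 / real (Suc n) \<le> l" if l: "0 \<le> l" "distribution \<gamma> f l \<le> ennreal t" for l
  proof (rule ccontr)
    assume "\<not> ?thesis"
    then have "emeasure M (A n) \<le> distribution \<gamma> f l"
      unfolding distribution_eq[OF f]
      by (intro emeasure_mono sets_M_Collect) (auto simp: A_def)
    then show False using l n by auto
  qed
  then have "ennreal (\<mu> + 1 / real (Suc n)) \<le> rearrangement \<gamma> f t"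
    unfolding rearrangement_def by (intro INF_greatest ennreal_leI) auto
  moreover have "ennreal \<mu> < ennreal (\<mu> + 1 / real (Suc n))"
    using \<open>0 \<le> \<mu>\<close> by (simp add: ennreal_less_iff del: ennreal_plus)
  ultimately show "ennreal \<mu> < rearrangement \<gamma> f t" by (rule order.strict_trans2[rotated])
qed

lemma less_orlicz_ext_iff: "0 \<le> \<mu> \<Longrightarrow> ennreal (\<phi> \<mu>) < orlicz_ext \<phi> u \<longleftrightarrow> ennreal \<mu> < u"
  by (cases u) (auto simp: orlicz_ext_def ennreal_less_iff phi_less_iff)

text \<open>Every level \<open>l\<close> is of the form \<open>\<phi> \<mu>\<close>, and
  \<open>\<phi>\<close> is strictly increasing. Hence applying \<open>\<phi>\<close> commutes with
  decreasing rearrangement.\<close>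

lemma level_iff:
  assumes f [measurable]: "f \<in> borel_measurable M" and "0 \<le> l"
  shows "ennreal l < orlicz_ext \<phi> (rearrangement \<gamma> f t) \<longleftrightarrow>
    ennreal t < dist_fun (\<lambda>t. ennreal (\<phi> \<bar>f t\<bar>)) l"
proof -
  obtain \<mu> where \<mu>: "0 \<le> \<mu>" "\<phi> \<mu> = l" using phi_surj[OF \<open>0 \<le> l\<close>] by blast
  have "{t \<in> space M. ennreal l < ennreal (\<phi> \<bar>f t\<bar>)} = {t \<in> half_open \<gamma>. \<mu> < \<bar>f t\<bar>}"
    using \<mu> \<open>0 \<le> l\<close> by (auto simp: ennreal_less_iff phi_less_iff)
  then have "dist_fun (\<lambda>t. ennreal (\<phi> \<bar>f t\<bar>)) l = distribution \<gamma> f \<mu>"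
    unfolding dist_fun_def distribution_eq[OF f] using \<open>0 \<le> l\<close> by simp
  then show ?thesis
    using less_orlicz_ext_iff[OF \<mu>(1)] less_rearrangement_iff[OF f \<mu>(1)] \<mu>(2) by simp
qed

lemma orlicz_rearrangement_measurable:
  assumes f [measurable]: "f \<in> borel_measurable M"
  shows "(\<lambda>t. orlicz_ext \<phi> (rearrangement \<gamma> f t)) \<in> borel_measurable M"
proof (rule borel_measurableI_greater)
  fix c
  have "{t \<in> half_open \<gamma>. c < orlicz_ext \<phi> (rearrangement \<gamma> f t)} \<in> sets M"
  proof (cases c)
    case (real l)
    have "{t \<in> half_open \<gamma>. ennreal t < dist_fun (\<lambda>t. ennreal (\<phi> \<bar>f t\<bar>)) l} \<in> sets M"
      by (intro sets_M_Collect) measurable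
    then show ?thesis using real level_iff[OF f] by simp
  qed simp
  then show "{t \<in> space M. c < orlicz_ext \<phi> (rearrangement \<gamma> f t)} \<in> sets M" by simp
qed

text \<open>By \<open>level_iff\<close> the level sets of the composed rearrangement are initial
  segments, and up to the origin so are those of \<open>w\<close>; the intersections in the product
  formula therefore have the smaller measure. The rearrangement disappears here, and the modular is
  handled through \<open>H\<close>.\<close>

lemma modular_eq_H:
  assumes f [measurable]: "f \<in> borel_measurable M"
  shows "\<rho> f = H (\<lambda>t. ennreal (\<phi> \<bar>f t\<bar>))"
proof -
  let ?G = "\<lambda>t. orlicz_ext \<phi> (rearrangement \<gamma> f t)"
  let ?F = "\<lambda>t. ennreal (\<phi> \<bar>f t\<bar>)"
  have "\<rho> f = (\<integral>\<^sup>+t. ?G t * ennreal (w t) \<partial>M)"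
    unfolding modular_def by (subst nn_integral_restrict_space) auto
  also have "\<dots> = (\<integral>\<^sup>+l. \<integral>\<^sup>+s. emeasure M {t \<in> space M. 0 \<le> l \<and> ennreal l < ?G t \<and> 0 \<le> s \<and> ennreal s < ennreal (w t)}
      \<partial>lborel \<partial>lborel)"
    by (intro layer_cake_product orlicz_rearrangement_measurable f) measurable
  also have "\<dots> = H ?F"
    unfolding H_def
  proof (intro nn_integral_cong)
    fix l s :: real
    show "emeasure M {t \<in> space M. 0 \<le> l \<and> ennreal l < ?G t \<and> 0 \<le> s \<and> ennreal s < ennreal (w t)} =
        min (dist_fun ?F l) (dist_fun (\<lambda>t. ennreal (w t)) s)"
    proof (cases "0 \<le> l \<and> 0 \<le> s")
      case True
      have "{t \<in> space M. 0 \<le> l \<and> ennreal l < ?G t \<and> 0 \<le> s \<and> ennreal s < ennreal (w t)} =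
          {t \<in> half_open \<gamma>. ennreal t < dist_fun ?F l \<and> ennreal s < ennreal (w t)}"
        using True level_iff[OF f] by auto
      moreover have "dist_fun ?F l \<le> emeasure M (half_open \<gamma>)"
        using dist_fun_le_space by simp
      ultimately show ?thesis
        using True by (simp add: emeasure_nested_segments dist_fun_def[of _ s])
    qed auto
  qed
  finally show ?thesis .
qed

lemma rho_mono:
  assumes [measurable]: "f \<in> borel_measurable M" "g \<in> borel_measurable M"
    and "AE t in M. \<bar>f t\<bar> \<le> \<bar>g t\<bar>"
  shows "\<rho> f \<le> \<rho> g"
  using assms(3) unfolding modular_eq_H[OF assms(1)] modular_eq_H[OF assms(2)]
  by (intro H_mono) (auto elim!: eventually_mono intro!: ennreal_leI phi_mono)

lemma rho_cong_AE:
  assumes "f \<in> borel_measurable M" "g \<in> borel_measurable M" "AE t in M. f t = g t"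
  shows "\<rho> f = \<rho> g"
  using assms by (intro antisym rho_mono) (auto elim!: eventually_mono)

lemma rho_0 [simp]: "\<rho> (\<lambda>_. 0) = 0"
  by (simp add: modular_eq_H)

lemma rho_convex:
  assumes [measurable]: "f \<in> borel_measurable M" "g \<in> borel_measurable M" and \<theta>: "0 \<le> \<theta>" "\<theta> \<le> 1"
  shows "\<rho> (\<lambda>t. (1 - \<theta>) * f t + \<theta> * g t) \<le> ennreal (1 - \<theta>) * \<rho> f + ennreal \<theta> * \<rho> g"
proof -
  have pt: "\<phi> \<bar>(1 - \<theta>) * x + \<theta> * y\<bar> \<le> (1 - \<theta>) * \<phi> \<bar>x\<bar> + \<theta> * \<phi> \<bar>y\<bar>" for x y
  proof -
    have "\<bar>(1 - \<theta>) * x + \<theta> * y\<bar> \<le> (1 - \<theta>) * \<bar>x\<bar> + \<theta> * \<bar>y\<bar>"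
      using \<theta> abs_triangle_ineq[of "(1 - \<theta>) * x" "\<theta> * y"] by (simp add: abs_mult)
    then have "\<phi> \<bar>(1 - \<theta>) * x + \<theta> * y\<bar> \<le> \<phi> ((1 - \<theta>) * \<bar>x\<bar> + \<theta> * \<bar>y\<bar>)"
      by (intro phi_mono) auto
    also have "\<dots> \<le> (1 - \<theta>) * \<phi> \<bar>x\<bar> + \<theta> * \<phi> \<bar>y\<bar>"
      using convex_onD[OF phi_convex, of \<theta> "\<bar>x\<bar>" "\<bar>y\<bar>"] \<theta> by simp
    finally show ?thesis .
  qed
  have "\<rho> (\<lambda>t. (1 - \<theta>) * f t + \<theta> * g t) \<le>
      H (\<lambda>t. ennreal (1 - \<theta>) * ennreal (\<phi> \<bar>f t\<bar>) + ennreal \<theta> * ennreal (\<phi> \<bar>g t\<bar>))"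
    using \<theta> pt by (subst modular_eq_H)
      (auto intro!: H_mono AE_I2 ennreal_leI simp: ennreal_mult[symmetric] ennreal_plus[symmetric] simp del: ennreal_plus)
  also have "\<dots> \<le> H (\<lambda>t. ennreal (1 - \<theta>) * ennreal (\<phi> \<bar>f t\<bar>)) + H (\<lambda>t. ennreal \<theta> * ennreal (\<phi> \<bar>g t\<bar>))"
    by (rule H_add) measurable
  also have "\<dots> = ennreal (1 - \<theta>) * \<rho> f + ennreal \<theta> * \<rho> g"
    using \<theta> by (simp add: H_cmult modular_eq_H)
  finally show ?thesis .
qed

text \<open>The Fatou property. It makes the infimum in the norm attained and keeps almost
  everywhere limits inside the unit ball.\<close>

lemma rho_liminf:
  assumes f [measurable]: "\<And>n. f n \<in> borel_measurable M" and [measurable]: "g \<in> borel_measurable M"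
    and lim: "AE t in M. (\<lambda>n. f n t) \<longlonglongrightarrow> g t"
  shows "\<rho> g \<le> liminf (\<lambda>n. \<rho> (f n))"
  unfolding modular_eq_H[OF f] modular_eq_H[OF \<open>g \<in> _\<close>]
proof (rule H_liminf)
  show "AE t in M. ennreal (\<phi> \<bar>g t\<bar>) \<le> liminf (\<lambda>n. ennreal (\<phi> \<bar>f n t\<bar>))"
    using lim
  proof eventually_elim
    fix t assume "(\<lambda>n. f n t) \<longlonglongrightarrow> g t"
    then have "(\<lambda>n. ennreal (\<phi> \<bar>f n t\<bar>)) \<longlonglongrightarrow> ennreal (\<phi> \<bar>g t\<bar>)"
      by (intro tendsto_ennrealI phi_tendsto)
    from lim_imp_Liminf[OF trivial_limit_sequentially this]
    show "ennreal (\<phi> \<bar>g t\<bar>) \<le> liminf (\<lambda>n. ennreal (\<phi> \<bar>f n t\<bar>))" by simp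
  qed
qed measurable

lemma rho_L1:
  assumes [measurable]: "f \<in> borel_measurable M"
  shows "(\<integral>\<^sup>+t. ennreal (\<phi> \<bar>f t\<bar>) * ennreal (w t) \<partial>M) \<le> \<rho> f"
  by (subst modular_eq_H) (auto intro!: nn_integral_le_H)

lemma rho_bounded_finite: "\<rho> (\<lambda>t. c * indicator {0..<real n} t) < \<infinity>"
proof -
  have "\<rho> (\<lambda>t. c * indicator {0..<real n} t) = H (\<lambda>t. ennreal (\<phi> \<bar>c\<bar>) * indicator {0..<real n} t)"
    by (subst modular_eq_H) (auto intro!: arg_cong[of _ _ H] simp: indicator_def fun_eq_iff)
  also have "\<dots> < \<infinity>" by (rule H_bounded_finite) simp
  finally show ?thesis .
qed

lemma rho_tendsto_0:
  assumes f [measurable]: "\<And>n. f n \<in> borel_measurable M" and g [measurable]: "g \<in> borel_measurable M"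
    and le: "\<And>n. AE t in M. \<bar>f n t\<bar> \<le> \<bar>g t\<bar>" and lim: "AE t in M. (\<lambda>n. f n t) \<longlonglongrightarrow> 0"
    and fin: "\<rho> g < \<infinity>"
  shows "(\<lambda>n. \<rho> (f n)) \<longlonglongrightarrow> 0"
  unfolding modular_eq_H[OF f]
proof (rule H_tendsto_0[where G = "\<lambda>t. ennreal (\<phi> \<bar>g t\<bar>)"])
  show "AE t in M. ennreal (\<phi> \<bar>f n t\<bar>) \<le> ennreal (\<phi> \<bar>g t\<bar>)" for n
    using le[of n] by eventually_elim (auto intro!: ennreal_leI phi_mono)
  show "AE t in M. (\<lambda>n. ennreal (\<phi> \<bar>f n t\<bar>)) \<longlonglongrightarrow> 0"
    using lim
  proof eventually_elim
    fix t assume "(\<lambda>n. f n t) \<longlonglongrightarrow> 0"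
    then have "(\<lambda>n. ennreal (\<phi> \<bar>f n t\<bar>)) \<longlonglongrightarrow> ennreal (\<phi> \<bar>0\<bar>)"
      by (intro tendsto_ennrealI phi_tendsto)
    then show "(\<lambda>n. ennreal (\<phi> \<bar>f n t\<bar>)) \<longlonglongrightarrow> 0" by simp
  qed
  show "H (\<lambda>t. ennreal (\<phi> \<bar>g t\<bar>)) < \<infinity>"
    using fin unfolding modular_eq_H[OF g] .
  show "dist_fun (\<lambda>t. ennreal (\<phi> \<bar>g t\<bar>)) l < \<infinity>"
    if "(\<integral>\<^sup>+s. min (dist_fun (\<lambda>t. ennreal (\<phi> \<bar>g t\<bar>)) l) (dist_fun (\<lambda>t. ennreal (w t)) s) \<partial>lborel) < \<infinity>" for l
    using that by (rule dist_fun_finite)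
qed measurable

lemma rho_double_finite:
  assumes f [measurable]: "f \<in> borel_measurable M" and fin: "\<rho> f < \<infinity>"
    and D2: "\<gamma> = \<infinity> \<Longrightarrow> Delta2 \<phi>" and D2i: "\<gamma> < \<infinity> \<Longrightarrow> Delta2_infty \<phi>"
  shows "\<rho> (\<lambda>t. 2 * f t) < \<infinity>"
proof -
  \<comment> \<open>One inequality for both cases. On the half-line the error term is zero. On a
    bounded interval small \<open>u\<close> are covered by the constant
    \<open>\<phi> (2 * u0)\<close>, and the indicator of \<open>[0, n)\<close> is 1 on the whole
    interval.\<close>
  obtain K c n where K: "0 \<le> K" and c: "0 \<le> c"
    and le: "\<And>t u. t \<in> half_open \<gamma> \<Longrightarrow> 0 \<le> u \<Longrightarrow> \<phi> (2 * u) \<le> K * \<phi> u + c * indicator {0..<real n} t"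
  proof (cases rule: gamma_cases)
    case 1
    then obtain K where "K > 0" "\<And>u. 0 \<le> u \<Longrightarrow> \<phi> (2 * u) \<le> K * \<phi> u"
      using D2 unfolding Delta2_def by blast
    then show thesis using that[of K 0 0] by simp
  next
    case (2 r)
    then obtain K u0 where K: "K > 0" "u0 \<ge> 0" "\<And>u. u0 \<le> u \<Longrightarrow> \<phi> (2 * u) \<le> K * \<phi> u"
      using D2i unfolding Delta2_infty_def by auto
    obtain n where n: "r \<le> real n" using real_arch_simple by blast
    show thesis
    proof (rule that[of K "\<phi> (2 * u0)" n])
      fix t u :: real assume t: "t \<in> half_open \<gamma>" and u: "0 \<le> u"
      then have ind: "indicator {0..<real n} t = (1 :: real)" using n 2 by auto
      show "\<phi> (2 * u) \<le> K * \<phi> u + \<phi> (2 * u0) * indicator {0..<real n} t"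
      proof (cases "u0 \<le> u")
        case True
        then show ?thesis using K(3)[OF True] K(2) ind by (simp add: add_increasing2)
      next
        case False
        then have "\<phi> (2 * u) \<le> \<phi> (2 * u0)" using u by (intro phi_mono) auto
        then show ?thesis using K(1) u ind by (simp add: add_increasing)
      qed
    qed (use K in auto)
  qed
  have "\<rho> (\<lambda>t. 2 * f t) \<le> H (\<lambda>t. ennreal K * ennreal (\<phi> \<bar>f t\<bar>) + ennreal c * indicator {0..<real n} t)"
  proof (subst modular_eq_H)
    show "H (\<lambda>t. ennreal (\<phi> \<bar>2 * f t\<bar>)) \<le> H (\<lambda>t. ennreal K * ennreal (\<phi> \<bar>f t\<bar>) + ennreal c * indicator {0..<real n} t)"
    proof (rule H_mono)
      show "AE t in M. ennreal (\<phi> \<bar>2 * f t\<bar>) \<le> ennreal K * ennreal (\<phi> \<bar>f t\<bar>) + ennreal c * indicator {0..<real n} t"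
      proof (rule AE_I2)
        fix t assume "t \<in> space M"
        then have "\<phi> \<bar>2 * f t\<bar> \<le> K * \<phi> \<bar>f t\<bar> + c * indicator {0..<real n} t"
          using le[of t "\<bar>f t\<bar>"] by (simp add: abs_mult)
        then have "ennreal (\<phi> \<bar>2 * f t\<bar>) \<le> ennreal (K * \<phi> \<bar>f t\<bar> + c * indicator {0..<real n} t)"
          by (rule ennreal_leI)
        also have "\<dots> = ennreal K * ennreal (\<phi> \<bar>f t\<bar>) + ennreal c * indicator {0..<real n} t"
          using K c by (auto simp: ennreal_mult indicator_def)
        finally show "ennreal (\<phi> \<bar>2 * f t\<bar>) \<le> ennreal K * ennreal (\<phi> \<bar>f t\<bar>) + ennreal c * indicator {0..<real n} t" .
      qed
    qed measurable
  qed measurable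
  also have "\<dots> \<le> H (\<lambda>t. ennreal K * ennreal (\<phi> \<bar>f t\<bar>)) + H (\<lambda>t. ennreal c * indicator {0..<real n} t)"
    by (rule H_add) measurable
  also have "\<dots> = ennreal K * \<rho> f + H (\<lambda>t. ennreal c * indicator {0..<real n} t)"
    using K by (simp add: H_cmult modular_eq_H)
  also have "\<dots> < \<infinity>"
    using fin H_bounded_finite[OF c] by (auto simp: ennreal_mult_less_top)
  finally show ?thesis .
qed

lemma rho_scale_finite:
  assumes f [measurable]: "f \<in> borel_measurable M" and fin: "\<rho> f < \<infinity>"
    and D2: "\<gamma> = \<infinity> \<Longrightarrow> Delta2 \<phi>" and D2i: "\<gamma> < \<infinity> \<Longrightarrow> Delta2_infty \<phi>"
  shows "\<rho> (\<lambda>t. l * f t) < \<infinity>"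
proof -
  have pow: "\<rho> (\<lambda>t. 2 ^ k * f t) < \<infinity>" for k :: nat
  proof (induction k)
    case (Suc k)
    have "\<rho> (\<lambda>t. 2 * (2 ^ k * f t)) < \<infinity>"
      using Suc by (intro rho_double_finite D2 D2i) measurable
    then show ?case by (simp add: mult.assoc)
  qed (use fin in simp)
  obtain k where k: "\<bar>l\<bar> < 2 ^ k" using real_arch_pow[of 2 "\<bar>l\<bar>"] by auto
  have "\<bar>l * f t\<bar> \<le> \<bar>2 ^ k * f t\<bar>" for t
    using k by (simp add: abs_mult mult_right_mono)
  then have "\<rho> (\<lambda>t. l * f t) \<le> \<rho> (\<lambda>t. 2 ^ k * f t)"
    by (intro rho_mono) auto
  then show ?thesis using pow by (rule order.strict_trans1)
qed

end

section \<open>Almost everywhere convergent convex combinations\<close>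

text \<open>Closing a tail under midpoints gives its convex combinations with dyadic coefficients.
  The convexity argument uses midpoints only, and facts about the hull follow by induction without
  coefficients.\<close>

inductive_set tail_hull :: "(nat \<Rightarrow> 'a \<Rightarrow> real) \<Rightarrow> nat \<Rightarrow> ('a \<Rightarrow> real) set" for f n where
  base: "n \<le> k \<Longrightarrow> f k \<in> tail_hull f n"
| midpoint: "u \<in> tail_hull f n \<Longrightarrow> v \<in> tail_hull f n \<Longrightarrow> (\<lambda>t. (u t + v t) / 2) \<in> tail_hull f n"

lemma tail_hull_antimono:
  assumes "m \<le> n"
  shows "tail_hull f n \<subseteq> tail_hull f m"
proof
  fix u assume "u \<in> tail_hull f n"
  then show "u \<in> tail_hull f m"
    by induction (use assms in \<open>auto intro: tail_hull.intros\<close>)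
qed

text \<open>The second coordinate of the unit vector in the direction \<open>(1, u)\<close>, that
  is, the sine of the angle with tangent \<open>u\<close>. It maps the line injectively into
  \<open>(-1, 1)\<close>, and a value near 1 or -1 means that \<open>u\<close> is large.\<close>

definition chi :: "real \<Rightarrow> real" where
  "chi u = u / sqrt (1 + u\<^sup>2)"

text \<open>For the plane vectors \<open>a = (1, u)\<close> and \<open>b = (1, v)\<close> the right-hand side is \<open>4 (|a| + |b| - |a + b|)\<close>, and
  the left-hand side is at most \<open>|a / |a| - b / |b||\<^sup>2\<close>.\<close>

lemma chi_diff_le:
  "(chi u - chi v)\<^sup>2 \<le> 8 * ((sqrt (1 + u\<^sup>2) + sqrt (1 + v\<^sup>2)) / 2 - sqrt (1 + ((u + v) / 2)\<^sup>2))"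
proof -
  define A where "A = sqrt (1 + u\<^sup>2)"
  define B where "B = sqrt (1 + v\<^sup>2)"
  define P where "P = 2 * sqrt (1 + ((u + v) / 2)\<^sup>2)"
  have A: "1 \<le> A" "A\<^sup>2 = 1 + u\<^sup>2" and B: "1 \<le> B" "B\<^sup>2 = 1 + v\<^sup>2"
    by (auto simp: A_def B_def)
  have P: "0 \<le> P" "P\<^sup>2 = 4 + (u + v)\<^sup>2"
  proof -
    show "0 \<le> P" by (simp add: P_def)
    have "P\<^sup>2 = 4 * (1 + ((u + v) / 2)\<^sup>2)" unfolding P_def power_mult_distrib by simp
    then show "P\<^sup>2 = 4 + (u + v)\<^sup>2" by (simp add: power_divide)
  qed
  have AB: "0 < A * B" using A B by simp
  have "(1 + u * v)\<^sup>2 + (u - v)\<^sup>2 = (A * B)\<^sup>2"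
    unfolding power_mult_distrib A B by (simp add: power2_eq_square algebra_simps)
  then have "(1 + u * v)\<^sup>2 \<le> (A * B)\<^sup>2" using zero_le_power2[of "u - v"] by linarith
  then have cs: "1 + u * v \<le> A * B" using AB by (rule power2_le_imp_le[OF _ less_imp_le])
  \<comment> \<open>For the plane vectors \<open>(1, u)\<close> and \<open>(1, v)\<close> this is
    the product of the lengths minus the inner product, nonnegative by Cauchy-Schwarz.\<close>
  define D where "D = A * B - 1 - u * v"
  have D: "0 \<le> D" using cs by (simp add: D_def)
  have prod: "(A + B - P) * (A + B + P) = 2 * D"
  proof -
    have "(A + B - P) * (A + B + P) = A\<^sup>2 + B\<^sup>2 + 2 * (A * B) - P\<^sup>2"
      by (simp add: power2_eq_square algebra_simps)
    also have "\<dots> = 2 * D"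
      unfolding A B P D_def by (simp add: power2_eq_square algebra_simps)
    finally show ?thesis .
  qed
  have "P\<^sup>2 \<le> (A + B)\<^sup>2"
  proof -
    have "(A + B)\<^sup>2 - P\<^sup>2 = 2 * D" using prod by (simp add: power2_eq_square algebra_simps)
    then show ?thesis using D by simp
  qed
  then have PAB: "P \<le> A + B"
    by (rule power2_le_imp_le) (use A B in linarith)
  have "2 * D \<le> (A + B - P) * (2 * (A + B))"
    unfolding prod[symmetric] using PAB by (intro mult_left_mono) auto
  also have "\<dots> \<le> (A + B - P) * (4 * (A * B))"
  proof (intro mult_left_mono)
    have "A * 1 \<le> A * B" "1 * B \<le> A * B" using A B by (intro mult_left_mono mult_right_mono; simp)+
    then show "2 * (A + B) \<le> 4 * (A * B)" by simp
  qed (use PAB in simp)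
  finally have main: "2 * D / (A * B) \<le> 4 * (A + B - P)"
    unfolding pos_divide_le_eq[OF AB] by (simp add: algebra_simps)
  \<comment> \<open>Adding the squared difference of the first coordinates completes the squared
    distance of the two unit vectors, which equals \<open>2 * D / (A * B)\<close>.\<close>
  have "(chi u - chi v)\<^sup>2 \<le> (1 / A - 1 / B)\<^sup>2 + (u / A - v / B)\<^sup>2"
    by (simp add: chi_def A_def B_def)
  also have "\<dots> = (1 + u\<^sup>2) / A\<^sup>2 + (1 + v\<^sup>2) / B\<^sup>2 - 2 * (1 + u * v) / (A * B)"
    by (simp add: power2_eq_square add_divide_distrib algebra_simps)
  also have "\<dots> = 2 * D / (A * B)"
    unfolding A(2)[symmetric] B(2)[symmetric] using A(1) B(1) by (simp add: D_def field_simps)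
  finally show ?thesis
    using main unfolding A_def B_def P_def by argo
qed

lemma abs_chi_less_1: "\<bar>chi u\<bar> < 1"
proof -
  have "\<bar>u\<bar> = sqrt (u\<^sup>2)" by simp
  also have "\<dots> < sqrt (1 + u\<^sup>2)" by (rule real_sqrt_less_mono) simp
  finally have "\<bar>u\<bar> < sqrt (1 + u\<^sup>2)" .
  moreover have "0 < sqrt (1 + u\<^sup>2)" by (simp add: add_pos_nonneg)
  ultimately show ?thesis by (simp add: chi_def)
qed

lemma chi_inverse: "u = chi u / sqrt (1 - (chi u)\<^sup>2)"
proof -
  have pos: "0 < 1 + u\<^sup>2" by (simp add: add_pos_nonneg)
  have "1 - (chi u)\<^sup>2 = 1 / (1 + u\<^sup>2)"
    using pos by (simp add: chi_def power_divide field_simps)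
  then show ?thesis using pos by (simp add: chi_def real_sqrt_divide)
qed

text \<open>Near-minimisers of the strictly convex functional \<open>\<integral> sqrt (1 + u\<^sup>2)\<close> over the convex tails converge almost everywhere
  along a subsequence; \<open>chi\<close> turns the convexity defect into a distance.\<close>

theorem tail_hull_AE_convergent:
  fixes f :: "nat \<Rightarrow> 'a \<Rightarrow> real"
  assumes fm: "finite_measure \<mu>" and meas: "\<And>n. f n \<in> borel_measurable \<mu>"
    and bound: "\<And>n. (\<integral>\<^sup>+t. ennreal \<bar>f n t\<bar> \<partial>\<mu>) \<le> ennreal C"
  obtains g h where "\<And>n. g n \<in> tail_hull f n" "h \<in> borel_measurable \<mu>" "AE t in \<mu>. (\<lambda>n. g n t) \<longlonglongrightarrow> h t"
proof -
  interpret finite_measure \<mu> by fact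
  define C0 where "C0 = max C 0"
  have C0: "0 \<le> C0" "(\<integral>\<^sup>+t. ennreal \<bar>f n t\<bar> \<partial>\<mu>) \<le> ennreal C0" for n
    using bound[of n] by (auto simp: C0_def intro: order_trans[OF _ ennreal_leI])
  have T_meas: "u \<in> borel_measurable \<mu>" if "u \<in> tail_hull f n" for u n
    using that by induction (use meas in auto)
  have T_int: "integrable \<mu> u \<and> (LINT t|\<mu>. \<bar>u t\<bar>) \<le> C0" if "u \<in> tail_hull f n" for u n
    using that
  proof induction
    case (base k)
    have "integrable \<mu> (f k)"
      using C0(2)[of k] meas by (intro integrableI_bounded) (auto intro: order.strict_trans1)
    moreover from this have "(\<integral>\<^sup>+t. ennreal \<bar>f k t\<bar> \<partial>\<mu>) = ennreal (LINT t|\<mu>. \<bar>f k t\<bar>)"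
      by (intro nn_integral_eq_integral) auto
    ultimately show ?case using C0(1) C0(2)[of k] by simp
  next
    case (midpoint u v)
    have "(LINT t|\<mu>. \<bar>(u t + v t) / 2\<bar>) \<le> (LINT t|\<mu>. \<bar>u t\<bar> / 2 + \<bar>v t\<bar> / 2)"
      using midpoint.IH by (intro integral_mono) auto
    also have "\<dots> \<le> C0" using midpoint.IH by simp
    finally show ?case using midpoint.IH by auto
  qed
  define J where "J u = (LINT t|\<mu>. sqrt (1 + (u t)\<^sup>2))" for u
  have sq_le: "sqrt (1 + x\<^sup>2) \<le> 1 + \<bar>x\<bar>" for x :: real
    by (rule real_le_lsqrt) (auto simp: power2_eq_square algebra_simps)
  have J_int: "integrable \<mu> (\<lambda>t. sqrt (1 + (u t)\<^sup>2))" if "u \<in> tail_hull f n" for u n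
  proof (rule Bochner_Integration.integrable_bound)
    show "integrable \<mu> (\<lambda>t. 1 + \<bar>u t\<bar>)" using T_int[OF that] by auto
    show "(\<lambda>t. sqrt (1 + (u t)\<^sup>2)) \<in> borel_measurable \<mu>" using T_meas[OF that] by measurable
    show "AE t in \<mu>. norm (sqrt (1 + (u t)\<^sup>2)) \<le> norm (1 + \<bar>u t\<bar>)"
      using sq_le by (auto intro!: AE_I2)
  qed
  have J_nonneg: "0 \<le> J u" for u unfolding J_def by (rule Bochner_Integration.integral_nonneg) simp
  have J_le: "J u \<le> measure \<mu> (space \<mu>) + C0" if "u \<in> tail_hull f n" for u n
  proof -
    have "J u \<le> (LINT t|\<mu>. 1 + \<bar>u t\<bar>)"
      unfolding J_def using J_int[OF that] T_int[OF that] sq_le by (intro integral_mono) auto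
    also have "\<dots> \<le> measure \<mu> (space \<mu>) + C0" using T_int[OF that] by simp
    finally show ?thesis .
  qed
  define s where "s n = Inf (J ` tail_hull f n)" for n
  have ne: "J ` tail_hull f n \<noteq> {}" for n by (auto intro: tail_hull.base)
  have bdd: "bdd_below (J ` tail_hull f n)" for n by (rule bdd_belowI[of _ 0]) (auto simp: J_nonneg)
  have s_le: "s n \<le> J u" if "u \<in> tail_hull f n" for u n
    unfolding s_def using that bdd by (intro cInf_lower) auto
  have s_inc: "incseq s"
    unfolding s_def by (intro incseq_SucI cInf_superset_mono ne bdd image_mono tail_hull_antimono) simp
  have "convergent s"
  proof (rule Bseq_mono_convergent)
    have "0 \<le> s n" for n
      unfolding s_def by (rule cInf_greatest[OF ne]) (auto simp: J_nonneg)
    then have "norm (s n) \<le> measure \<mu> (space \<mu>) + C0" for n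
      using s_le[OF tail_hull.base[of n n f]] J_le[OF tail_hull.base[of n n f]] by simp
    then show "Bseq s" by (rule BseqI')
  qed (use s_inc in \<open>auto simp: incseq_def\<close>)
  then obtain sl where sl: "s \<longlonglongrightarrow> sl" unfolding convergent_def by blast
  have s_sl: "s n \<le> sl" for n using incseq_le[OF s_inc sl] .
  have "\<exists>u\<in>tail_hull f n. J u < s n + 1 / real (Suc n)" for n
    using cInf_lessD[OF ne, of n "s n + 1 / real (Suc n)"] unfolding s_def by auto
  then obtain g where g: "\<And>n. g n \<in> tail_hull f n" "\<And>n. J (g n) < s n + 1 / real (Suc n)" by metis
  have g_meas [measurable]: "g n \<in> borel_measurable \<mu>" for n using T_meas[OF g(1)] .
  \<comment> \<open>Eight times a bound for the convexity defect: both near-minimisers have integral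
    below \<open>sl + 1 / real (Suc n)\<close>, while their midpoint stays in the
    \<open>n\<close>-th hull and has integral at least \<open>s n\<close>.\<close>
  define \<epsilon> where "\<epsilon> n = 8 * ((sl - s n) + 1 / real (Suc n))" for n
  have "(\<lambda>n. 8 * ((sl - s n) + inverse (real (Suc n)))) \<longlonglongrightarrow> 8 * ((sl - sl) + 0)"
    by (intro tendsto_intros sl LIMSEQ_inverse_real_of_nat)
  then have eps_lim: "\<epsilon> \<longlonglongrightarrow> 0" unfolding \<epsilon>_def by (simp add: inverse_eq_divide)
  have chi_int: "(\<integral>\<^sup>+t. ennreal ((chi (g n t) - chi (g m t))\<^sup>2) \<partial>\<mu>) \<le> ennreal (\<epsilon> n)" if "n \<le> m" for n m
  proof -
    let ?m = "\<lambda>t. (g n t + g m t) / 2"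
    have gm: "g m \<in> tail_hull f n" using g(1)[of m] tail_hull_antimono[OF that] by auto
    have mid: "?m \<in> tail_hull f n" by (intro tail_hull.midpoint g gm)
    let ?d = "\<lambda>t. 8 * ((sqrt (1 + (g n t)\<^sup>2) + sqrt (1 + (g m t)\<^sup>2)) / 2 - sqrt (1 + (?m t)\<^sup>2))"
    have d_int: "integrable \<mu> ?d"
      using J_int[OF g(1)[of n]] J_int[OF gm] J_int[OF mid] by auto
    have d_nonneg: "0 \<le> ?d t" for t
      using chi_diff_le[of "g n t" "g m t"] zero_le_power2 by (rule order_trans[rotated])
    have "(LINT t|\<mu>. ?d t) = 8 * ((J (g n) + J (g m)) / 2 - J ?m)"
      using J_int[OF g(1)[of n]] J_int[OF gm] J_int[OF mid] unfolding J_def by simp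
    also have "\<dots> \<le> \<epsilon> n"
    proof -
      have "1 / real (Suc m) \<le> 1 / real (Suc n)" using that by (intro divide_left_mono) auto
      then have "J (g m) < sl + 1 / real (Suc n)" using g(2)[of m] s_sl[of m] by linarith
      moreover have "J (g n) < sl + 1 / real (Suc n)" using g(2)[of n] s_sl[of n] by linarith
      ultimately have "(J (g n) + J (g m)) / 2 - J ?m \<le> (sl - s n) + 1 / real (Suc n)"
        using s_le[OF mid] by argo
      then show ?thesis unfolding \<epsilon>_def by (rule mult_left_mono) simp
    qed
    finally have "ennreal (LINT t|\<mu>. ?d t) \<le> ennreal (\<epsilon> n)" by (rule ennreal_leI)
    moreover have "(\<integral>\<^sup>+t. ennreal (?d t) \<partial>\<mu>) = ennreal (LINT t|\<mu>. ?d t)"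
      by (rule nn_integral_eq_integral[OF d_int AE_I2[OF d_nonneg]])
    moreover have "(\<integral>\<^sup>+t. ennreal ((chi (g n t) - chi (g m t))\<^sup>2) \<partial>\<mu>) \<le> (\<integral>\<^sup>+t. ennreal (?d t) \<partial>\<mu>)"
      by (intro nn_integral_mono ennreal_leI chi_diff_le)
    ultimately show ?thesis by simp
  qed
  \<comment> \<open>The rate \<open>1 / 8\<close> leaves room for the weights \<open>2 ^ k\<close>:
    the weighted squares of the increments have integrals at most \<open>(1 / 4) ^ k\<close>, which
    are summable.\<close>
  have "\<exists>r. strict_mono r \<and> (\<forall>k::nat. \<epsilon> (r k) < (1 / 8) ^ k)"
  proof -
    have ev: "\<exists>N. \<forall>n\<ge>N. \<epsilon> n < (1 / 8) ^ k" for k :: nat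
    proof -
      have "\<forall>\<^sub>F n in sequentially. \<epsilon> n < (1 / 8) ^ k"
        by (rule order_tendstoD(2)[OF eps_lim]) simp
      then show ?thesis by (simp add: eventually_sequentially)
    qed
    have "\<exists>r. \<forall>k. \<epsilon> (r k) < (1 / 8) ^ k \<and> r k < r (Suc k)"
    proof (rule dependent_nat_choice)
      show "\<exists>x. \<epsilon> x < (1 / 8) ^ 0" using ev[of 0] by auto
      fix x k
      obtain N where "\<forall>n\<ge>N. \<epsilon> n < (1 / 8) ^ Suc k" using ev by blast
      then show "\<exists>y. \<epsilon> y < (1 / 8) ^ Suc k \<and> x < y"
        by (intro exI[of _ "max N (Suc x)"]) auto
    qed
    then show ?thesis by (auto simp: strict_mono_Suc_iff)
  qed
  then obtain r where r: "strict_mono r" "\<And>k. \<epsilon> (r k) < (1 / 8) ^ k" by blast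
  define d where "d k t = chi (g (r (Suc k)) t) - chi (g (r k) t)" for k t
  have [measurable]: "d k \<in> borel_measurable \<mu>" for k unfolding d_def chi_def by measurable
  have "(\<integral>\<^sup>+t. (\<Sum>k. ennreal (2 ^ k * (d k t)\<^sup>2)) \<partial>\<mu>) = (\<Sum>k. \<integral>\<^sup>+t. ennreal (2 ^ k * (d k t)\<^sup>2) \<partial>\<mu>)"
    by (intro nn_integral_suminf) measurable
  also have "\<dots> \<le> (\<Sum>k. ennreal ((1 / 4) ^ k))"
  proof (intro suminf_le summableI)
    fix k
    have "(\<integral>\<^sup>+t. ennreal (2 ^ k * (d k t)\<^sup>2) \<partial>\<mu>) = ennreal (2 ^ k) * (\<integral>\<^sup>+t. ennreal ((d k t)\<^sup>2) \<partial>\<mu>)"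
      by (simp add: ennreal_mult nn_integral_cmult)
    also have "(\<integral>\<^sup>+t. ennreal ((d k t)\<^sup>2) \<partial>\<mu>) \<le> ennreal (\<epsilon> (r k))"
      using chi_int[of "r k" "r (Suc k)"] strict_mono_leD[OF r(1), of k "Suc k"]
      unfolding d_def by (subst power2_commute) simp
    also have "\<dots> \<le> ennreal ((1 / 8) ^ k)" using r(2)[of k] by (intro ennreal_leI) simp
    also have "ennreal (2 ^ k) * ennreal ((1 / 8) ^ k) = ennreal ((1 / 4) ^ k)"
      by (simp add: ennreal_mult[symmetric] power_mult_distrib[symmetric])
    finally show "(\<integral>\<^sup>+t. ennreal (2 ^ k * (d k t)\<^sup>2) \<partial>\<mu>) \<le> ennreal ((1 / 4) ^ k)"
      by (simp add: mult_left_mono)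
  qed
  also have "\<dots> < \<infinity>"
    by (subst suminf_ennreal2) (auto intro: summable_geometric)
  finally have "AE t in \<mu>. (\<Sum>k. ennreal (2 ^ k * (d k t)\<^sup>2)) \<noteq> \<infinity>"
    by (intro nn_integral_PInf_AE) auto
  then have chi_conv: "AE t in \<mu>. convergent (\<lambda>k. chi (g (r k) t))"
  proof eventually_elim
    fix t assume "(\<Sum>k. ennreal (2 ^ k * (d k t)\<^sup>2)) \<noteq> \<infinity>"
    then have "summable (\<lambda>k. 2 ^ k * (d k t)\<^sup>2)"
      by (intro summable_suminf_not_top) auto
    then have s2: "summable (\<lambda>k. (1 / 2) ^ k + 2 ^ k * (d k t)\<^sup>2)"
      by (intro summable_add summable_geometric) auto
    \<comment> \<open>The inequality between arithmetic and geometric mean trades the weighted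
      square for the increment itself, so the increments are summable at almost every point.\<close>
    have "norm (d k t) \<le> (1 / 2) ^ k + 2 ^ k * (d k t)\<^sup>2" for k
    proof -
      define a where "a = (2::real) ^ k"
      have a: "a > 0" "(1 / 2) ^ k = 1 / a" by (auto simp: a_def power_one_over)
      have "a * \<bar>d k t\<bar> \<le> 1 + (a * \<bar>d k t\<bar>)\<^sup>2"
      proof -
        have "2 * (a * \<bar>d k t\<bar>) \<le> (a * \<bar>d k t\<bar>)\<^sup>2 + 1"
          using sum_squares_bound[of "a * \<bar>d k t\<bar>" 1] by simp
        moreover have "0 \<le> a * \<bar>d k t\<bar>" using a(1) by simp
        ultimately show ?thesis by linarith
      qed
      then have "\<bar>d k t\<bar> \<le> (1 + (a * \<bar>d k t\<bar>)\<^sup>2) / a"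
        using a by (simp add: field_simps)
      also have "\<dots> = 1 / a + a * (d k t)\<^sup>2" using a by (simp add: field_simps power2_eq_square)
      finally show ?thesis using a unfolding a_def[symmetric] by simp
    qed
    then have "summable (\<lambda>k. d k t)" by (rule summable_comparison_test'[OF s2, of 0])
    then have "convergent (\<lambda>n. \<Sum>k<n. d k t)" by (simp add: summable_iff_convergent)
    then have "convergent (\<lambda>n. (\<Sum>k<n. d k t) + chi (g (r 0) t))"
      by (simp add: convergent_add_const_right_iff)
    then show "convergent (\<lambda>k. chi (g (r k) t))"
      by (simp add: d_def sum_lessThan_telescope[of "\<lambda>k. chi (g (r k) t)"])
  qed
  \<comment> \<open>Convergence of \<open>chi\<close> alone would allow a limit 1 or -1, that is,
    values tending to infinity in modulus. Fatou's lemma and the integral bound exclude this almost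
    everywhere.\<close>
  have "(\<integral>\<^sup>+t. liminf (\<lambda>k. ennreal \<bar>g (r k) t\<bar>) \<partial>\<mu>) \<le> liminf (\<lambda>k. \<integral>\<^sup>+t. ennreal \<bar>g (r k) t\<bar> \<partial>\<mu>)"
    by (rule nn_integral_liminf) measurable
  also have "\<dots> \<le> liminf (\<lambda>k. ennreal C0)"
  proof (intro Liminf_mono always_eventually allI)
    fix k
    have "(\<integral>\<^sup>+t. ennreal \<bar>g (r k) t\<bar> \<partial>\<mu>) = ennreal (LINT t|\<mu>. \<bar>g (r k) t\<bar>)"
      using T_int[OF g(1)[of "r k"]] by (intro nn_integral_eq_integral) auto
    then show "(\<integral>\<^sup>+t. ennreal \<bar>g (r k) t\<bar> \<partial>\<mu>) \<le> ennreal C0"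
      using T_int[OF g(1)[of "r k"]] by (simp add: ennreal_leI)
  qed
  also have "\<dots> < \<infinity>" by (simp add: Liminf_const)
  finally have fin: "AE t in \<mu>. liminf (\<lambda>k. ennreal \<bar>g (r k) t\<bar>) \<noteq> \<infinity>"
    by (intro nn_integral_PInf_AE) auto
  define h where "h t = lim (\<lambda>k. g (r k) t)" for t
  have "AE t in \<mu>. (\<lambda>k. g (r k) t) \<longlonglongrightarrow> h t"
    using chi_conv fin
  proof eventually_elim
    fix t assume "convergent (\<lambda>k. chi (g (r k) t))" and fin: "liminf (\<lambda>k. ennreal \<bar>g (r k) t\<bar>) \<noteq> \<infinity>"
    then obtain y where y: "(\<lambda>k. chi (g (r k) t)) \<longlonglongrightarrow> y" unfolding convergent_def by blast
    have "\<bar>y\<bar> \<le> 1"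
      by (rule tendsto_upperbound[OF tendsto_rabs[OF y]])
        (intro always_eventually allI less_imp_le abs_chi_less_1, simp)
    moreover have "\<bar>y\<bar> \<noteq> 1"
    proof
      assume "\<bar>y\<bar> = 1"
      have "filterlim (\<lambda>k. ennreal \<bar>g (r k) t\<bar>) (nhds \<infinity>) sequentially"
      proof -
        have sq: "(\<lambda>k. sqrt (1 - (chi (g (r k) t))\<^sup>2)) \<longlonglongrightarrow> sqrt (1 - y\<^sup>2)"
          by (intro tendsto_intros y)
        have "1 - y\<^sup>2 = 0" using \<open>\<bar>y\<bar> = 1\<close> by (metis abs_square_eq_1 diff_self)
        then have sq0: "(\<lambda>k. sqrt (1 - (chi (g (r k) t))\<^sup>2)) \<longlonglongrightarrow> 0" using sq by simp
        have pos: "0 < sqrt (1 - (chi (g (r k) t))\<^sup>2)" for k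
          using abs_chi_less_1[of "g (r k) t"] by (simp add: abs_square_less_1)
        have "filterlim (\<lambda>k. \<bar>chi (g (r k) t)\<bar> / sqrt (1 - (chi (g (r k) t))\<^sup>2)) at_top sequentially"
          by (rule LIM_at_top_divide[OF tendsto_rabs[OF y] _ sq0]) (use pos \<open>\<bar>y\<bar> = 1\<close> in auto)
        moreover have "\<bar>chi (g (r k) t)\<bar> / sqrt (1 - (chi (g (r k) t))\<^sup>2) = \<bar>g (r k) t\<bar>" for k
          by (subst (3) chi_inverse) (use pos[of k] in \<open>simp add: abs_divide\<close>)
        ultimately show ?thesis by (simp add: ennreal_tendsto_top_eq_at_top)
      qed
      then have "liminf (\<lambda>k. ennreal \<bar>g (r k) t\<bar>) = \<infinity>"
        by (intro lim_imp_Liminf) auto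
      then show False using fin by simp
    qed
    ultimately have "\<bar>y\<bar> < 1" by simp
    then have "sqrt (1 - y\<^sup>2) \<noteq> 0" by (simp add: abs_square_eq_1)
    then have "(\<lambda>k. chi (g (r k) t) / sqrt (1 - (chi (g (r k) t))\<^sup>2)) \<longlonglongrightarrow> y / sqrt (1 - y\<^sup>2)"
      by (intro tendsto_intros y)
    then have "(\<lambda>k. g (r k) t) \<longlonglongrightarrow> y / sqrt (1 - y\<^sup>2)"
      by (simp only: chi_inverse[symmetric])
    then have "convergent (\<lambda>k. g (r k) t)"
      unfolding convergent_def by blast
    then show "(\<lambda>k. g (r k) t) \<longlonglongrightarrow> h t"
      unfolding h_def by (simp add: convergent_LIMSEQ_iff)
  qed
  moreover have "h \<in> borel_measurable \<mu>"
    unfolding h_def by measurable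
  moreover have "g (r k) \<in> tail_hull f k" for k
    using g(1)[of "r k"] tail_hull_antimono[OF seq_suble[OF r(1), of k], of f] by auto
  ultimately show thesis using that[of "\<lambda>k. g (r k)" h] by blast
qed

section \<open>Step functions\<close>

text \<open>The index codes a mesh and finitely many rational values: entry \<open>j\<close> is the
  value on the \<open>j\<close>-th cell of length \<open>1 / (N + 1)\<close>, and the function is 0
  elsewhere. Indexing by natural numbers supplies the countable family of functionals.\<close>

definition step_fun :: "nat \<Rightarrow> real \<Rightarrow> real" where
  "step_fun i t = (case from_nat i of (N :: nat, xs :: rat list) \<Rightarrow>
     if 0 \<le> t \<and> nat \<lfloor>real (Suc N) * t\<rfloor> < length xs then of_rat (xs ! nat \<lfloor>real (Suc N) * t\<rfloor>) else 0)"

lemma step_fun_to_nat: "step_fun (to_nat (N :: nat, xs :: rat list)) t =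
    (if 0 \<le> t \<and> nat \<lfloor>real (Suc N) * t\<rfloor> < length xs then of_rat (xs ! nat \<lfloor>real (Suc N) * t\<rfloor>) else 0)"
  by (simp add: step_fun_def)

lemma step_fun_measurable [measurable]: "step_fun i \<in> borel_measurable borel"
proof -
  obtain N :: nat and xs :: "rat list" where i: "from_nat i = (N, xs)" by fastforce
  define F where "F k = (if k < length xs then of_rat (xs ! k) else 0 :: real)" for k
  have "(\<lambda>t. if 0 \<le> t then F (nat \<lfloor>real (Suc N) * t\<rfloor>) else 0) \<in> borel_measurable borel"
    by measurable
  also have "(\<lambda>t. if 0 \<le> t then F (nat \<lfloor>real (Suc N) * t\<rfloor>) else 0) = step_fun i"
    unfolding step_fun_def i F_def by auto
  finally show ?thesis .
qed

text \<open>Cells have length at most 1, so the support lies in \<open>[0, length xs)\<close>; the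
  sum of the moduli of all entries bounds every value.\<close>

lemma step_fun_bounded:
  obtains c n where "0 \<le> c" "\<And>t. \<bar>step_fun i t\<bar> \<le> c * indicator {0..<real n} t"
proof -
  obtain N :: nat and xs :: "rat list" where i: "from_nat i = (N, xs)" by fastforce
  define c where "c = (\<Sum>j<length xs. \<bar>real_of_rat (xs ! j)\<bar>)"
  have "\<bar>step_fun i t\<bar> \<le> c * indicator {0..<real (length xs)} t" for t
  proof (cases "0 \<le> t \<and> nat \<lfloor>real (Suc N) * t\<rfloor> < length xs")
    case True
    define j where "j = nat \<lfloor>real (Suc N) * t\<rfloor>"
    have j: "j < length xs" using True by (simp add: j_def)
    have "t \<le> real (Suc N) * t" using True by (simp add: algebra_simps)
    also have "\<dots> < real j + 1" unfolding j_def using True by (simp add: of_nat_nat)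
    also have "\<dots> \<le> real (length xs)" using j by simp
    finally have "indicator {0..<real (length xs)} t = (1::real)" using True by simp
    moreover have "\<bar>step_fun i t\<bar> = \<bar>real_of_rat (xs ! j)\<bar>"
      using True unfolding step_fun_def i j_def by simp
    moreover have "\<bar>real_of_rat (xs ! j)\<bar> \<le> c"
      unfolding c_def using j by (intro member_le_sum) auto
    ultimately show ?thesis by simp
  next
    case False
    have "0 \<le> c" unfolding c_def by (intro sum_nonneg) auto
    then show ?thesis using False unfolding step_fun_def i by (auto simp: indicator_def)
  qed
  moreover have "0 \<le> c" unfolding c_def by (intro sum_nonneg) auto
  ultimately show thesis using that by blast
qed

lemma step_fun_uniform_approx:
  fixes h :: "real \<Rightarrow> real" and n :: nat
  assumes h: "continuous_on UNIV h" and e: "0 < e"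
  obtains i where "\<And>t. 0 \<le> t \<Longrightarrow> t < real n \<Longrightarrow> \<bar>step_fun i t - h t\<bar> \<le> e"
    and "\<And>t. real n \<le> t \<Longrightarrow> step_fun i t = 0"
proof -
  have "uniformly_continuous_on {0..real n} h"
    by (intro compact_uniformly_continuous continuous_on_subset[OF h]) auto
  then obtain d where d: "0 < d" "\<And>x y. x \<in> {0..real n} \<Longrightarrow> y \<in> {0..real n} \<Longrightarrow> dist y x < d \<Longrightarrow> dist (h y) (h x) < e / 2"
    using e unfolding uniformly_continuous_on_def by (meson half_gt_zero)
  obtain N where N: "1 / real (Suc N) < d" using nat_approx_posE[OF d(1)] by blast
  have "\<exists>q. \<bar>of_rat q - h (real j / real (Suc N))\<bar> < e / 2" for j
  proof -
    obtain q where "h (real j / real (Suc N)) < of_rat q" "of_rat q < h (real j / real (Suc N)) + e / 2"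
      using of_rat_dense[of "h (real j / real (Suc N))" "h (real j / real (Suc N)) + e / 2"] e by auto
    then show ?thesis by (intro exI[of _ q]) auto
  qed
  then obtain q where q: "\<And>j. \<bar>of_rat (q j) - h (real j / real (Suc N))\<bar> < e / 2" by metis
  \<comment> \<open>\<open>n * Suc N\<close> cells fill \<open>[0, n)\<close> exactly, so the step
    function vanishes from \<open>n\<close> on; the values are taken near those of \<open>h\<close>
    at the left endpoints.\<close>
  define xs where "xs = map q [0..<n * Suc N]"
  define i where "i = to_nat (N, xs)"
  show thesis
  proof (rule that[of i])
    fix t :: real assume t: "0 \<le> t" "t < real n"
    define j where "j = nat \<lfloor>real (Suc N) * t\<rfloor>"
    have j: "real j \<le> real (Suc N) * t" "real (Suc N) * t < real j + 1"
      using t(1) unfolding j_def by (simp_all add: of_nat_nat)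
    have "real (Suc N) * t < real (Suc N) * real n" using t(2) by (intro mult_strict_left_mono) auto
    then have jn: "j < n * Suc N"
      using j(1) by (metis mult.commute of_nat_less_iff of_nat_mult order.strict_trans1)
    have "real j / real (Suc N) \<le> t" using j(1) by (simp add: pos_divide_le_eq mult.commute)
    moreover have "t < real j / real (Suc N) + 1 / real (Suc N)"
      using j(2) by (simp add: add_divide_distrib[symmetric] pos_less_divide_eq mult.commute)
    ultimately have "dist t (real j / real (Suc N)) < d" "real j / real (Suc N) \<in> {0..real n}"
      using N t by (auto simp: dist_real_def)
    then have "\<bar>h t - h (real j / real (Suc N))\<bar> < e / 2"
      using d(2)[of "real j / real (Suc N)" t] t by (simp add: dist_real_def)
    moreover have "step_fun i t = of_rat (q j)"
      unfolding i_def step_fun_to_nat j_def[symmetric] using t(1) jn by (simp add: xs_def del: of_nat_Suc)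
    ultimately show "\<bar>step_fun i t - h t\<bar> \<le> e"
      using q[of j] by linarith
  next
    fix t assume t: "real n \<le> t"
    have "int (n * Suc N) \<le> \<lfloor>real (Suc N) * t\<rfloor>"
      unfolding le_floor_iff using mult_left_mono[OF t, of "real (Suc N)"] by (simp add: algebra_simps)
    then have "n * Suc N \<le> nat \<lfloor>real (Suc N) * t\<rfloor>" by linarith
    then show "step_fun i t = 0"
      unfolding i_def step_fun_to_nat xs_def by simp
  qed
qed

text \<open>Lebesgue measurability provides continuous functions converging almost everywhere.
  Clipping them at \<open>\<bar>c\<bar>\<close> leaves the limit unchanged and bounds them
  uniformly; uniform approximation with error at most 1 accounts for the bound
  \<open>\<bar>c\<bar> + 1\<close>.\<close>

lemma step_fun_AE_approx:
  fixes f :: "real \<Rightarrow> real"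
  assumes S: "S \<in> sets lebesgue" and f: "f \<in> borel_measurable (lebesgue_on S)" and S0: "S \<subseteq> {0..}"
    and bound: "\<And>t. t \<in> S \<Longrightarrow> \<bar>f t\<bar> \<le> c * indicator {0..<real n} t"
  obtains k where "AE t in lebesgue_on S. (\<lambda>j. step_fun (k j) t) \<longlonglongrightarrow> f t"
    "\<And>j t. t \<in> S \<Longrightarrow> \<bar>step_fun (k j) t\<bar> \<le> (\<bar>c\<bar> + 1) * indicator {0..<real n} t"
proof -
  have "f measurable_on S"
    using f by (simp add: measurable_on_iff_borel_measurable[OF S])
  then obtain N g where N: "negligible N" and g: "\<And>j. continuous_on UNIV (g j)"
    and lim: "\<And>t. t \<notin> N \<Longrightarrow> (\<lambda>j. g j t) \<longlonglongrightarrow> (if t \<in> S then f t else 0)"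
    unfolding measurable_on_def by blast
  define h where "h j t = max (- \<bar>c\<bar>) (min \<bar>c\<bar> (g j t))" for j :: nat and t
  have h: "continuous_on UNIV (h j)" for j
    unfolding h_def using g by (intro continuous_intros)
  have h_bound: "\<bar>h j t\<bar> \<le> \<bar>c\<bar>" for j t unfolding h_def by auto
  have "\<exists>i. (\<forall>t. 0 \<le> t \<and> t < real n \<longrightarrow> \<bar>step_fun i t - h j t\<bar> \<le> 1 / real (Suc j)) \<and>
      (\<forall>t. real n \<le> t \<longrightarrow> step_fun i t = 0)" for j
    by (rule step_fun_uniform_approx[OF h[of j], of "1 / real (Suc j)" n]) auto
  then obtain k where k: "\<And>j t. 0 \<le> t \<Longrightarrow> t < real n \<Longrightarrow> \<bar>step_fun (k j) t - h j t\<bar> \<le> 1 / real (Suc j)"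
      "\<And>j t. real n \<le> t \<Longrightarrow> step_fun (k j) t = 0"
    by metis
  show thesis
  proof (rule that[of k])
    have pt: "(\<lambda>j. step_fun (k j) t) \<longlonglongrightarrow> f t" if t: "t \<in> S" "t \<notin> N" for t
    proof (cases "t < real n")
      case True
      have "c * indicator {0..<real n} t \<le> \<bar>c\<bar>" by (auto simp: indicator_def)
      then have ft: "\<bar>f t\<bar> \<le> \<bar>c\<bar>" using bound[OF t(1)] by (rule order_trans[rotated])
      have "(\<lambda>j. h j t) \<longlonglongrightarrow> max (- \<bar>c\<bar>) (min \<bar>c\<bar> (f t))"
        unfolding h_def using lim[OF t(2)] t(1) by (intro tendsto_intros) auto
      also have "max (- \<bar>c\<bar>) (min \<bar>c\<bar> (f t)) = f t" using ft by auto
      finally have "(\<lambda>j. h j t) \<longlonglongrightarrow> f t" .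
      moreover have "(\<lambda>j. step_fun (k j) t - h j t) \<longlonglongrightarrow> 0"
      proof (rule Lim_null_comparison[OF _ LIMSEQ_inverse_real_of_nat])
        show "\<forall>\<^sub>F j in sequentially. norm (step_fun (k j) t - h j t) \<le> inverse (real (Suc j))"
          using k(1)[of t] True t S0 by (auto simp: inverse_eq_divide)
      qed
      ultimately have "(\<lambda>j. (step_fun (k j) t - h j t) + h j t) \<longlonglongrightarrow> 0 + f t"
        by (intro tendsto_add)
      then show ?thesis by simp
    next
      case False
      then have "f t = 0" using bound[OF t(1)] by simp
      then show ?thesis using k(2)[of t] False by simp
    qed
    have "AE t in lebesgue. t \<notin> N"
      using N by (simp add: negligible_iff_null_sets AE_not_in)
    then show "AE t in lebesgue_on S. (\<lambda>j. step_fun (k j) t) \<longlonglongrightarrow> f t"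
      using S pt by (subst AE_restrict_space_iff) (auto elim!: eventually_mono)
  next
    fix j t assume t: "t \<in> S"
    show "\<bar>step_fun (k j) t\<bar> \<le> (\<bar>c\<bar> + 1) * indicator {0..<real n} t"
    proof (cases "t < real n")
      case True
      have t0: "0 \<le> t" using t S0 by auto
      have "1 / real (Suc j) \<le> 1" by simp
      then have "\<bar>step_fun (k j) t\<bar> \<le> \<bar>c\<bar> + 1"
        using k(1)[OF t0 True, of j] h_bound[of j t] by linarith
      then show ?thesis using t0 True by simp
    next
      case False
      then show ?thesis using k(2)[of t j] by simp
    qed
  qed
qed

text \<open>The product of the intervals is compact by Tychonoff's theorem and, having countably
  many factors, sequentially compact; a convergent subsequence in the product converges in each
  coordinate.\<close>

lemma diagonal_convergent_subsequence:
  fixes a :: "nat \<Rightarrow> nat \<Rightarrow> real"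
  assumes bound: "\<And>n i. \<bar>a n i\<bar> \<le> C i"
  obtains r l where "strict_mono (r :: nat \<Rightarrow> nat)" "\<And>i. (\<lambda>n. a (r n) i) \<longlonglongrightarrow> l i"
proof -
  have "compactin (product_topology (\<lambda>i::nat. euclidean :: real topology) UNIV) (PiE UNIV (\<lambda>i. {- C i..C i}))"
    by (subst compactin_PiE) auto
  then have "compact (PiE UNIV (\<lambda>i. {- C i..C i}))"
    by (simp add: euclidean_product_topology)
  then have "seq_compact (PiE UNIV (\<lambda>i. {- C i..C i}))"
    by (rule compact_imp_seq_compact)
  moreover have "a n \<in> PiE UNIV (\<lambda>i. {- C i..C i})" for n
    using bound[of n] by (auto simp: PiE_def abs_le_iff minus_le_iff)
  ultimately obtain l r where "strict_mono (r :: nat \<Rightarrow> nat)" "(a \<circ> r) \<longlonglongrightarrow> l"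
    unfolding seq_compact_def by metis
  moreover have "(\<lambda>n. (a \<circ> r) n i) \<longlonglongrightarrow> l i" if "(a \<circ> r) \<longlonglongrightarrow> l" for i
    using continuous_on_tendsto_compose[OF continuous_on_product_coordinates that] by auto
  ultimately show thesis using that[of r l] by (simp add: o_def)
qed

section \<open>The Luxemburg norm\<close>

locale orlicz_lorentz_delta2 = orlicz_lorentz_modular \<gamma> w \<phi> for \<gamma> w \<phi> +
  assumes superlinear: "filterlim (\<lambda>u. \<phi> u / u) at_top at_top"
    and D2: "\<gamma> = \<infinity> \<Longrightarrow> Delta2 \<phi>" and D2i: "\<gamma> < \<infinity> \<Longrightarrow> Delta2_infty \<phi>"
begin

text \<open>Under the growth condition, a finite modular of one positive multiple gives a finite
  modular of all multiples. Hence these functions are the representatives of the elements of the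
  space, as \<open>carrier_V\<close> confirms.\<close>

definition good :: "(real \<Rightarrow> real) \<Rightarrow> bool" where
  "good f \<longleftrightarrow> f \<in> borel_measurable M \<and> \<rho> f < \<infinity>"

definition lux :: "(real \<Rightarrow> real) \<Rightarrow> real" where
  "lux f = Inf {e. 0 < e \<and> \<rho> (\<lambda>t. f t / e) \<le> 1}"

lemma good_measurable [measurable_dest]: "good f \<Longrightarrow> f \<in> borel_measurable M"
  by (simp add: good_def)

lemma good_cmult: "good f \<Longrightarrow> good (\<lambda>t. a * f t)"
  unfolding good_def using rho_scale_finite[OF _ _ D2 D2i] by auto

lemma good_divide: "good f \<Longrightarrow> good (\<lambda>t. f t / a)"
  using good_cmult[of f "inverse a"] by (simp add: divide_inverse mult.commute)

lemma good_add:
  assumes "good f" "good g"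
  shows "good (\<lambda>t. f t + g t)"
proof -
  have [measurable]: "f \<in> borel_measurable M" "g \<in> borel_measurable M" using assms by (auto simp: good_def)
  have f2: "\<rho> (\<lambda>t. 2 * f t) < \<infinity>" and g2: "\<rho> (\<lambda>t. 2 * g t) < \<infinity>"
    using good_cmult[OF assms(1)] good_cmult[OF assms(2)] by (auto simp: good_def)
  have "\<rho> (\<lambda>t. (1 - 1 / 2) * (2 * f t) + 1 / 2 * (2 * g t)) \<le>
      ennreal (1 - 1 / 2) * \<rho> (\<lambda>t. 2 * f t) + ennreal (1 / 2) * \<rho> (\<lambda>t. 2 * g t)"
    by (rule rho_convex) auto
  also have "\<dots> < \<infinity>"
  proof -
    have "ennreal a * x + ennreal b * y < \<infinity>" if "x < \<infinity>" "y < \<infinity>" for a b x y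
      using that by (auto simp: ennreal_mult_less_top)
    then show ?thesis using f2 g2 by blast
  qed
  finally show ?thesis by (simp add: good_def)
qed

lemma good_diff: "good f \<Longrightarrow> good g \<Longrightarrow> good (\<lambda>t. f t - g t)"
  using good_add[of f "\<lambda>t. (-1) * g t"] good_cmult[of g "-1"] by simp

lemma good_cong_AE: "good f \<Longrightarrow> g \<in> borel_measurable M \<Longrightarrow> AE t in M. f t = g t \<Longrightarrow> good g"
  unfolding good_def using rho_cong_AE[of f g] by auto

lemma good_0: "good (\<lambda>_. 0)"
  by (simp add: good_def)

lemma good_mono: "good g \<Longrightarrow> f \<in> borel_measurable M \<Longrightarrow> AE t in M. \<bar>f t\<bar> \<le> \<bar>g t\<bar> \<Longrightarrow> good f"
  unfolding good_def using rho_mono[of f g] by (auto intro: order.strict_trans1)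

lemma good_bounded: "good (\<lambda>t. c * indicator {0..<real n} t)"
  unfolding good_def using rho_bounded_finite by auto

lemma rho_theta:
  assumes "f \<in> borel_measurable M" "0 \<le> \<theta>" "\<theta> \<le> 1"
  shows "\<rho> (\<lambda>t. \<theta> * f t) \<le> ennreal \<theta> * \<rho> f"
  using rho_convex[of "\<lambda>_. 0" f \<theta>] assms by simp

lemma lux_set_nonempty:
  assumes "good f"
  shows "\<exists>e>0. \<rho> (\<lambda>t. f t / e) \<le> 1"
proof -
  define r where "r = enn2real (\<rho> f)"
  have r: "0 \<le> r" "\<rho> f = ennreal r" using assms by (auto simp: r_def good_def less_top)
  have "\<rho> (\<lambda>t. 1 / (r + 1) * f t) \<le> ennreal (1 / (r + 1)) * \<rho> f"
    using assms r by (intro rho_theta) (auto simp: good_def)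
  also have "\<dots> = ennreal (1 / (r + 1) * r)" using r by (simp add: ennreal_mult[symmetric])
  also have "\<dots> \<le> ennreal 1" using r by (intro ennreal_leI) simp
  finally show ?thesis using r by (intro exI[of _ "r + 1"]) simp
qed

lemma lux_le: "0 < e \<Longrightarrow> \<rho> (\<lambda>t. f t / e) \<le> 1 \<Longrightarrow> lux f \<le> e"
  unfolding lux_def by (intro cInf_lower bdd_belowI[of _ 0]) auto

lemma lux_nonneg: "good f \<Longrightarrow> 0 \<le> lux f"
  unfolding lux_def using lux_set_nonempty by (intro cInf_greatest) auto

lemma lux_lessD:
  assumes f: "good f" and e: "lux f < e"
  shows "\<rho> (\<lambda>t. f t / e) \<le> 1"
proof -
  have "{e. 0 < e \<and> \<rho> (\<lambda>t. f t / e) \<le> 1} \<noteq> {}" using lux_set_nonempty[OF f] by auto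
  from cInf_lessD[OF this] obtain d where d: "0 < d" "\<rho> (\<lambda>t. f t / d) \<le> 1" "d < e"
    using e unfolding lux_def by auto
  have "\<bar>f t / e\<bar> \<le> \<bar>f t / d\<bar>" for t
    using d by (auto simp: abs_divide intro: divide_left_mono)
  then have "\<rho> (\<lambda>t. f t / e) \<le> \<rho> (\<lambda>t. f t / d)"
    using f by (intro rho_mono) (auto simp: good_def)
  then show ?thesis using d(2) by (rule order_trans)
qed

text \<open>By the Fatou property the infimum is attained, so the closed unit ball is the set where
  the modular is at most 1.\<close>

lemma lux_leD:
  assumes f: "good f" and c: "0 < c" "lux f \<le> c"
  shows "\<rho> (\<lambda>t. f t / c) \<le> 1"
proof -
  have [measurable]: "f \<in> borel_measurable M" using f by (simp add: good_def)
  have "(\<lambda>n. c + inverse (real (Suc n))) \<longlonglongrightarrow> c + 0"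
    by (intro tendsto_intros LIMSEQ_inverse_real_of_nat)
  then have "\<rho> (\<lambda>t. f t / c) \<le> liminf (\<lambda>n. \<rho> (\<lambda>t. f t / (c + inverse (real (Suc n)))))"
    using c by (intro rho_liminf AE_I2 tendsto_divide tendsto_const) auto
  also have "\<dots> \<le> liminf (\<lambda>n. 1)"
  proof (intro Liminf_mono always_eventually allI lux_lessD f)
    fix n
    have "0 < inverse (real (Suc n))" by simp
    then show "lux f < c + inverse (real (Suc n))" using c by linarith
  qed
  finally show ?thesis by (simp add: Liminf_const)
qed

lemma lux_cong_AE:
  assumes "f \<in> borel_measurable M" "g \<in> borel_measurable M" "AE t in M. f t = g t"
  shows "lux f = lux g"
proof -
  have "\<rho> (\<lambda>t. f t / e) = \<rho> (\<lambda>t. g t / e)" for e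
    using assms by (intro rho_cong_AE) (auto elim!: eventually_mono)
  then show ?thesis by (simp add: lux_def)
qed

lemma lux_0 [simp]: "lux (\<lambda>_. 0) = 0"
proof (rule antisym)
  show "lux (\<lambda>_. 0) \<le> 0"
    by (rule field_le_epsilon) (auto intro: lux_le)
qed (rule lux_nonneg[OF good_0])

lemma lux_cmult_le:
  assumes f: "good f"
  shows "lux (\<lambda>t. a * f t) \<le> \<bar>a\<bar> * lux f"
proof (cases "a = 0")
  case False
  show ?thesis
  proof (rule field_le_epsilon)
    fix e :: real assume e: "0 < e"
    define d where "d = lux f + e / \<bar>a\<bar>"
    have d: "lux f < d" "0 < d" using e False lux_nonneg[OF f] by (auto simp: d_def add_nonneg_pos)
    have "\<rho> (\<lambda>t. a * f t / (\<bar>a\<bar> * d)) \<le> \<rho> (\<lambda>t. f t / d)"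
      using False f by (intro rho_mono) (auto simp: good_def abs_divide abs_mult)
    also have "\<dots> \<le> 1" by (rule lux_lessD[OF f d(1)])
    finally have "lux (\<lambda>t. a * f t) \<le> \<bar>a\<bar> * d" using d(2) False by (intro lux_le) auto
    also have "\<dots> = \<bar>a\<bar> * lux f + e" using False by (simp add: d_def distrib_left)
    finally show "lux (\<lambda>t. a * f t) \<le> \<bar>a\<bar> * lux f + e" .
  qed
qed simp

lemma lux_cmult:
  assumes f: "good f"
  shows "lux (\<lambda>t. a * f t) = \<bar>a\<bar> * lux f"
proof (cases "a = 0")
  case False
  have "lux (\<lambda>t. 1 / a * (a * f t)) \<le> \<bar>1 / a\<bar> * lux (\<lambda>t. a * f t)"
    by (intro lux_cmult_le good_cmult f)
  then have "\<bar>a\<bar> * lux f \<le> lux (\<lambda>t. a * f t)"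
    using False by (simp add: field_simps)
  then show ?thesis using lux_cmult_le[OF f] by (intro antisym)
qed simp

lemma lux_add:
  assumes f: "good f" and g: "good g"
  shows "lux (\<lambda>t. f t + g t) \<le> lux f + lux g"
proof (rule field_le_epsilon)
  fix e :: real assume e: "0 < e"
  define a b where "a = lux f + e / 2" and "b = lux g + e / 2"
  have a: "lux f < a" "0 < a" and b: "lux g < b" "0 < b"
    using e lux_nonneg[OF f] lux_nonneg[OF g] by (auto simp: a_def b_def)
  \<comment> \<open>These weights write \<open>(f + g) / (a + b)\<close> as a convex combination of
    \<open>f / a\<close> and \<open>g / b\<close>.\<close>
  define \<theta> where "\<theta> = b / (a + b)"
  have \<theta>: "0 \<le> \<theta>" "\<theta> \<le> 1" "1 - \<theta> = a / (a + b)" using a b by (auto simp: \<theta>_def field_simps)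
  have "\<rho> (\<lambda>t. (f t + g t) / (a + b)) = \<rho> (\<lambda>t. (1 - \<theta>) * (f t / a) + \<theta> * (g t / b))"
    unfolding \<theta>(3) unfolding \<theta>_def using a b by (simp add: add_divide_distrib)
  also have "\<dots> \<le> ennreal (1 - \<theta>) * \<rho> (\<lambda>t. f t / a) + ennreal \<theta> * \<rho> (\<lambda>t. g t / b)"
    using f g \<theta> by (intro rho_convex) (auto simp: good_def)
  also have "\<dots> \<le> ennreal (1 - \<theta>) * 1 + ennreal \<theta> * 1"
    by (intro add_mono mult_left_mono lux_lessD f g a b) auto
  also have "\<dots> = 1" using \<theta> by (simp add: ennreal_plus[symmetric] del: ennreal_plus)
  finally have "lux (\<lambda>t. f t + g t) \<le> a + b" using a b by (intro lux_le) auto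
  then show "lux (\<lambda>t. f t + g t) \<le> lux f + lux g + e" by (simp add: a_def b_def)
qed

lemma w_pos_AE: "AE t in M. 0 < w t"
  using AE_M_pos by eventually_elim (auto intro: w_pos)

text \<open>All quotients \<open>f / e\<close> have modular at most 1, and by convexity division by
  \<open>e \<le> 1\<close> multiplies the modular integrand by at least \<open>1 / e\<close>. So the
  weighted integral of \<open>\<phi> \<bar>f t\<bar>\<close> is at most every such
  \<open>e\<close>.\<close>

lemma lux_eq_0D:
  assumes f: "good f" and 0: "lux f = 0"
  shows "AE t in M. f t = 0"
proof -
  have [measurable]: "f \<in> borel_measurable M" using f by (simp add: good_def)
  let ?I = "\<integral>\<^sup>+t. ennreal (\<phi> \<bar>f t\<bar>) * ennreal (w t) \<partial>M"
  have le: "?I \<le> ennreal e" if e: "0 < e" "e \<le> 1" for e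
  proof -
    have "?I \<le> (\<integral>\<^sup>+t. ennreal e * (ennreal (\<phi> \<bar>f t / e\<bar>) * ennreal (w t)) \<partial>M)"
    proof (rule nn_integral_mono)
      fix t
      have "\<phi> \<bar>f t\<bar> \<le> e * \<phi> \<bar>f t / e\<bar>"
        using phi_scale[of e "\<bar>f t / e\<bar>"] e by (simp add: abs_divide)
      then have "ennreal (\<phi> \<bar>f t\<bar>) \<le> ennreal e * ennreal (\<phi> \<bar>f t / e\<bar>)"
        using e by (simp add: ennreal_mult[symmetric] ennreal_leI)
      then show "ennreal (\<phi> \<bar>f t\<bar>) * ennreal (w t) \<le> ennreal e * (ennreal (\<phi> \<bar>f t / e\<bar>) * ennreal (w t))"
        by (simp add: mult.assoc[symmetric] mult_right_mono)
    qed
    also have "\<dots> = ennreal e * (\<integral>\<^sup>+t. ennreal (\<phi> \<bar>f t / e\<bar>) * ennreal (w t) \<partial>M)"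
      by (rule nn_integral_cmult) measurable
    also have "\<dots> \<le> ennreal e * 1"
      using rho_L1[of "\<lambda>t. f t / e"] lux_lessD[OF f, of e] 0 e
      by (intro mult_left_mono) (auto intro: order_trans)
    finally show ?thesis by simp
  qed
  have "?I = 0"
  proof (rule ccontr)
    assume "?I \<noteq> 0"
    then obtain b where b: "0 < b" "b < ?I" using dense[of 0 ?I] by (auto simp: zero_less_iff_neq_zero)
    \<comment> \<open>\<open>b\<close> is cut off at 1 because the bound \<open>le\<close> is stated
      for \<open>e \<le> 1\<close>.\<close>
    define e where "e = enn2real (min b 1)"
    have "min b 1 < \<infinity>" by (rule order.strict_trans1[OF min.cobounded2]) simp
    then have e: "ennreal e = min b 1" unfolding e_def by (intro ennreal_enn2real) simp
    have "0 < e" using b e by (metis ennreal_less_zero_iff min_less_iff_conj zero_less_one)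
    moreover have "e \<le> 1"
      using e by (metis ennreal_le_1 min.cobounded2)
    ultimately have "?I \<le> min b 1" using le e by metis
    then show False using b by auto
  qed
  then have "AE t in M. ennreal (\<phi> \<bar>f t\<bar>) * ennreal (w t) = 0"
    by (subst (asm) nn_integral_0_iff_AE) auto
  then show ?thesis using w_pos_AE
  proof eventually_elim
    fix t assume "ennreal (\<phi> \<bar>f t\<bar>) * ennreal (w t) = 0" "0 < w t"
    then show "f t = 0" using phi_pos[of "\<bar>f t\<bar>"] by (auto simp: ennreal_eq_0_iff)
  qed
qed

text \<open>Order continuity of the norm: convergence of the modular is applied to the quotients
  \<open>u j / e\<close>, whose majorant \<open>g / e\<close> still has finite modular by the growth
  condition.\<close>

lemma lux_vanishing:
  assumes g: "good g" and u [measurable]: "\<And>j. u j \<in> borel_measurable M"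
    and le: "\<And>j. AE t in M. \<bar>u j t\<bar> \<le> \<bar>g t\<bar>" and lim: "AE t in M. (\<lambda>j. u j t) \<longlonglongrightarrow> 0" and e: "0 < e"
  shows "\<exists>j. lux (u j) \<le> e"
proof -
  have [measurable]: "g \<in> borel_measurable M" using g by (simp add: good_def)
  have "(\<lambda>j. \<rho> (\<lambda>t. u j t / e)) \<longlonglongrightarrow> 0"
  proof (rule rho_tendsto_0)
    show "AE t in M. \<bar>u j t / e\<bar> \<le> \<bar>g t / e\<bar>" for j
      using le[of j] by eventually_elim (use e in \<open>simp add: abs_divide divide_right_mono\<close>)
    show "AE t in M. (\<lambda>j. u j t / e) \<longlonglongrightarrow> 0"
      using lim
    proof eventually_elim
      fix t assume "(\<lambda>j. u j t) \<longlonglongrightarrow> 0"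
      then have "(\<lambda>j. u j t / e) \<longlonglongrightarrow> 0 / e" using e by (intro tendsto_intros) auto
      then show "(\<lambda>j. u j t / e) \<longlonglongrightarrow> 0" by simp
    qed
    show "\<rho> (\<lambda>t. g t / e) < \<infinity>" using good_divide[OF g] by (simp add: good_def)
  qed measurable
  then have "\<forall>\<^sub>F j in sequentially. \<rho> (\<lambda>t. u j t / e) < 1"
    by (rule order_tendstoD) simp
  then obtain j where "\<rho> (\<lambda>t. u j t / e) < 1" by (auto simp: eventually_sequentially)
  then show ?thesis using e by (intro exI[of _ j] lux_le) auto
qed

section \<open>Uniform integrability and integrals against bounded functions\<close>

lemma phi_superlinear: "\<exists>L>0. \<forall>u\<ge>L. K * u \<le> \<phi> u"
proof -
  have "\<forall>\<^sub>F u in at_top. K \<le> \<phi> u / u"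
    using superlinear by (auto simp: filterlim_at_top)
  then obtain L where L: "\<And>u. u \<ge> L \<Longrightarrow> K \<le> \<phi> u / u" by (auto simp: eventually_at_top_linorder)
  have "K * u \<le> \<phi> u" if "u \<ge> max L 1" for u
    using L[of u] that by (simp add: pos_le_divide_eq)
  then show ?thesis by (intro exI[of _ "max L 1"]) auto
qed

text \<open>Uniform integrability with respect to the weight: the threshold \<open>L\<close> depends
  only on \<open>K\<close>, while the bound \<open>1 / K\<close> holds for all functions of modular
  at most 1.\<close>

lemma excess_le:
  assumes [measurable]: "f \<in> borel_measurable M" and \<rho>: "\<rho> f \<le> 1" and K: "0 < K"
    and L: "\<And>u. L \<le> u \<Longrightarrow> K * u \<le> \<phi> u" "0 < L"
  shows "(\<integral>\<^sup>+t. ennreal (max 0 (\<bar>f t\<bar> - L)) * ennreal (w t) \<partial>M) \<le> ennreal (1 / K)"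
proof -
  have "(\<integral>\<^sup>+t. ennreal (max 0 (\<bar>f t\<bar> - L)) * ennreal (w t) \<partial>M) \<le>
      (\<integral>\<^sup>+t. ennreal (1 / K) * (ennreal (\<phi> \<bar>f t\<bar>) * ennreal (w t)) \<partial>M)"
  proof (rule nn_integral_mono)
    fix t
    have "max 0 (\<bar>f t\<bar> - L) \<le> 1 / K * \<phi> \<bar>f t\<bar>"
    proof (cases "L \<le> \<bar>f t\<bar>")
      case True
      have "K * (\<bar>f t\<bar> - L) \<le> K * \<bar>f t\<bar>" using K L(2) by simp
      also have "\<dots> \<le> \<phi> \<bar>f t\<bar>" by (rule L(1)[OF True])
      finally show ?thesis using K True by (simp add: field_simps)
    qed (use K in auto)
    then have "ennreal (max 0 (\<bar>f t\<bar> - L)) \<le> ennreal (1 / K) * ennreal (\<phi> \<bar>f t\<bar>)"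
      using K by (simp add: ennreal_mult[symmetric] ennreal_leI del: max.bounded_iff)
    then show "ennreal (max 0 (\<bar>f t\<bar> - L)) * ennreal (w t) \<le> ennreal (1 / K) * (ennreal (\<phi> \<bar>f t\<bar>) * ennreal (w t))"
      by (simp add: mult.assoc[symmetric] mult_right_mono)
  qed
  also have "\<dots> = ennreal (1 / K) * (\<integral>\<^sup>+t. ennreal (\<phi> \<bar>f t\<bar>) * ennreal (w t) \<partial>M)"
    by (rule nn_integral_cmult) measurable
  also have "\<dots> \<le> ennreal (1 / K) * 1"
    using rho_L1[of f] \<rho> by (intro mult_left_mono) (auto intro: order_trans)
  finally show ?thesis by simp
qed

text \<open>The mass of the weight on the part of \<open>[0, n)\<close> inside the interval, finite
  even when \<open>n\<close> exceeds the right end.\<close>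

definition Wn :: "nat \<Rightarrow> ennreal" where
  "Wn n = (\<integral>\<^sup>+t. indicator {0..<real n} t * ennreal (w t) \<partial>M)"

lemma Wn_finite: "Wn n < \<infinity>"
proof -
  have "Wn n \<le> H (\<lambda>t. ennreal 1 * indicator {0..<real n} t)"
    unfolding Wn_def using nn_integral_le_H[of "indicator {0..<real n}"] by simp
  also have "\<dots> < \<infinity>" by (rule H_bounded_finite) simp
  finally show ?thesis .
qed

lemma local_L1_bound:
  obtains C where "0 < C" "\<And>f. f \<in> borel_measurable M \<Longrightarrow> \<rho> f \<le> 1 \<Longrightarrow>
    (\<integral>\<^sup>+t. ennreal \<bar>f t\<bar> * indicator {0..<real n} t * ennreal (w t) \<partial>M) \<le> ennreal C"
proof -
  obtain L where L: "L > 0" "\<And>u. L \<le> u \<Longrightarrow> 1 * u \<le> \<phi> u" using phi_superlinear[of 1] by auto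
  \<comment> \<open>Values up to \<open>L\<close> contribute at most \<open>L\<close> times the mass
    of the weight; the summand 1 is the excess bound for \<open>K = 1\<close>.\<close>
  define C where "C = L * enn2real (Wn n) + 1"
  show thesis
  proof (rule that[of C])
    show "0 < C" using L(1) by (simp add: C_def add_nonneg_pos)
    fix f assume f [measurable]: "f \<in> borel_measurable M" and \<rho>: "\<rho> f \<le> 1"
    have "(\<integral>\<^sup>+t. ennreal \<bar>f t\<bar> * indicator {0..<real n} t * ennreal (w t) \<partial>M) \<le>
        (\<integral>\<^sup>+t. ennreal L * (indicator {0..<real n} t * ennreal (w t)) + ennreal (max 0 (\<bar>f t\<bar> - L)) * ennreal (w t) \<partial>M)"
    proof (rule nn_integral_mono)
      fix t
      have "ennreal \<bar>f t\<bar> \<le> ennreal L + ennreal (max 0 (\<bar>f t\<bar> - L))"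
      proof -
        have "ennreal \<bar>f t\<bar> \<le> ennreal (L + max 0 (\<bar>f t\<bar> - L))" by (rule ennreal_leI) simp
        also have "\<dots> = ennreal L + ennreal (max 0 (\<bar>f t\<bar> - L))" using L(1) by (intro ennreal_plus) auto
        finally show ?thesis .
      qed
      then have "ennreal \<bar>f t\<bar> * ennreal (w t) \<le> (ennreal L + ennreal (max 0 (\<bar>f t\<bar> - L))) * ennreal (w t)"
        by (rule mult_right_mono) simp
      then show "ennreal \<bar>f t\<bar> * indicator {0..<real n} t * ennreal (w t) \<le>
          ennreal L * (indicator {0..<real n} t * ennreal (w t)) + ennreal (max 0 (\<bar>f t\<bar> - L)) * ennreal (w t)"
        by (auto simp: indicator_def distrib_right)
    qed
    also have "\<dots> = ennreal L * Wn n + (\<integral>\<^sup>+t. ennreal (max 0 (\<bar>f t\<bar> - L)) * ennreal (w t) \<partial>M)"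
      unfolding Wn_def by (subst nn_integral_add) (auto simp: nn_integral_cmult)
    also have "\<dots> \<le> ennreal L * Wn n + ennreal (1 / 1)"
      using L f \<rho> by (intro add_left_mono excess_le) auto
    also have "\<dots> = ennreal C"
      using L(1) Wn_finite[of n] by (simp add: C_def ennreal_mult less_top ennreal_plus)
    finally show "(\<integral>\<^sup>+t. ennreal \<bar>f t\<bar> * indicator {0..<real n} t * ennreal (w t) \<partial>M) \<le> ennreal C" .
  qed
qed

definition pairing :: "(real \<Rightarrow> real) \<Rightarrow> (real \<Rightarrow> real) \<Rightarrow> real" where
  "pairing s f = (LINT t|M. f t * s t * w t)"

lemma pairing_norm_le:
  assumes f [measurable]: "f \<in> borel_measurable M" and s [measurable]: "s \<in> borel_measurable M"
    and c: "0 \<le> c" and bound: "\<And>t. t \<in> half_open \<gamma> \<Longrightarrow> \<bar>s t\<bar> \<le> c * indicator {0..<real n} t"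
  shows "(\<integral>\<^sup>+t. ennreal (norm (f t * s t * w t)) \<partial>M) \<le>
    ennreal c * (\<integral>\<^sup>+t. ennreal \<bar>f t\<bar> * indicator {0..<real n} t * ennreal (w t) \<partial>M)"
proof -
  have "(\<integral>\<^sup>+t. ennreal (norm (f t * s t * w t)) \<partial>M) \<le>
      (\<integral>\<^sup>+t. ennreal c * (ennreal \<bar>f t\<bar> * indicator {0..<real n} t * ennreal (w t)) \<partial>M)"
  proof (rule nn_integral_mono_AE)
    show "AE t in M. ennreal (norm (f t * s t * w t)) \<le>
        ennreal c * (ennreal \<bar>f t\<bar> * indicator {0..<real n} t * ennreal (w t))"
      using w_pos_AE AE_space
    proof eventually_elim
      fix t assume t: "0 < w t" "t \<in> space M"
      have "norm (f t * s t * w t) \<le> c * (\<bar>f t\<bar> * indicator {0..<real n} t * w t)"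
        using bound[of t] t mult_left_mono[of "\<bar>s t\<bar>" "c * indicator {0..<real n} t" "\<bar>f t\<bar> * w t"]
        by (simp add: abs_mult mult_ac)
      then have "ennreal (norm (f t * s t * w t)) \<le> ennreal (c * (\<bar>f t\<bar> * indicator {0..<real n} t * w t))"
        by (rule ennreal_leI)
      also have "\<dots> = ennreal c * (ennreal \<bar>f t\<bar> * indicator {0..<real n} t * ennreal (w t))"
        using c t by (auto simp: ennreal_mult indicator_def)
      finally show "ennreal (norm (f t * s t * w t)) \<le>
          ennreal c * (ennreal \<bar>f t\<bar> * indicator {0..<real n} t * ennreal (w t))" .
    qed
  qed
  also have "\<dots> = ennreal c * (\<integral>\<^sup>+t. ennreal \<bar>f t\<bar> * indicator {0..<real n} t * ennreal (w t) \<partial>M)"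
    by (rule nn_integral_cmult) measurable
  finally show ?thesis .
qed

lemma pairing_ball:
  assumes s [measurable]: "s \<in> borel_measurable M" and c: "0 \<le> c"
    and bound: "\<And>t. t \<in> half_open \<gamma> \<Longrightarrow> \<bar>s t\<bar> \<le> c * indicator {0..<real n} t"
  obtains C where "0 < C"
    "\<And>f. f \<in> borel_measurable M \<Longrightarrow> \<rho> f \<le> 1 \<Longrightarrow> integrable M (\<lambda>t. f t * s t * w t) \<and> \<bar>pairing s f\<bar> \<le> C"
proof -
  obtain C0 where C0: "0 < C0" "\<And>f. f \<in> borel_measurable M \<Longrightarrow> \<rho> f \<le> 1 \<Longrightarrow>
      (\<integral>\<^sup>+t. ennreal \<bar>f t\<bar> * indicator {0..<real n} t * ennreal (w t) \<partial>M) \<le> ennreal C0"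
    using local_L1_bound[of n] by blast
  show thesis
  \<comment> \<open>The summand 1 keeps the constant positive when \<open>c = 0\<close>.\<close>
  proof (rule that[of "c * C0 + 1"])
    fix f assume f [measurable]: "f \<in> borel_measurable M" and \<rho>: "\<rho> f \<le> 1"
    have le: "(\<integral>\<^sup>+t. ennreal (norm (f t * s t * w t)) \<partial>M) \<le> ennreal (c * C0)"
    proof -
      have "(\<integral>\<^sup>+t. ennreal (norm (f t * s t * w t)) \<partial>M) \<le> ennreal c * ennreal C0"
        using pairing_norm_le[OF f s c bound] mult_left_mono[OF C0(2)[OF f \<rho>], of "ennreal c"]
        by (auto intro: order_trans)
      then show ?thesis using c C0(1) by (simp add: ennreal_mult)
    qed
    then have int: "integrable M (\<lambda>t. f t * s t * w t)"
      by (intro integrableI_bounded) (auto intro: order.strict_trans1)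
    have "ennreal (norm (pairing s f)) \<le> ennreal (c * C0)"
      unfolding pairing_def using integral_norm_bound_ennreal[OF int] le by (rule order_trans)
    then show "integrable M (\<lambda>t. f t * s t * w t) \<and> \<bar>pairing s f\<bar> \<le> c * C0 + 1"
      using int c C0(1) by simp
  qed (use c C0 in \<open>simp add: add_nonneg_pos\<close>)
qed

lemma pairing_integrable:
  assumes "s \<in> borel_measurable M" "0 \<le> c" "\<And>t. t \<in> half_open \<gamma> \<Longrightarrow> \<bar>s t\<bar> \<le> c * indicator {0..<real n} t"
    and f: "good f"
  shows "integrable M (\<lambda>t. f t * s t * w t)"
proof -
  obtain e where e: "0 < e" "\<rho> (\<lambda>t. f t / e) \<le> 1" using lux_set_nonempty[OF f] by blast
  have "integrable M (\<lambda>t. f t / e * s t * w t)"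
  proof -
    obtain C where C: "\<And>g. g \<in> borel_measurable M \<Longrightarrow> \<rho> g \<le> 1 \<Longrightarrow> integrable M (\<lambda>t. g t * s t * w t) \<and> \<bar>pairing s g\<bar> \<le> C"
      using pairing_ball[OF assms(1-3)] by blast
    have "(\<lambda>t. f t / e) \<in> borel_measurable M" using good_divide[OF f] by (simp add: good_def)
    from C[OF this e(2)] show ?thesis ..
  qed
  then have "integrable M (\<lambda>t. e * (f t / e * s t * w t))" by (rule integrable_mult_right)
  then show ?thesis using e(1) by simp
qed

lemma pairing_bound:
  assumes s: "s \<in> borel_measurable M" "0 \<le> c" "\<And>t. t \<in> half_open \<gamma> \<Longrightarrow> \<bar>s t\<bar> \<le> c * indicator {0..<real n} t"
  shows "\<exists>C. \<forall>f. good f \<longrightarrow> \<bar>pairing s f\<bar> \<le> C * lux f"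
proof -
  obtain C where C: "0 < C" "\<And>f. f \<in> borel_measurable M \<Longrightarrow> \<rho> f \<le> 1 \<Longrightarrow> \<bar>pairing s f\<bar> \<le> C"
    using pairing_ball[OF s] by metis
  have "\<bar>pairing s f\<bar> \<le> C * lux f" if f: "good f" for f
  proof (rule field_le_epsilon)
    fix d :: real assume d: "0 < d"
    define e where "e = lux f + d / C"
    have e: "lux f < e" "0 < e" using d C(1) lux_nonneg[OF f] by (auto simp: e_def add_nonneg_pos)
    have "\<bar>pairing s (\<lambda>t. f t / e)\<bar> \<le> C"
      using f e by (intro C lux_lessD) (auto simp: good_def)
    moreover have "pairing s (\<lambda>t. f t / e) = pairing s f / e"
      unfolding pairing_def by simp
    ultimately have "\<bar>pairing s f\<bar> \<le> C * e" using e(2) by (simp add: abs_divide pos_divide_le_eq)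
    then show "\<bar>pairing s f\<bar> \<le> C * lux f + d" using C(1) by (simp add: e_def distrib_left)
  qed
  then show ?thesis by blast
qed

text \<open>Vitali's argument: the difference truncated at \<open>2 * L\<close> converges by
  dominated convergence, and what lies above is controlled by the uniformly small excesses of
  \<open>u k\<close> and \<open>g\<close>.\<close>

lemma pairing_tendsto:
  assumes s [measurable]: "s \<in> borel_measurable M" and c: "0 \<le> c"
    and bound: "\<And>t. t \<in> half_open \<gamma> \<Longrightarrow> \<bar>s t\<bar> \<le> c * indicator {0..<real n} t"
    and u [measurable]: "\<And>k. u k \<in> borel_measurable M" and g [measurable]: "g \<in> borel_measurable M"
    and u1: "\<And>k. \<rho> (u k) \<le> 1" and g1: "\<rho> g \<le> 1" and lim: "AE t in M. (\<lambda>k. u k t) \<longlonglongrightarrow> g t"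
  shows "(\<lambda>k. pairing s (u k)) \<longlonglongrightarrow> pairing s g"
proof (rule LIMSEQ_I)
  fix e' :: real assume e': "0 < e'"
  \<comment> \<open>The denominator absorbs the factor \<open>c\<close> by which the bounded
    function enlarges the error and leaves half of \<open>e'\<close>; the summand 1 covers
    \<open>c = 0\<close>.\<close>
  define e where "e = e' / (2 * (c + 1))"
  have e: "0 < e" using e' c by (simp add: e_def)
  \<comment> \<open>The two excesses are then at most \<open>e / 4\<close> each, and the truncated
    part receives the remaining \<open>e / 2\<close>.\<close>
  define K where "K = 4 / e"
  have K: "0 < K" using e by (simp add: K_def)
  obtain L where L: "0 < L" "\<And>v. L \<le> v \<Longrightarrow> K * v \<le> \<phi> v" using phi_superlinear[of K] by auto
  define D where "D k = (\<integral>\<^sup>+t. ennreal \<bar>u k t - g t\<bar> * indicator {0..<real n} t * ennreal (w t) \<partial>M)" for k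
  define E where "E k = (\<integral>\<^sup>+t. ennreal (min \<bar>u k t - g t\<bar> (2 * L)) * (indicator {0..<real n} t * ennreal (w t)) \<partial>M)" for k
  have "E \<longlonglongrightarrow> (\<integral>\<^sup>+t. 0 \<partial>M)"
    unfolding E_def
  proof (rule nn_integral_dominated_convergence[where w = "\<lambda>t. ennreal (2 * L) * (indicator {0..<real n} t * ennreal (w t))"])
    show "AE t in M. ennreal (min \<bar>u k t - g t\<bar> (2 * L)) * (indicator {0..<real n} t * ennreal (w t)) \<le>
        ennreal (2 * L) * (indicator {0..<real n} t * ennreal (w t))" for k
      by (intro AE_I2 mult_right_mono ennreal_leI) auto
    show "(\<integral>\<^sup>+t. ennreal (2 * L) * (indicator {0..<real n} t * ennreal (w t)) \<partial>M) < \<infinity>"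
      using Wn_finite[of n] by (simp add: nn_integral_cmult Wn_def ennreal_mult_less_top)
    show "AE t in M. (\<lambda>k. ennreal (min \<bar>u k t - g t\<bar> (2 * L)) * (indicator {0..<real n} t * ennreal (w t))) \<longlonglongrightarrow> 0"
      using lim
    proof eventually_elim
      fix t assume "(\<lambda>k. u k t) \<longlonglongrightarrow> g t"
      then have "(\<lambda>k. min \<bar>u k t - g t\<bar> (2 * L)) \<longlonglongrightarrow> min \<bar>g t - g t\<bar> (2 * L)"
        by (intro tendsto_intros)
      then have "(\<lambda>k. ennreal (min \<bar>u k t - g t\<bar> (2 * L))) \<longlonglongrightarrow> 0"
        using L(1) by (auto dest: tendsto_ennrealI)
      then have "(\<lambda>k. (indicator {0..<real n} t * ennreal (w t)) * ennreal (min \<bar>u k t - g t\<bar> (2 * L))) \<longlonglongrightarrow>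
          (indicator {0..<real n} t * ennreal (w t)) * 0"
        by (intro ennreal_tendsto_cmult) (auto simp: indicator_def)
      then show "(\<lambda>k. ennreal (min \<bar>u k t - g t\<bar> (2 * L)) * (indicator {0..<real n} t * ennreal (w t))) \<longlonglongrightarrow> 0"
        by (simp add: mult.commute)
    qed
  qed measurable
  then have "\<forall>\<^sub>F k in sequentially. E k < ennreal (e / 2)"
    using e by (intro order_tendstoD(2)[of E 0]) auto
  then obtain k0 where k0: "\<And>k. k \<ge> k0 \<Longrightarrow> E k < ennreal (e / 2)" by (auto simp: eventually_sequentially)
  have D_le: "D k \<le> ennreal e" if "k \<ge> k0" for k
  proof -
    have "D k \<le> (\<integral>\<^sup>+t. ennreal (min \<bar>u k t - g t\<bar> (2 * L)) * (indicator {0..<real n} t * ennreal (w t)) +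
        (ennreal (max 0 (\<bar>u k t\<bar> - L)) * ennreal (w t) + ennreal (max 0 (\<bar>g t\<bar> - L)) * ennreal (w t)) \<partial>M)"
      unfolding D_def
    proof (rule nn_integral_mono)
      fix t
      \<comment> \<open>If the difference exceeds \<open>2 * L\<close>, the surplus is at most the
        sum of the amounts by which the two moduli exceed \<open>L\<close>.\<close>
      have "ennreal \<bar>u k t - g t\<bar> \<le> ennreal (min \<bar>u k t - g t\<bar> (2 * L) + (max 0 (\<bar>u k t\<bar> - L) + max 0 (\<bar>g t\<bar> - L)))"
        by (rule ennreal_leI) (auto simp: min_def max_def)
      also have "\<dots> = ennreal (min \<bar>u k t - g t\<bar> (2 * L)) + (ennreal (max 0 (\<bar>u k t\<bar> - L)) + ennreal (max 0 (\<bar>g t\<bar> - L)))"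
        using L(1) by (simp add: ennreal_plus)
      finally have "ennreal \<bar>u k t - g t\<bar> * ennreal (w t) \<le>
          (ennreal (min \<bar>u k t - g t\<bar> (2 * L)) + (ennreal (max 0 (\<bar>u k t\<bar> - L)) + ennreal (max 0 (\<bar>g t\<bar> - L)))) * ennreal (w t)"
        by (rule mult_right_mono) simp
      then show "ennreal \<bar>u k t - g t\<bar> * indicator {0..<real n} t * ennreal (w t) \<le>
          ennreal (min \<bar>u k t - g t\<bar> (2 * L)) * (indicator {0..<real n} t * ennreal (w t)) +
          (ennreal (max 0 (\<bar>u k t\<bar> - L)) * ennreal (w t) + ennreal (max 0 (\<bar>g t\<bar> - L)) * ennreal (w t))"
        by (auto simp: indicator_def distrib_right)
    qed
    also have "\<dots> = E k + ((\<integral>\<^sup>+t. ennreal (max 0 (\<bar>u k t\<bar> - L)) * ennreal (w t) \<partial>M) +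
        (\<integral>\<^sup>+t. ennreal (max 0 (\<bar>g t\<bar> - L)) * ennreal (w t) \<partial>M))"
      unfolding E_def by (simp add: nn_integral_add)
    also have "\<dots> \<le> ennreal (e / 2) + (ennreal (1 / K) + ennreal (1 / K))"
      using k0[OF that] by (intro add_mono excess_le u g u1 g1 K L) (auto intro: L)
    also have "\<dots> = ennreal e"
      using e by (simp add: K_def ennreal_plus[symmetric] del: ennreal_plus)
    finally show ?thesis .
  qed
  obtain C where int: "\<And>f. f \<in> borel_measurable M \<Longrightarrow> \<rho> f \<le> 1 \<Longrightarrow> integrable M (\<lambda>t. f t * s t * w t)"
    using pairing_ball[OF s c bound] by metis
  have "norm (pairing s (u k) - pairing s g) < e'" if "k \<ge> k0" for k
  proof -
    have eq: "pairing s (u k) - pairing s g = (LINT t|M. (u k t - g t) * s t * w t)"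
      unfolding pairing_def
      using Bochner_Integration.integral_diff[OF int[OF u u1, of k] int[OF g g1]] by (simp add: algebra_simps)
    have dint: "integrable M (\<lambda>t. (u k t - g t) * s t * w t)"
      using Bochner_Integration.integrable_diff[OF int[OF u u1, of k] int[OF g g1]] by (simp add: algebra_simps)
    have "ennreal (norm (pairing s (u k) - pairing s g)) \<le> (\<integral>\<^sup>+t. ennreal (norm ((u k t - g t) * s t * w t)) \<partial>M)"
      unfolding eq by (rule integral_norm_bound_ennreal[OF dint])
    also have "\<dots> \<le> ennreal c * D k"
      unfolding D_def using u g by (intro pairing_norm_le[OF _ s c bound]) auto
    also have "\<dots> \<le> ennreal c * ennreal e" by (intro mult_left_mono D_le that) simp
    also have "\<dots> = ennreal (c * e)" using c e by (simp add: ennreal_mult)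
    finally have "norm (pairing s (u k) - pairing s g) \<le> c * e" using c e by simp
    also have "c * e < e'"
    proof -
      have "c * e \<le> (c + 1) * e" using e by (simp add: algebra_simps)
      also have "\<dots> = e' / 2" using c by (simp add: e_def field_simps)
      finally show ?thesis using e' by simp
    qed
    finally show ?thesis .
  qed
  then show "\<exists>no. \<forall>k\<ge>no. norm (pairing s (u k) - pairing s g) < e'" by blast
qed

end

section \<open>The Orlicz-Lorentz space\<close>

lemma ae_rel_iff:
  "(f, g) \<in> ae_rel \<gamma> \<longleftrightarrow> f \<in> borel_measurable (lebesgue_on (half_open \<gamma>)) \<and>
     g \<in> borel_measurable (lebesgue_on (half_open \<gamma>)) \<and> (AE t in lebesgue_on (half_open \<gamma>). f t = g t)"
  by (simp add: ae_rel_def)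

lemma ae_class_cong:
  assumes "(f, g) \<in> ae_rel \<gamma>"
  shows "ae_class \<gamma> f = ae_class \<gamma> g"
proof -
  have "(f, k) \<in> ae_rel \<gamma> \<longleftrightarrow> (g, k) \<in> ae_rel \<gamma>" for k
    using assms unfolding ae_rel_iff by (auto elim: eventually_elim2)
  then show ?thesis unfolding ae_class_def by auto
qed

lemma rep_ae_class:
  assumes f: "f \<in> borel_measurable (lebesgue_on (half_open \<gamma>))"
  shows "(f, rep (ae_class \<gamma> f)) \<in> ae_rel \<gamma>"
proof -
  have "f \<in> ae_class \<gamma> f" using f by (simp add: ae_class_def ae_rel_iff)
  then have "rep (ae_class \<gamma> f) \<in> ae_class \<gamma> f"
    using someI[of "\<lambda>g. g \<in> ae_class \<gamma> f" f] by (simp add: rep_def)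
  then show ?thesis by (simp add: ae_class_def)
qed

lemma ae_class_L0: "f \<in> borel_measurable (lebesgue_on (half_open \<gamma>)) \<Longrightarrow> ae_class \<gamma> f \<in> L0 \<gamma>"
  unfolding L0_def ae_class_def by (rule quotientI)

lemma L0_rep:
  assumes "x \<in> L0 \<gamma>"
  shows "rep x \<in> borel_measurable (lebesgue_on (half_open \<gamma>))" "x = ae_class \<gamma> (rep x)"
proof -
  obtain f where f: "f \<in> borel_measurable (lebesgue_on (half_open \<gamma>))" "x = ae_class \<gamma> f"
    using assms unfolding L0_def ae_class_def by (auto elim: quotientE)
  show "rep x \<in> borel_measurable (lebesgue_on (half_open \<gamma>))"
    using rep_ae_class[OF f(1)] by (simp add: f(2) ae_rel_iff)
  show "x = ae_class \<gamma> (rep x)"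
    using ae_class_cong[OF rep_ae_class[OF f(1)]] by (simp add: f(2))
qed

section \<open>The normed space of equivalence classes\<close>

context orlicz_lorentz_delta2
begin

abbreviation "V \<equiv> orlicz_lorentz \<gamma> \<phi> w"
abbreviation "cls \<equiv> ae_class \<gamma>"

lemma cls_eqI: "f \<in> borel_measurable M \<Longrightarrow> g \<in> borel_measurable M \<Longrightarrow> AE t in M. f t = g t \<Longrightarrow> cls f = cls g"
  by (intro ae_class_cong) (simp add: ae_rel_iff)

lemma rep_cls:
  assumes "good f"
  shows "good (rep (cls f))" "AE t in M. rep (cls f) t = f t"
proof -
  have *: "rep (cls f) \<in> borel_measurable M" "AE t in M. f t = rep (cls f) t"
    using rep_ae_class[of f \<gamma>] assms by (auto simp: good_def ae_rel_iff)
  then show "good (rep (cls f))" using good_cong_AE[OF assms] by blast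
  show "AE t in M. rep (cls f) t = f t" using *(2) by (auto elim: eventually_mono)
qed

text \<open>The scalar in the definition of the carrier can be removed because \<open>good\<close>
  is closed under all multiples.\<close>

lemma carrier_V: "x \<in> carrier V \<longleftrightarrow> x \<in> L0 \<gamma> \<and> good (rep x)"
proof
  assume x: "x \<in> carrier V"
  then obtain l where l: "x \<in> L0 \<gamma>" "0 < l" "\<rho> (\<lambda>t. l * rep x t) < \<infinity>"
    unfolding orlicz_lorentz_def by auto
  then have "good (\<lambda>t. l * rep x t)" using L0_rep(1)[OF l(1)] by (simp add: good_def)
  then have "good (\<lambda>t. 1 / l * (l * rep x t))" by (rule good_cmult)
  then show "x \<in> L0 \<gamma> \<and> good (rep x)" using l by simp
next
  assume "x \<in> L0 \<gamma> \<and> good (rep x)"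
  then show "x \<in> carrier V"
    unfolding orlicz_lorentz_def good_def by (auto intro!: exI[of _ 1])
qed

lemma cls_carrier: "good f \<Longrightarrow> cls f \<in> carrier V"
  using rep_cls(1) ae_class_L0 by (auto simp: carrier_V good_def)

lemma carrierE:
  assumes "x \<in> carrier V"
  obtains f where "good f" "x = cls f"
  using assms L0_rep(2) that unfolding carrier_V by blast

lemma cls_add: "good f \<Longrightarrow> good g \<Longrightarrow> cls f \<oplus>\<^bsub>V\<^esub> cls g = cls (\<lambda>t. f t + g t)"
proof -
  assume fg: "good f" "good g"
  have "cls (\<lambda>t. rep (cls f) t + rep (cls g) t) = cls (\<lambda>t. f t + g t)"
  proof (rule cls_eqI)
    show "AE t in M. rep (cls f) t + rep (cls g) t = f t + g t"
      using rep_cls(2)[OF fg(1)] rep_cls(2)[OF fg(2)] by eventually_elim simp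
  qed (use fg in \<open>auto intro!: good_measurable good_add rep_cls(1)\<close>)
  then show ?thesis by (simp add: orlicz_lorentz_def)
qed

lemma cls_smult: "good f \<Longrightarrow> a \<odot>\<^bsub>V\<^esub> cls f = cls (\<lambda>t. a * f t)"
proof -
  assume f: "good f"
  have "cls (\<lambda>t. a * rep (cls f) t) = cls (\<lambda>t. a * f t)"
  proof (rule cls_eqI)
    show "AE t in M. a * rep (cls f) t = a * f t"
      using rep_cls(2)[OF f] by eventually_elim simp
  qed (use f in \<open>auto intro!: good_measurable good_cmult rep_cls(1)\<close>)
  then show ?thesis by (simp add: orlicz_lorentz_def)
qed

lemma cls_zero: "\<zero>\<^bsub>V\<^esub> = cls (\<lambda>_. 0)"
  by (simp add: orlicz_lorentz_def)

lemma nrm_V: "nrm V x = lux (rep x)"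
  by (simp add: orlicz_lorentz_def lux_def)

lemma nrm_cls: "good f \<Longrightarrow> nrm V (cls f) = lux f"
  unfolding nrm_V using rep_cls by (intro lux_cong_AE) (auto simp: good_def)

lemma V_normed: "normed_vector_space V"
proof (rule normed_vector_spaceI)
  fix x assume "x \<in> carrier V"
  then obtain f where f: "good f" "x = cls f" by (rule carrierE)
  note [simp] = f cls_add cls_smult cls_zero nrm_cls good_cmult good_add good_0 cls_carrier
  show "a \<odot>\<^bsub>V\<^esub> x \<in> carrier V" for a by simp
  show "\<zero>\<^bsub>V\<^esub> \<oplus>\<^bsub>V\<^esub> x = x" by simp
  show "(-1) \<odot>\<^bsub>V\<^esub> x \<oplus>\<^bsub>V\<^esub> x = \<zero>\<^bsub>V\<^esub>"
    using good_cmult[OF f(1), of "-1"] by (simp add: cls_add[of "\<lambda>t. - f t"])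
  show "(a + b) \<odot>\<^bsub>V\<^esub> x = a \<odot>\<^bsub>V\<^esub> x \<oplus>\<^bsub>V\<^esub> b \<odot>\<^bsub>V\<^esub> x" for a b by (simp add: distrib_right)
  show "(a * b) \<odot>\<^bsub>V\<^esub> x = a \<odot>\<^bsub>V\<^esub> (b \<odot>\<^bsub>V\<^esub> x)" for a b by (simp add: mult.assoc)
  show "1 \<odot>\<^bsub>V\<^esub> x = x" by simp
  show "0 \<le> nrm V x" by (simp add: lux_nonneg)
  show "nrm V x = 0 \<longleftrightarrow> x = \<zero>\<^bsub>V\<^esub>"
  proof
    assume "nrm V x = 0"
    then have "AE t in M. f t = 0" using lux_eq_0D[OF f(1)] by simp
    then show "x = \<zero>\<^bsub>V\<^esub>"
      unfolding f(2) cls_zero by (intro cls_eqI good_measurable f good_0)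
  next
    assume "x = \<zero>\<^bsub>V\<^esub>"
    then have "nrm V x = nrm V (cls (\<lambda>_. 0))" by simp
    also have "\<dots> = 0" by (subst nrm_cls) auto
    finally show "nrm V x = 0" .
  qed
  show "nrm V (a \<odot>\<^bsub>V\<^esub> x) = \<bar>a\<bar> * nrm V x" for a by (simp add: lux_cmult)
  fix y assume "y \<in> carrier V"
  then obtain g where g: "good g" "y = cls g" by (rule carrierE)
  note [simp] = g
  show "x \<oplus>\<^bsub>V\<^esub> y \<in> carrier V" by simp
  show "x \<oplus>\<^bsub>V\<^esub> y = y \<oplus>\<^bsub>V\<^esub> x" by (simp add: add.commute)
  show "a \<odot>\<^bsub>V\<^esub> (x \<oplus>\<^bsub>V\<^esub> y) = a \<odot>\<^bsub>V\<^esub> x \<oplus>\<^bsub>V\<^esub> a \<odot>\<^bsub>V\<^esub> y" for a by (simp add: distrib_left)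
  show "nrm V (x \<oplus>\<^bsub>V\<^esub> y) \<le> nrm V x + nrm V y" by (simp add: lux_add)
  fix z assume "z \<in> carrier V"
  then obtain h where h: "good h" "z = cls h" by (rule carrierE)
  show "(x \<oplus>\<^bsub>V\<^esub> y) \<oplus>\<^bsub>V\<^esub> z = x \<oplus>\<^bsub>V\<^esub> (y \<oplus>\<^bsub>V\<^esub> z)" by (simp add: h add.assoc)
next
  show "\<zero>\<^bsub>V\<^esub> \<in> carrier V" by (simp add: cls_zero cls_carrier good_0)
qed

sublocale V: normed_space V
  by unfold_locales (rule V_normed)

lemma cls_minus: "good f \<Longrightarrow> good g \<Longrightarrow> cls f \<ominus>\<^bsub>V\<^esub> cls g = cls (\<lambda>t. f t - g t)"
  using good_cmult[of g "-1"] by (subst V.minus_eq_smult) (simp_all add: cls_carrier cls_smult cls_add)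

section \<open>Density of step functions\<close>

lemma step_fun_measurable_M [measurable]: "step_fun i \<in> borel_measurable M"
  by (rule borel_imp_measurable_M) measurable

lemma half_open_nonneg: "half_open \<gamma> \<subseteq> {0..}"
  by (auto simp: half_open_def)

text \<open>Order continuity is used twice: to cut \<open>f\<close> off in height and support, and
  to pass from almost everywhere approximation of the cut-off function by dominated step functions
  to norm approximation.\<close>

lemma step_fun_dense:
  assumes f: "good f" and e: "0 < e"
  shows "\<exists>i. good (step_fun i) \<and> lux (\<lambda>t. f t - step_fun i t) < e"
proof -
  have [measurable]: "f \<in> borel_measurable M" using f by (simp add: good_def)
  define fn where "fn n t = (if \<bar>f t\<bar> \<le> real n \<and> t < real n then f t else 0)" for n :: nat and t
  have [measurable]: "(\<lambda>t. t) \<in> borel_measurable M" by (rule borel_imp_measurable_M) simp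
  have fn_meas [measurable]: "fn n \<in> borel_measurable M" for n unfolding fn_def by measurable
  have "\<exists>n. lux (\<lambda>t. f t - fn n t) \<le> e / 3"
  proof (rule lux_vanishing[OF f])
    show "AE t in M. \<bar>f t - fn n t\<bar> \<le> \<bar>f t\<bar>" for n by (auto simp: fn_def)
    show "AE t in M. (\<lambda>n. f t - fn n t) \<longlonglongrightarrow> 0"
    proof (rule AE_I2)
      fix t
      obtain m :: nat where m: "max \<bar>f t\<bar> (t + 1) \<le> real m" using real_arch_simple by blast
      have "f t - fn n t = 0" if "n \<ge> m" for n using m that unfolding fn_def by auto
      then show "(\<lambda>n. f t - fn n t) \<longlonglongrightarrow> 0"
        by (intro tendsto_eventually) (auto simp: eventually_sequentially)
    qed
  qed (use e in auto)
  then obtain n where n: "lux (\<lambda>t. f t - fn n t) \<le> e / 3" by blast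
  have fn_bound: "\<bar>fn n t\<bar> \<le> real n * indicator {0..<real n} t" if "t \<in> half_open \<gamma>" for t
    using that half_open_nonneg by (auto simp: fn_def)
  obtain k where k: "AE t in M. (\<lambda>j. step_fun (k j) t) \<longlonglongrightarrow> fn n t"
      "\<And>j t. t \<in> half_open \<gamma> \<Longrightarrow> \<bar>step_fun (k j) t\<bar> \<le> (\<bar>real n\<bar> + 1) * indicator {0..<real n} t"
    using step_fun_AE_approx[OF half_open_lebesgue fn_meas half_open_nonneg fn_bound] by blast
  have good_fn: "good (fn n)"
    by (rule good_mono[OF f]) (auto simp: fn_def)
  have good_step: "good (step_fun (k j))" for j
  proof (rule good_mono[OF good_bounded[of "real n + 1" n]])
    show "AE t in M. \<bar>step_fun (k j) t\<bar> \<le> \<bar>(real n + 1) * indicator {0..<real n} t\<bar>"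
    proof (rule AE_I2)
      fix t assume "t \<in> space M"
      then show "\<bar>step_fun (k j) t\<bar> \<le> \<bar>(real n + 1) * indicator {0..<real n} t\<bar>"
        using k(2)[of t j] by (simp add: abs_mult)
    qed
  qed (rule step_fun_measurable_M)
  have "\<exists>j. lux (\<lambda>t. fn n t - step_fun (k j) t) \<le> e / 3"
  proof (rule lux_vanishing[OF good_bounded[of "2 * real n + 1" n]])
    show "AE t in M. \<bar>fn n t - step_fun (k j) t\<bar> \<le> \<bar>(2 * real n + 1) * indicator {0..<real n} t\<bar>" for j
    proof (rule AE_I2)
      fix t assume "t \<in> space M"
      then have "\<bar>fn n t\<bar> \<le> real n * indicator {0..<real n} t"
          "\<bar>step_fun (k j) t\<bar> \<le> (real n + 1) * indicator {0..<real n} t"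
        using fn_bound[of t] k(2)[of t j] by auto
      then show "\<bar>fn n t - step_fun (k j) t\<bar> \<le> \<bar>(2 * real n + 1) * indicator {0..<real n} t\<bar>"
        by (auto simp: indicator_def split: if_splits)
    qed
    show "AE t in M. (\<lambda>j. fn n t - step_fun (k j) t) \<longlonglongrightarrow> 0"
      using k(1)
    proof eventually_elim
      fix t assume "(\<lambda>j. step_fun (k j) t) \<longlonglongrightarrow> fn n t"
      then have "(\<lambda>j. fn n t - step_fun (k j) t) \<longlonglongrightarrow> fn n t - fn n t" by (intro tendsto_intros)
      then show "(\<lambda>j. fn n t - step_fun (k j) t) \<longlonglongrightarrow> 0" by simp
    qed
  qed (use e in auto)
  then obtain j where j: "lux (\<lambda>t. fn n t - step_fun (k j) t) \<le> e / 3" by blast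
  have "lux (\<lambda>t. (f t - fn n t) + (fn n t - step_fun (k j) t)) \<le> e / 3 + e / 3"
    using lux_add[OF good_diff[OF f good_fn] good_diff[OF good_fn good_step[of j]]] n j by linarith
  then have "lux (\<lambda>t. f t - step_fun (k j) t) < e" using e by simp
  then show ?thesis using good_step by blast
qed

lemma V_separable: "separable_normed V"
  unfolding V.separable_normed_iff
proof (intro exI conjI ballI allI impI)
  let ?D = "cls ` step_fun ` {i. good (step_fun i)}"
  show "countable ?D" by auto
  show "?D \<subseteq> carrier V" using cls_carrier by auto
  fix x and e :: real assume x: "x \<in> carrier V" and e: "0 < e"
  obtain f where f: "good f" "x = cls f" using x by (rule carrierE)
  obtain i where i: "good (step_fun i)" "lux (\<lambda>t. f t - step_fun i t) < e"
    using step_fun_dense[OF f(1) e] by blast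
  then have "nrm V (x \<ominus>\<^bsub>V\<^esub> cls (step_fun i)) < e"
    using f good_diff by (simp add: cls_minus nrm_cls)
  then show "\<exists>y\<in>?D. nrm V (x \<ominus>\<^bsub>V\<^esub> y) < e" using i(1) by blast
qed

section \<open>The separating functionals and compactness of the ball\<close>

definition p :: "nat \<Rightarrow> (real \<Rightarrow> real) set \<Rightarrow> real" where
  "p i x = pairing (step_fun i) (rep x)"

lemma pairing_cong_AE:
  assumes "AE t in M. f t = g t" "f \<in> borel_measurable M" "g \<in> borel_measurable M" "s \<in> borel_measurable M"
  shows "pairing s f = pairing s g"
  unfolding pairing_def using assms by (intro integral_cong_AE) (auto elim!: eventually_mono)

lemma p_cls: "good f \<Longrightarrow> p i (cls f) = pairing (step_fun i) f"
  unfolding p_def using rep_cls by (intro pairing_cong_AE) (auto simp: good_def)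

lemma step_pairing_integrable: "good f \<Longrightarrow> integrable M (\<lambda>t. f t * step_fun i t * w t)"
proof -
  assume f: "good f"
  obtain c n where c: "0 \<le> c" "\<And>t. \<bar>step_fun i t\<bar> \<le> c * indicator {0..<real n} t"
    using step_fun_bounded by blast
  show ?thesis by (rule pairing_integrable[OF _ c f]) measurable
qed

lemma p_bounded_functional: "bounded_functional V (p i)"
proof -
  obtain c n where c: "0 \<le> c" "\<And>t. \<bar>step_fun i t\<bar> \<le> c * indicator {0..<real n} t"
    using step_fun_bounded by blast
  obtain C where C: "\<And>f. good f \<Longrightarrow> \<bar>pairing (step_fun i) f\<bar> \<le> C * lux f"
    using pairing_bound[OF step_fun_measurable_M c] by blast
  have "p i (x \<oplus>\<^bsub>V\<^esub> y) = p i x + p i y" if "x \<in> carrier V" "y \<in> carrier V" for x y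
  proof -
    obtain f where "good f" "x = cls f" using \<open>x \<in> carrier V\<close> by (rule carrierE)
    moreover obtain g where "good g" "y = cls g" using \<open>y \<in> carrier V\<close> by (rule carrierE)
    ultimately have fg: "good f" "x = cls f" "good g" "y = cls g" by auto
    have "pairing (step_fun i) (\<lambda>t. f t + g t) = pairing (step_fun i) f + pairing (step_fun i) g"
      unfolding pairing_def using step_pairing_integrable[OF fg(1)] step_pairing_integrable[OF fg(3)]
      by (simp add: distrib_right)
    then show ?thesis using fg good_add by (simp add: cls_add p_cls)
  qed
  moreover have "p i (a \<odot>\<^bsub>V\<^esub> x) = a * p i x" if x: "x \<in> carrier V" for a x
  proof -
    obtain f where f: "good f" "x = cls f" using x by (rule carrierE)
    have "pairing (step_fun i) (\<lambda>t. a * f t) = a * pairing (step_fun i) f"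
      unfolding pairing_def by (simp add: mult.assoc)
    then show ?thesis using f good_cmult by (simp add: cls_smult p_cls)
  qed
  moreover have "\<bar>p i x\<bar> \<le> C * nrm V x" if "x \<in> carrier V" for x
    using that C by (auto simp: p_def nrm_V carrier_V)
  ultimately show ?thesis unfolding bounded_functional_def by blast
qed

text \<open>The sign of \<open>f\<close> on \<open>[0, n)\<close> is an almost everywhere limit of
  dominated step functions, so the weighted integral of \<open>\<bar>f t\<bar>\<close> over
  \<open>[0, n)\<close> is zero. The weight is positive almost everywhere.\<close>

lemma p_separating:
  assumes x: "x \<in> carrier V" and 0: "\<And>i. p i x = 0"
  shows "x = \<zero>\<^bsub>V\<^esub>"
proof -
  obtain f where f: "good f" "x = cls f" using x by (rule carrierE)
  have [measurable]: "f \<in> borel_measurable M" using f by (simp add: good_def)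
  have pair0: "pairing (step_fun i) f = 0" for i using 0[of i] f by (simp add: p_cls)
  have "AE t in M. t < real n \<longrightarrow> f t = 0" for n
  proof -
    define h where "h t = sgn (f t) * indicator {0..<real n} t" for t
    have h_meas [measurable]: "h \<in> borel_measurable M" unfolding h_def by measurable
    have h_bound: "\<bar>h t\<bar> \<le> 1 * indicator {0..<real n} t" if "t \<in> half_open \<gamma>" for t
      by (auto simp: h_def abs_mult sgn_if indicator_def)
    obtain k where k: "AE t in M. (\<lambda>j. step_fun (k j) t) \<longlonglongrightarrow> h t"
        "\<And>j t. t \<in> half_open \<gamma> \<Longrightarrow> \<bar>step_fun (k j) t\<bar> \<le> (\<bar>1\<bar> + 1) * indicator {0..<real n} t"
      using step_fun_AE_approx[OF half_open_lebesgue h_meas half_open_nonneg h_bound] by blast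
    have int: "integrable M (\<lambda>t. f t * indicator {0..<real n} t * w t)"
      by (rule pairing_integrable[OF _ _ _ f(1), of _ 1 n]) auto
    have "(\<lambda>j. LINT t|M. f t * step_fun (k j) t * w t) \<longlonglongrightarrow> (LINT t|M. f t * h t * w t)"
    proof (rule integral_dominated_convergence[where w = "\<lambda>t. 2 * \<bar>f t * indicator {0..<real n} t * w t\<bar>"])
      show "integrable M (\<lambda>t. 2 * \<bar>f t * indicator {0..<real n} t * w t\<bar>)"
        using int by auto
      show "AE t in M. (\<lambda>j. f t * step_fun (k j) t * w t) \<longlonglongrightarrow> f t * h t * w t"
        using k(1) by eventually_elim (intro tendsto_intros)
      show "AE t in M. norm (f t * step_fun (k j) t * w t) \<le> 2 * \<bar>f t * indicator {0..<real n} t * w t\<bar>" for j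
      proof (rule AE_I2)
        fix t assume "t \<in> space M"
        then have "\<bar>f t\<bar> * \<bar>w t\<bar> * \<bar>step_fun (k j) t\<bar> \<le> \<bar>f t\<bar> * \<bar>w t\<bar> * (2 * indicator {0..<real n} t)"
          using k(2)[of t j] by (intro mult_left_mono) auto
        then show "norm (f t * step_fun (k j) t * w t) \<le> 2 * \<bar>f t * indicator {0..<real n} t * w t\<bar>"
          by (simp add: abs_mult mult_ac)
      qed
    qed measurable
    then have "(LINT t|M. f t * h t * w t) = 0"
      using pair0 unfolding pairing_def by (simp add: LIMSEQ_const_iff)
    moreover have eq: "f t * h t * w t = \<bar>f t\<bar> * indicator {0..<real n} t * w t" for t
      by (simp add: h_def sgn_if)
    moreover have "integrable M (\<lambda>t. \<bar>f t\<bar> * indicator {0..<real n} t * w t)"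
    proof (rule Bochner_Integration.integrable_bound[OF int])
      show "AE t in M. norm (\<bar>f t\<bar> * indicator {0..<real n} t * w t) \<le> norm (f t * indicator {0..<real n} t * w t)"
        by (simp add: abs_mult)
    qed measurable
    moreover have "AE t in M. 0 \<le> \<bar>f t\<bar> * indicator {0..<real n} t * w t"
      using w_pos_AE by eventually_elim simp
    ultimately have "AE t in M. \<bar>f t\<bar> * indicator {0..<real n} t * w t = 0"
      by (simp add: integral_nonneg_eq_0_iff_AE)
    then show ?thesis using w_pos_AE AE_space
    proof eventually_elim
      fix t assume "\<bar>f t\<bar> * indicator {0..<real n} t * w t = 0" "0 < w t" "t \<in> space M"
      then show "t < real n \<longrightarrow> f t = 0" using half_open_nonneg by (auto simp: indicator_def)
    qed
  qed
  then have "AE t in M. \<forall>n. t < real n \<longrightarrow> f t = 0" by (subst AE_all_countable) blast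
  then have "AE t in M. f t = 0"
    by eventually_elim (metis reals_Archimedean2)
  then show ?thesis
    unfolding f(2) cls_zero by (intro cls_eqI) auto
qed

text \<open>The convergence theorem for convex combinations asks for a finite measure with a uniform
  L^1 bound, whereas the estimates are local. The measure is a weighted sum of \<open>w\<close> over
  the intervals \<open>[0, n)\<close>; its density is positive almost everywhere, so no exceptional
  set is lost on the way back to \<open>M\<close>.\<close>

lemma exists_control_measure:
  obtains \<mu> where "finite_measure \<mu>" "sets \<mu> = sets M" "\<And>P. AE t in \<mu>. P t \<Longrightarrow> AE t in M. P t"
    "\<And>f. f \<in> borel_measurable M \<Longrightarrow> \<rho> f \<le> 1 \<Longrightarrow> (\<integral>\<^sup>+t. ennreal \<bar>f t\<bar> \<partial>\<mu>) \<le> ennreal 2"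
proof -
  have "\<forall>n. \<exists>C. 0 < C \<and> (\<forall>f. f \<in> borel_measurable M \<longrightarrow> \<rho> f \<le> 1 \<longrightarrow>
      (\<integral>\<^sup>+t. ennreal \<bar>f t\<bar> * indicator {0..<real n} t * ennreal (w t) \<partial>M) \<le> ennreal C)"
    using local_L1_bound by metis
  from choice[OF this] obtain C where C: "\<And>n. 0 < C n" "\<And>n f. f \<in> borel_measurable M \<Longrightarrow> \<rho> f \<le> 1 \<Longrightarrow>
      (\<integral>\<^sup>+t. ennreal \<bar>f t\<bar> * indicator {0..<real n} t * ennreal (w t) \<partial>M) \<le> ennreal (C n)"
    by blast
  \<comment> \<open>\<open>C n\<close> normalises the integrals of functions of modular at most 1
    and \<open>Wn n\<close> the total mass; after division by their sum, the bound 2 is that of the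
    geometric series.\<close>
  define a where "a n = (1 / 2) ^ n / (C n + enn2real (Wn n))" for n
  have a_pos: "0 < a n" for n using C(1)[of n] by (simp add: a_def add_pos_nonneg)
  have a_le: "a n * x \<le> (1 / 2) ^ n" if "x \<le> C n + enn2real (Wn n)" for n x
  proof -
    have pos: "0 < C n + enn2real (Wn n)" using C(1)[of n] by (simp add: add_pos_nonneg)
    have "a n * x \<le> a n * (C n + enn2real (Wn n))"
      using that a_pos[of n] by (intro mult_left_mono) auto
    also have "\<dots> = (1 / 2) ^ n" using pos by (simp add: a_def)
    finally show ?thesis .
  qed
  define k where "k t = (\<Sum>n. ennreal (a n) * (indicator {0..<real n} t * ennreal (w t)))" for t
  have k_meas [measurable]: "k \<in> borel_measurable M" unfolding k_def by measurable
  have series: "(\<integral>\<^sup>+t. k t * g t \<partial>M) \<le> ennreal 2"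
    if [measurable]: "g \<in> borel_measurable M"
      and le: "\<And>n. (\<integral>\<^sup>+t. g t * indicator {0..<real n} t * ennreal (w t) \<partial>M) \<le> ennreal (C n + enn2real (Wn n))" for g
  proof -
    have "(\<integral>\<^sup>+t. k t * g t \<partial>M) = (\<integral>\<^sup>+t. (\<Sum>n. ennreal (a n) * (g t * indicator {0..<real n} t * ennreal (w t))) \<partial>M)"
      unfolding k_def by (intro nn_integral_cong) (simp add: ennreal_suminf_multc[symmetric] mult_ac)
    also have "\<dots> = (\<Sum>n. \<integral>\<^sup>+t. ennreal (a n) * (g t * indicator {0..<real n} t * ennreal (w t)) \<partial>M)"
      by (intro nn_integral_suminf) measurable
    also have "\<dots> \<le> (\<Sum>n. ennreal ((1 / 2) ^ n))"
    proof (intro suminf_le summableI)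
      fix n
      have "(\<integral>\<^sup>+t. ennreal (a n) * (g t * indicator {0..<real n} t * ennreal (w t)) \<partial>M) =
          ennreal (a n) * (\<integral>\<^sup>+t. g t * indicator {0..<real n} t * ennreal (w t) \<partial>M)"
        by (rule nn_integral_cmult) measurable
      also have "\<dots> \<le> ennreal (a n) * ennreal (C n + enn2real (Wn n))"
        by (intro mult_left_mono le) simp
      also have "\<dots> \<le> ennreal ((1 / 2) ^ n)"
        using a_le[of "C n + enn2real (Wn n)" n] a_pos[of n] C(1)[of n]
        by (subst ennreal_mult[symmetric]) (auto intro!: ennreal_leI add_nonneg_nonneg simp: less_imp_le)
      finally show "(\<integral>\<^sup>+t. ennreal (a n) * (g t * indicator {0..<real n} t * ennreal (w t)) \<partial>M) \<le> ennreal ((1 / 2) ^ n)" .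
    qed
    also have "\<dots> = ennreal (\<Sum>n. (1 / 2) ^ n)"
      by (intro suminf_ennreal2 summable_geometric) auto
    also have "(\<Sum>n. (1 / 2 :: real) ^ n) = 2" by (simp add: suminf_geometric)
    finally show ?thesis .
  qed
  define \<mu> where "\<mu> = density M k"
  show thesis
  proof (rule that[of \<mu>])
    show "finite_measure \<mu>"
    proof
      have "emeasure \<mu> (space \<mu>) = (\<integral>\<^sup>+t. k t * 1 \<partial>M)"
        unfolding \<mu>_def by (subst emeasure_density) (auto intro!: nn_integral_cong simp: indicator_def)
      also have "\<dots> \<le> ennreal 2"
      proof (rule series)
        fix n
        have "(\<integral>\<^sup>+t. 1 * indicator {0..<real n} t * ennreal (w t) \<partial>M) = ennreal (enn2real (Wn n))"
          using Wn_finite[of n] by (simp add: Wn_def less_top)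
        then show "(\<integral>\<^sup>+t. 1 * indicator {0..<real n} t * ennreal (w t) \<partial>M) \<le> ennreal (C n + enn2real (Wn n))"
          using C(1)[of n] by (simp add: ennreal_leI)
      qed simp
      finally show "emeasure \<mu> (space \<mu>) \<noteq> \<infinity>" by (auto simp: top_unique)
    qed
    show "sets \<mu> = sets M" by (simp add: \<mu>_def)
    show "AE t in M. P t" if "AE t in \<mu>. P t" for P
    proof -
      have "AE t in M. 0 < k t \<longrightarrow> P t" using that unfolding \<mu>_def by (simp add: AE_density)
      then show ?thesis using w_pos_AE AE_space
      proof eventually_elim
        fix t assume P: "0 < k t \<longrightarrow> P t" and t: "0 < w t" "t \<in> space M"
        obtain n where n: "t < real n" using reals_Archimedean2 by blast
        have "0 < ennreal (a n) * (indicator {0..<real n} t * ennreal (w t))"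
          using n t a_pos[of n] half_open_nonneg by (auto simp: ennreal_zero_less_mult_iff)
        also have "\<dots> \<le> k t"
          unfolding k_def using sum_le_suminf[of "\<lambda>n. ennreal (a n) * (indicator {0..<real n} t * ennreal (w t))" "{n}"]
          by (auto intro: summableI)
        finally show "P t" using P by blast
      qed
    qed
    fix f assume f [measurable]: "f \<in> borel_measurable M" and \<rho>: "\<rho> f \<le> 1"
    have "(\<integral>\<^sup>+t. ennreal \<bar>f t\<bar> \<partial>\<mu>) = (\<integral>\<^sup>+t. k t * ennreal \<bar>f t\<bar> \<partial>M)"
      unfolding \<mu>_def by (subst nn_integral_density) auto
    also have "\<dots> \<le> ennreal 2"
    proof (rule series)
      fix n
      show "(\<integral>\<^sup>+t. ennreal \<bar>f t\<bar> * indicator {0..<real n} t * ennreal (w t) \<partial>M) \<le> ennreal (C n + enn2real (Wn n))"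
        using C(2)[OF f \<rho>, of n] by (rule order_trans) (simp add: ennreal_leI)
    qed measurable
    finally show "(\<integral>\<^sup>+t. ennreal \<bar>f t\<bar> \<partial>\<mu>) \<le> ennreal 2" .
  qed
qed

text \<open>The subsequence is chosen before convex combinations are taken. All functionals then
  converge along it already, so the combinations serve only to produce a function with these limits
  as its values; the original subsequence need not converge almost everywhere.\<close>

lemma V_ball_compact:
  assumes x: "\<And>n. x n \<in> carrier V" and x1: "\<And>n. nrm V (x n) \<le> 1"
  shows "\<exists>r v. strict_mono (r :: nat \<Rightarrow> nat) \<and> v \<in> carrier V \<and> nrm V v \<le> 1 \<and>
            (\<forall>i. (\<lambda>n. p i (x (r n))) \<longlonglongrightarrow> p i v)"
proof -
  define f where "f n = rep (x n)" for n
  have good_f: "good (f n)" for n using x by (simp add: f_def carrier_V)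
  have f [measurable]: "f n \<in> borel_measurable M" for n using good_f by (simp add: good_def)
  have f1: "\<rho> (f n) \<le> 1" for n
    using lux_leD[OF good_f[of n], of 1] x1[of n] by (simp add: f_def nrm_V)
  have "\<exists>C. \<forall>g. g \<in> borel_measurable M \<longrightarrow> \<rho> g \<le> 1 \<longrightarrow>
      integrable M (\<lambda>t. g t * step_fun i t * w t) \<and> \<bar>pairing (step_fun i) g\<bar> \<le> C" for i
  proof -
    obtain c n where c: "0 \<le> c" "\<And>t. \<bar>step_fun i t\<bar> \<le> c * indicator {0..<real n} t"
      using step_fun_bounded by blast
    then show ?thesis using pairing_ball[OF step_fun_measurable_M c] by metis
  qed
  then obtain C where C: "\<And>i g. g \<in> borel_measurable M \<Longrightarrow> \<rho> g \<le> 1 \<Longrightarrow>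
      integrable M (\<lambda>t. g t * step_fun i t * w t) \<and> \<bar>pairing (step_fun i) g\<bar> \<le> C i"
    by metis
  have "\<bar>pairing (step_fun i) (f n)\<bar> \<le> C i" for n i using C[OF f f1] by blast
  then obtain r l where r: "strict_mono (r :: nat \<Rightarrow> nat)"
    and l: "\<And>i. (\<lambda>n. pairing (step_fun i) (f (r n))) \<longlonglongrightarrow> l i"
    using diagonal_convergent_subsequence[of "\<lambda>n i. pairing (step_fun i) (f n)" C] by blast
  define F where "F n = f (r n)" for n
  obtain \<mu> where \<mu>: "finite_measure \<mu>" "sets \<mu> = sets M" "\<And>P. AE t in \<mu>. P t \<Longrightarrow> AE t in M. P t"
    "\<And>f. f \<in> borel_measurable M \<Longrightarrow> \<rho> f \<le> 1 \<Longrightarrow> (\<integral>\<^sup>+t. ennreal \<bar>f t\<bar> \<partial>\<mu>) \<le> ennreal 2"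
    using exists_control_measure by blast
  have meas_eq: "borel_measurable \<mu> = borel_measurable M"
    using \<mu>(2) by (rule measurable_cong_sets) simp
  have F_meas: "F n \<in> borel_measurable \<mu>" and F_le: "(\<integral>\<^sup>+t. ennreal \<bar>F n t\<bar> \<partial>\<mu>) \<le> ennreal 2" for n
    unfolding meas_eq using f f1 \<mu>(4) by (auto simp: F_def)
  have "\<exists>g h. (\<forall>n. g n \<in> tail_hull F n) \<and> h \<in> borel_measurable \<mu> \<and> (AE t in \<mu>. (\<lambda>n. g n t) \<longlonglongrightarrow> h t)"
    by (rule tail_hull_AE_convergent[of \<mu> F 2, OF \<mu>(1) F_meas F_le]) blast
  then obtain g h where g: "\<And>n. g n \<in> tail_hull F n" and h: "h \<in> borel_measurable \<mu>"
    and gh: "AE t in \<mu>. (\<lambda>n. g n t) \<longlonglongrightarrow> h t" by blast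
  have h [measurable]: "h \<in> borel_measurable M" using h by (simp add: meas_eq)
  have gh: "AE t in M. (\<lambda>n. g n t) \<longlonglongrightarrow> h t" by (rule \<mu>(3)[OF gh])
  have hull: "u \<in> borel_measurable M \<and> \<rho> u \<le> 1" if "u \<in> tail_hull F n" for u n
    using that
  proof induction
    case (base k)
    then show ?case using f f1 by (simp add: F_def)
  next
    case (midpoint u v)
    then have [measurable]: "u \<in> borel_measurable M" "v \<in> borel_measurable M" by auto
    have "\<rho> (\<lambda>t. (u t + v t) / 2) = \<rho> (\<lambda>t. (1 - 1 / 2) * u t + 1 / 2 * v t)"
      by (simp add: add_divide_distrib)
    also have "\<dots> \<le> ennreal (1 - 1 / 2) * \<rho> u + ennreal (1 / 2) * \<rho> v"
      by (rule rho_convex) auto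
    also have "\<dots> \<le> ennreal (1 - 1 / 2) * 1 + ennreal (1 / 2) * 1"
      using midpoint by (intro add_mono mult_left_mono) auto
    also have "\<dots> = ennreal (1 / 2 + 1 / 2)" by (subst ennreal_plus) auto
    finally show ?case by simp
  qed
  have g_meas [measurable]: "g n \<in> borel_measurable M" and g1: "\<rho> (g n) \<le> 1" for n using hull[OF g] by auto
  have "\<rho> h \<le> liminf (\<lambda>n. \<rho> (g n))" by (rule rho_liminf[OF g_meas h gh])
  also have "\<dots> \<le> liminf (\<lambda>n. 1)" by (intro Liminf_mono always_eventually allI g1)
  finally have h1: "\<rho> h \<le> 1" by (simp add: Liminf_const)
  then have good_h: "good h" using h by (auto simp: good_def intro: order.strict_trans1)
  have "pairing (step_fun i) h = l i" for i
  proof (rule LIMSEQ_unique)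
    obtain c n where c: "0 \<le> c" "\<And>t. \<bar>step_fun i t\<bar> \<le> c * indicator {0..<real n} t"
      using step_fun_bounded by blast
    show "(\<lambda>k. pairing (step_fun i) (g k)) \<longlonglongrightarrow> pairing (step_fun i) h"
      by (rule pairing_tendsto[OF step_fun_measurable_M c g_meas h g1 h1 gh])
    \<comment> \<open>An interval around \<open>l i\<close> is convex, so an estimate valid on a
      whole tail passes to its hull.\<close>
    have close: "\<bar>pairing (step_fun i) u - l i\<bar> \<le> e"
      if u: "u \<in> tail_hull F m" and e: "\<And>k. k \<ge> m \<Longrightarrow> \<bar>pairing (step_fun i) (F k) - l i\<bar> \<le> e" for u m e
      using u
    proof induction
      case (base k)
      then show ?case using e by simp
    next
      case (midpoint u v)
      have int: "integrable M (\<lambda>t. u t * step_fun i t * w t)" "integrable M (\<lambda>t. v t * step_fun i t * w t)"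
        using C hull[OF midpoint.hyps(1)] hull[OF midpoint.hyps(2)] by blast+
      have "pairing (step_fun i) (\<lambda>t. (u t + v t) / 2) = (pairing (step_fun i) u + pairing (step_fun i) v) / 2"
        using Bochner_Integration.integral_add[OF int] unfolding pairing_def
        by (simp add: distrib_right)
      then show ?case using midpoint.IH by (auto simp: abs_le_iff field_simps)
    qed
    show "(\<lambda>k. pairing (step_fun i) (g k)) \<longlonglongrightarrow> l i"
    proof (rule LIMSEQ_I)
      fix e :: real assume e: "0 < e"
      then obtain m where m: "\<And>k. k \<ge> m \<Longrightarrow> \<bar>pairing (step_fun i) (F k) - l i\<bar> < e / 2"
        using LIMSEQ_D[OF l[of i], of "e / 2"] by (auto simp: F_def)
      have "norm (pairing (step_fun i) (g k) - l i) < e" if "k \<ge> m" for k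
      proof -
        have "g k \<in> tail_hull F m" using g[of k] tail_hull_antimono[OF that] by blast
        then have "\<bar>pairing (step_fun i) (g k) - l i\<bar> \<le> e / 2"
          by (rule close[OF _ less_imp_le[OF m]])
        then show ?thesis using e by simp
      qed
      then show "\<exists>no. \<forall>k\<ge>no. norm (pairing (step_fun i) (g k) - l i) < e" by blast
    qed
  qed
  then have "(\<lambda>n. p i (x (r n))) \<longlonglongrightarrow> p i (cls h)" for i
    using l[of i] good_h by (simp add: p_cls p_def[of i "x _"] f_def)
  moreover have "nrm V (cls h) \<le> 1"
    using good_h h1 by (simp add: nrm_cls) (rule lux_le, simp_all)
  ultimately show ?thesis
    using r cls_carrier[OF good_h] by blast
qed

end

text \<open>A functional is stored through its values on a dense sequence.\<close>

lemma (in normed_space) separable_functional_encoding: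
  assumes sep: "separable_normed V"
  shows "\<exists>enc :: ('v \<Rightarrow> real) \<Rightarrow> (real \<Rightarrow> real) set.
    inj_on enc {f \<in> extensional (carrier V). bounded_functional V f}"
proof -
  obtain D where "countable D \<and> D \<subseteq> carrier V \<and> (\<forall>x\<in>carrier V. \<forall>e>0. \<exists>y\<in>D. nrm V (x \<ominus>\<^bsub>V\<^esub> y) < e)"
    using sep[unfolded separable_normed_iff] by (rule exE)
  then have D: "countable D" "D \<subseteq> carrier V"
    "\<And>x e. x \<in> carrier V \<Longrightarrow> 0 < e \<Longrightarrow> \<exists>y\<in>D. nrm V (x \<ominus>\<^bsub>V\<^esub> y) < e"
    by auto
  have "D \<noteq> {}" using D(3)[of "\<zero>\<^bsub>V\<^esub>" 1] by auto
  then have rng: "range (from_nat_into D) = D" using D(1) by (rule range_from_nat_into)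
  \<comment> \<open>Index \<open>n\<close> is recovered at the argument \<open>real n\<close>, and
    the singleton turns the resulting function into an element of the required type. Equal values on
    the dense sequence force equality by boundedness.\<close>
  define enc where "enc f = {\<lambda>t::real. f (from_nat_into D (nat \<lfloor>t\<rfloor>)) :: real}" for f
  have "inj_on enc {f \<in> extensional (carrier V). bounded_functional V f}"
  proof (rule inj_onI)
    fix f g assume "f \<in> {f \<in> extensional (carrier V). bounded_functional V f}"
      and "g \<in> {f \<in> extensional (carrier V). bounded_functional V f}" and eq: "enc f = enc g"
    then have ext: "f \<in> extensional (carrier V)" "g \<in> extensional (carrier V)"
      and bf: "bounded_functional V f" "bounded_functional V g" by auto
    interpret f: normed_functional V f by unfold_locales (rule bf)
    interpret g: normed_functional V g by unfold_locales (rule bf)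
    have on_D: "f y = g y" if y: "y \<in> D" for y
    proof -
      have "y \<in> range (from_nat_into D)" using y rng by simp
      then obtain n where n: "y = from_nat_into D n" by (rule rangeE)
      have "(\<lambda>t::real. f (from_nat_into D (nat \<lfloor>t\<rfloor>))) = (\<lambda>t. g (from_nat_into D (nat \<lfloor>t\<rfloor>)))"
        using eq unfolding enc_def by simp
      from fun_cong[OF this, of "real n"] show ?thesis by (simp add: n)
    qed
    obtain A where A: "A > 0" "\<And>x. x \<in> carrier V \<Longrightarrow> \<bar>f x\<bar> \<le> A * nrm V x"
      using f.f_bounded by blast
    obtain B where B: "B > 0" "\<And>x. x \<in> carrier V \<Longrightarrow> \<bar>g x\<bar> \<le> B * nrm V x"
      using g.f_bounded by blast
    have "f x = g x" if x: "x \<in> carrier V" for x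
    proof -
      have "\<bar>f x - g x\<bar> \<le> 0 + e" if e: "0 < e" for e
      proof -
        obtain y where y: "y \<in> D" "nrm V (x \<ominus>\<^bsub>V\<^esub> y) < e / (A + B)"
          using D(3)[OF x, of "e / (A + B)"] e A(1) B(1) by auto
        have yV: "y \<in> carrier V" using y(1) D(2) by auto
        have "f x - g x = f (x \<ominus>\<^bsub>V\<^esub> y) - g (x \<ominus>\<^bsub>V\<^esub> y)"
          using x yV on_D[OF y(1)] by simp
        then have "\<bar>f x - g x\<bar> \<le> (A + B) * nrm V (x \<ominus>\<^bsub>V\<^esub> y)"
          using A(2)[OF minus_mem[OF x yV]] B(2)[OF minus_mem[OF x yV]] unfolding distrib_right by linarith
        also have "\<dots> \<le> (A + B) * (e / (A + B))"
          using y(2) A(1) B(1) by (intro mult_left_mono) auto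
        also have "\<dots> = e" using A(1) B(1) by simp
        finally show ?thesis by simp
      qed
      then have "\<bar>f x - g x\<bar> \<le> 0" by (rule field_le_epsilon)
      then show ?thesis by simp
    qed
    then show "f = g" using ext by (intro extensionalityI)
  qed
  then show ?thesis by blast
qed

theorem theorem2p3:
  fixes \<gamma> :: ereal and w \<phi> :: "real \<Rightarrow> real"
  assumes "0 < \<gamma>"
    and "weight_function \<gamma> w"
    and "\<gamma> = \<infinity> \<Longrightarrow> weight_primitive w \<infinity> = \<infinity>"
    and "orlicz_N_function \<phi>"
    and "\<gamma> = \<infinity> \<Longrightarrow> Delta2 \<phi>"
    and "\<gamma> < \<infinity> \<Longrightarrow> Delta2_infty \<phi>"
  shows "separable_normed (orlicz_lorentz \<gamma> \<phi> w) \<and>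
         is_dual_space TYPE((real \<Rightarrow> real) set) (orlicz_lorentz \<gamma> \<phi> w) \<and>
         radon_nikodym_property TYPE('b) (orlicz_lorentz \<gamma> \<phi> w)"
proof -
  interpret orlicz_lorentz_delta2 \<gamma> w \<phi>
    using assms unfolding orlicz_N_function_def by unfold_locales auto
  interpret weakly_compact_ball V p
    by unfold_locales (fact p_bounded_functional p_separating V_ball_compact)+
  obtain enc :: "((real \<Rightarrow> real) set \<Rightarrow> real) \<Rightarrow> (real \<Rightarrow> real) set"
    where "inj_on enc {f \<in> extensional (carrier V). bounded_functional V f}"
    using V.separable_functional_encoding[OF V_separable] by blast
  then interpret encoded_predual V p enc
    by unfold_locales
  show ?thesis
    using V_separable is_dual_space radon_nikodym_property[OF V_separable] by blast
qed

end
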